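(* Let $k$ be a field, let $H$ be a group, let $R=\bigoplus_{h\in H}R_h$ be an $H$-graded algebra over $k$, and let $A$ be a finite abelian group such that $k$ is a splitting field of $A$. Let $\bar R$ be an $A$-refinement of $R$, and consider the corresponding twisting action of the character group $\widehat A$ on $\mathrm{Mod}^H\text{-}R$. Let $\pi\colon H\times A\to H$ be the canonical projection. Then the functor $$\Gamma\colon\mathrm{Mod}^{(H\times A)}\text{-}\bar R\longrightarrow(\mathrm{Mod}^H\text{-}R)^{\widehat A},\qquad\bar X\mapsto(\pi_*(\bar X),\gamma),$$ where $\gamma_\chi\colon\pi_*(\bar X)\to\pi_*(\bar X)^{\chi^{-1}}$ is given by $\gamma_\chi(x)=\chi^{-1}(a)x$ for $\chi\in\widehat A$ and $x\in\bar X_{(h,a)}$, and where $\Gamma$ acts on morphisms by $\pi_*$, is an isomorphism of categories. Moreover, it restricts to an isomorphism $$\Gamma\colon\mathrm{mod}^{(H\times A)}\text{-}\bar R\stackrel{\sim}\longrightarrow(\mathrm{mod}^H\text{-}R)^{\widehat A}.$$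
   Context: All modules are right modules. For a group $G$ and a $G$-graded algebra $B$, $\mathrm{Mod}^G\text{-}B$ is the category of $G$-graded $B$-modules with degree-preserving homomorphisms, and $\mathrm{mod}^G\text{-}B$ its full subcategory of finitely presented graded modules. $k$ is a splitting field of the finite abelian group $A$ if the group algebra $kA$ is isomorphic to a direct product of copies of $k$. $\widehat A$ is the group of linear characters of $A$ over $k$. For a homomorphism $\pi\colon G\to H$ of groups and a $G$-graded algebra $B$, $\pi_*(B)$ is the $H$-graded algebra equal to $B$ as an algebra, with $\pi_*(B)_h=\bigoplus_{g\in\pi^{-1}(h)}B_g$; for a $G$-graded $B$-module $X$, $\pi_*(X)$ is the $H$-graded $\pi_*(B)$-module equal to $X$ as a module with $\pi_*(X)_h=\bigoplus_{g\in\pi^{-1}(h)}X_g$; $\pi_*$ is the identity on morphisms. An $A$-refinement of $R$ is an $(H\times A)$-graded algebra $\bar R$ with $\pi_*(\bar R)=R$, where $\pi\colon H\times A\to H$ is the projection. It gives an action of $\widehat A$ on $R$ by $H$-graded algebra automorphisms: $\chi.r=\chi(a)r$ for $\chi\in\widehat A$, $r\in\bar R_{(h,a)}$. For an $H$-graded algebra automorphism $\sigma$ of $R$ and $X\in\mathrm{Mod}^H\text{-}R$, the twisted module $X^\sigma$ is $X$ as a graded space with new action $x\circ r=x.\sigma(r)$. The twisting action of $\widehat A$ on $\mathrm{Mod}^H\text{-}R$ (and on $\mathrm{mod}^H\text{-}R$) corresponding to $\bar R$ is the strict action $F_\chi=(-)^{\chi^{-1}}$, where $\chi^{-1}$ is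 regarded as an automorphism of $R$. For a strict action $g\mapsto F_g$ of a group $G$ on a category $\mathcal{C}$, $\mathcal{C}^G$ is the category of pairs $(X,\alpha)$ with $X\in\mathcal{C}$ and isomorphisms $\alpha_g\colon X\to F_g(X)$, $g\in G$, satisfying $\alpha_{gg'}=F_g(\alpha_{g'})\circ\alpha_g$; morphisms $(X,\alpha)\to(Y,\beta)$ are morphisms $\theta\colon X\to Y$ with $\beta_g\circ\theta=F_g(\theta)\circ\alpha_g$. *)

theory Defs
  imports "HOL-Algebra.Module" "HOL-Algebra.QuotRing"
begin

section \<open>Categories, isomorphisms of categories, equivariant objects\<close>

text \<open>Hom-sets of different pairs of objects may overlap, so composition carries its three
  objects and a functor acts on morphisms relative to their source and target.\<close>

record ('o, 'f) cat =
  Obj :: "'o set"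
  Mor :: "'o \<Rightarrow> 'o \<Rightarrow> 'f set"
  Idt :: "'o \<Rightarrow> 'f"
  Cmp :: "'o \<Rightarrow> 'o \<Rightarrow> 'o \<Rightarrow> 'f \<Rightarrow> 'f \<Rightarrow> 'f"

definition is_cat :: "('o, 'f) cat \<Rightarrow> bool" where
  "is_cat C \<longleftrightarrow>
     (\<forall>X\<in>Obj C. Idt C X \<in> Mor C X X) \<and>
     (\<forall>X\<in>Obj C. \<forall>Y\<in>Obj C. \<forall>Z\<in>Obj C. \<forall>f\<in>Mor C X Y. \<forall>g\<in>Mor C Y Z.
        Cmp C X Y Z g f \<in> Mor C X Z) \<and>
     (\<forall>X\<in>Obj C. \<forall>Y\<in>Obj C. \<forall>f\<in>Mor C X Y.
        Cmp C X X Y f (Idt C X) = f \<and> Cmp C X Y Y (Idt C Y) f = f) \<and>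
     (\<forall>W\<in>Obj C. \<forall>X\<in>Obj C. \<forall>Y\<in>Obj C. \<forall>Z\<in>Obj C.
        \<forall>f\<in>Mor C W X. \<forall>g\<in>Mor C X Y. \<forall>h\<in>Mor C Y Z.
        Cmp C W Y Z h (Cmp C W X Y g f) = Cmp C W X Z (Cmp C X Y Z h g) f)"

record ('o1, 'f1, 'o2, 'f2) cfun =
  fobj :: "'o1 \<Rightarrow> 'o2"
  fmor :: "'o1 \<Rightarrow> 'o1 \<Rightarrow> 'f1 \<Rightarrow> 'f2"

definition is_functor ::
    "('o1, 'f1) cat \<Rightarrow> ('o2, 'f2) cat \<Rightarrow> ('o1, 'f1, 'o2, 'f2) cfun \<Rightarrow> bool" where
  "is_functor C D F \<longleftrightarrow> is_cat C \<and> is_cat D \<and>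
     (\<forall>X\<in>Obj C. fobj F X \<in> Obj D) \<and>
     (\<forall>X\<in>Obj C. \<forall>Y\<in>Obj C. \<forall>f\<in>Mor C X Y. fmor F X Y f \<in> Mor D (fobj F X) (fobj F Y)) \<and>
     (\<forall>X\<in>Obj C. fmor F X X (Idt C X) = Idt D (fobj F X)) \<and>
     (\<forall>X\<in>Obj C. \<forall>Y\<in>Obj C. \<forall>Z\<in>Obj C. \<forall>f\<in>Mor C X Y. \<forall>g\<in>Mor C Y Z.
        fmor F X Z (Cmp C X Y Z g f)
          = Cmp D (fobj F X) (fobj F Y) (fobj F Z) (fmor F Y Z g) (fmor F X Y f))"

definition left_inverse ::
    "('o1, 'f1) cat \<Rightarrow> ('o1, 'f1, 'o2, 'f2) cfun \<Rightarrow> ('o2, 'f2, 'o1, 'f1) cfun \<Rightarrow> bool" where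
  "left_inverse C F G \<longleftrightarrow>
     (\<forall>X\<in>Obj C. fobj G (fobj F X) = X) \<and>
     (\<forall>X\<in>Obj C. \<forall>Y\<in>Obj C. \<forall>f\<in>Mor C X Y.
        fmor G (fobj F X) (fobj F Y) (fmor F X Y f) = f)"

definition cat_isomorphism ::
    "('o1, 'f1) cat \<Rightarrow> ('o2, 'f2) cat \<Rightarrow> ('o1, 'f1, 'o2, 'f2) cfun \<Rightarrow> bool" where
  "cat_isomorphism C D F \<longleftrightarrow> is_functor C D F \<and>
     (\<exists>G. is_functor D C G \<and> left_inverse C F G \<and> left_inverse D G F)"

definition is_iso :: "('o, 'f) cat \<Rightarrow> 'o \<Rightarrow> 'o \<Rightarrow> 'f \<Rightarrow> bool" where
  "is_iso C X Y f \<longleftrightarrow> X \<in> Obj C \<and> Y \<in> Obj C \<and> f \<in> Mor C X Y \<and>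
     (\<exists>g\<in>Mor C Y X. Cmp C X Y X g f = Idt C X \<and> Cmp C Y X Y f g = Idt C Y)"

definition full_subcat :: "('o, 'f) cat \<Rightarrow> ('o \<Rightarrow> bool) \<Rightarrow> ('o, 'f) cat" where
  "full_subcat C P = C \<lparr>Obj := {X \<in> Obj C. P X}\<rparr>"

text \<open>The category of equivariant objects, for a strict action \<open>F\<close> of the group \<open>G\<close> on \<open>C\<close>.
  The family \<open>\<alpha>\<close> is made \<open>undefined\<close> outside of \<open>G\<close>, so that equality of objects
  only depends on \<open>\<alpha>\<close> as a family indexed by \<open>G\<close>.\<close>

definition equivariant_cat ::
    "('x, 'y) monoid_scheme \<Rightarrow> ('o, 'f) cat \<Rightarrow> ('x \<Rightarrow> ('o, 'f, 'o, 'f) cfun)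
      \<Rightarrow> ('o \<times> ('x \<Rightarrow> 'f), 'f) cat" where
  "equivariant_cat G C F =
     \<lparr>Obj = {(X, \<alpha>). X \<in> Obj C \<and> \<alpha> \<in> extensional (carrier G) \<and>
        (\<forall>g\<in>carrier G. is_iso C X (fobj (F g) X) (\<alpha> g)) \<and>
        (\<forall>g\<in>carrier G. \<forall>g'\<in>carrier G.
           \<alpha> (g \<otimes>\<^bsub>G\<^esub> g') =
             Cmp C X (fobj (F g) X) (fobj (F g) (fobj (F g') X))
               (fmor (F g) X (fobj (F g') X) (\<alpha> g')) (\<alpha> g))},
      Mor = (\<lambda>(X, \<alpha>) (Y, \<beta>). {\<theta> \<in> Mor C X Y. \<forall>g\<in>carrier G.
        Cmp C X Y (fobj (F g) Y) (\<beta> g) \<theta>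
          = Cmp C X (fobj (F g) X) (fobj (F g) Y) (fmor (F g) X Y \<theta>) (\<alpha> g)}),
      Idt = (\<lambda>(X, \<alpha>). Idt C X),
      Cmp = (\<lambda>(X, \<alpha>) (Y, \<beta>) (Z, \<gamma>). Cmp C X Y Z)\<rparr>"

section \<open>Graded algebras and graded right modules\<close>

text \<open>One record type serves for graded algebras and for graded modules. In a
  \<open>k\<close>-algebra, \<open>smult\<close> is the scalar multiplication by \<open>k\<close>. In a right module over \<open>B\<close>,
  \<open>r \<odot>\<^bsub>X\<^esub> x\<close> stands for the right action \<open>x.r\<close> of \<open>r\<close> in \<open>B\<close>.\<close>

record ('b, 'm, 'g) graded = "('b, 'm) module" +
  grade :: "'g \<Rightarrow> 'm set"

abbreviation (input) ract :: "('b, 'm, 'z) module_scheme \<Rightarrow> 'm \<Rightarrow> 'b \<Rightarrow> 'm" where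
  "ract X x r \<equiv> r \<odot>\<^bsub>X\<^esub> x"

definition hsupport :: "('g, 'y) monoid_scheme \<Rightarrow> ('b, 'm, 'g) graded \<Rightarrow> ('g \<Rightarrow> 'm) \<Rightarrow> 'g set" where
  "hsupport G X c = {g \<in> carrier G. c g \<noteq> \<zero>\<^bsub>X\<^esub>}"

definition is_decomposition ::
    "('g, 'y) monoid_scheme \<Rightarrow> ('b, 'm, 'g) graded \<Rightarrow> 'm \<Rightarrow> ('g \<Rightarrow> 'm) \<Rightarrow> bool" where
  "is_decomposition G X x c \<longleftrightarrow>
     c \<in> (\<Pi>\<^sub>E g\<in>carrier G. grade X g) \<and> finite (hsupport G X c) \<and>
     x = (\<Oplus>\<^bsub>X\<^esub>g\<in>hsupport G X c. c g)"

text \<open>\<open>X\<close> is the internal direct sum of the additive subgroups \<open>grade X g\<close>. The grading is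
  \<open>undefined\<close> outside of \<open>G\<close>, so that it is determined by its components.\<close>

definition is_grading :: "('g, 'y) monoid_scheme \<Rightarrow> ('b, 'm, 'g) graded \<Rightarrow> bool" where
  "is_grading G X \<longleftrightarrow> grade X \<in> extensional (carrier G) \<and>
     (\<forall>g\<in>carrier G. additive_subgroup (grade X g) X) \<and>
     (\<forall>x\<in>carrier X. \<exists>!c. is_decomposition G X x c)"

definition hparts :: "('g, 'y) monoid_scheme \<Rightarrow> ('b, 'm, 'g) graded \<Rightarrow> 'm \<Rightarrow> 'g \<Rightarrow> 'm" where
  "hparts G X x = (THE c. is_decomposition G X x c)"

text \<open>The library locale \<open>algebra\<close> is restricted to commutative algebras.\<close>

locale graded_algebra = K?: field K + B?: ring B + module K B + G?: group G
  for K (structure) and G (structure) and B :: "('k, 'b, 'g) graded" (structure) +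
  assumes smult_mult_left:
      "\<lbrakk>a \<in> carrier K; x \<in> carrier B; y \<in> carrier B\<rbrakk> \<Longrightarrow>
        a \<odot>\<^bsub>B\<^esub> (x \<otimes>\<^bsub>B\<^esub> y) = (a \<odot>\<^bsub>B\<^esub> x) \<otimes>\<^bsub>B\<^esub> y"
    and smult_mult_right:
      "\<lbrakk>a \<in> carrier K; x \<in> carrier B; y \<in> carrier B\<rbrakk> \<Longrightarrow>
        a \<odot>\<^bsub>B\<^esub> (x \<otimes>\<^bsub>B\<^esub> y) = x \<otimes>\<^bsub>B\<^esub> (a \<odot>\<^bsub>B\<^esub> y)"
    and grading: "is_grading G B"
    and grade_subspace: "g \<in> carrier G \<Longrightarrow> submodule (grade B g) K B"
    and grade_mult:
      "\<lbrakk>g \<in> carrier G; h \<in> carrier G; x \<in> grade B g; y \<in> grade B h\<rbrakk> \<Longrightarrow>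
        x \<otimes>\<^bsub>B\<^esub> y \<in> grade B (g \<otimes>\<^bsub>G\<^esub> h)"

text \<open>The fields of the record that carry no information (\<open>mult\<close> and \<open>one\<close>, and the values of the
  operations outside of the carriers) are fixed, so that two graded modules are equal
  as records iff they are equal as mathematical objects.\<close>

locale graded_module = G?: group G + B?: ring B + X?: abelian_group X
  for G (structure) and B :: "('k, 'b, 'g) graded" (structure)
    and X :: "('b, 'm, 'g) graded" (structure) +
  assumes ract_closed: "\<lbrakk>x \<in> carrier X; r \<in> carrier B\<rbrakk> \<Longrightarrow> ract X x r \<in> carrier X"
    and ract_add_left: "\<lbrakk>x \<in> carrier X; y \<in> carrier X; r \<in> carrier B\<rbrakk> \<Longrightarrow>
        ract X (x \<oplus>\<^bsub>X\<^esub> y) r = ract X x r \<oplus>\<^bsub>X\<^esub> ract X y r"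
    and ract_add_right: "\<lbrakk>x \<in> carrier X; r \<in> carrier B; s \<in> carrier B\<rbrakk> \<Longrightarrow>
        ract X x (r \<oplus>\<^bsub>B\<^esub> s) = ract X x r \<oplus>\<^bsub>X\<^esub> ract X x s"
    and ract_mult: "\<lbrakk>x \<in> carrier X; r \<in> carrier B; s \<in> carrier B\<rbrakk> \<Longrightarrow>
        ract X x (r \<otimes>\<^bsub>B\<^esub> s) = ract X (ract X x r) s"
    and ract_one: "x \<in> carrier X \<Longrightarrow> ract X x \<one>\<^bsub>B\<^esub> = x"
    and module_grading: "is_grading G X"
    and grade_ract: "\<lbrakk>g \<in> carrier G; h \<in> carrier G; x \<in> grade X g; r \<in> grade B h\<rbrakk> \<Longrightarrow>
        ract X x r \<in> grade X (g \<otimes>\<^bsub>G\<^esub> h)"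
    and mult_irrelevant: "mult X = undefined"
    and one_irrelevant: "one X = undefined"
    and add_ext: "add X = (\<lambda>x\<in>carrier X. \<lambda>y\<in>carrier X. x \<oplus>\<^bsub>X\<^esub> y)"
    and smult_ext: "smult X = (\<lambda>r\<in>carrier B. \<lambda>x\<in>carrier X. r \<odot>\<^bsub>X\<^esub> x)"

definition graded_hom ::
    "('g, 'y) monoid_scheme \<Rightarrow> ('k, 'b, 'g) graded \<Rightarrow> ('b, 'm, 'g) graded \<Rightarrow> ('b, 'n, 'g) graded
      \<Rightarrow> ('m \<Rightarrow> 'n) set" where
  "graded_hom G B X Y = {f \<in> carrier X \<rightarrow>\<^sub>E carrier Y.
     (\<forall>x\<in>carrier X. \<forall>y\<in>carrier X. f (x \<oplus>\<^bsub>X\<^esub> y) = f x \<oplus>\<^bsub>Y\<^esub> f y) \<and>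
     (\<forall>x\<in>carrier X. \<forall>r\<in>carrier B. f (ract X x r) = ract Y (f x) r) \<and>
     (\<forall>g\<in>carrier G. f ` grade X g \<subseteq> grade Y g)}"

definition grMod ::
    "('g, 'y) monoid_scheme \<Rightarrow> ('k, 'b, 'g) graded \<Rightarrow> (('b, 'm, 'g) graded, 'm \<Rightarrow> 'm) cat" where
  "grMod G B =
     \<lparr>Obj = {X. graded_module G B X},
      Mor = (\<lambda>X Y. graded_hom G B X Y),
      Idt = (\<lambda>X. \<lambda>x\<in>carrier X. x),
      Cmp = (\<lambda>X Y Z g f. compose (carrier X) g f)\<rparr>"

text \<open>The graded free right module whose \<open>i\<close>-th basis element has degree \<open>gs ! i\<close>: the
  component of degree \<open>g\<close> of its \<open>i\<close>-th summand is the component of \<open>B\<close> of degree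
  \<open>(gs ! i)\<^sup>-\<^sup>1 g\<close>.\<close>

definition free_graded ::
    "('g, 'y) monoid_scheme \<Rightarrow> ('k, 'b, 'g) graded \<Rightarrow> 'g list \<Rightarrow> ('b, nat \<Rightarrow> 'b, 'g) graded" where
  "free_graded G B gs = (let C = {..<length gs} \<rightarrow>\<^sub>E carrier B in
     \<lparr>carrier = C, mult = undefined, one = undefined,
      zero = (\<lambda>i\<in>{..<length gs}. \<zero>\<^bsub>B\<^esub>),
      add = (\<lambda>u\<in>C. \<lambda>v\<in>C. \<lambda>i\<in>{..<length gs}. u i \<oplus>\<^bsub>B\<^esub> v i),
      smult = (\<lambda>r\<in>carrier B. \<lambda>u\<in>C. \<lambda>i\<in>{..<length gs}. u i \<otimes>\<^bsub>B\<^esub> r),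
      grade = (\<lambda>g\<in>carrier G. \<Pi>\<^sub>E i\<in>{..<length gs}. grade B (inv\<^bsub>G\<^esub> (gs ! i) \<otimes>\<^bsub>G\<^esub> g))\<rparr>)"

text \<open>There is an exact sequence \<open>F\<^sub>1 \<rightarrow> F\<^sub>0 \<rightarrow> X \<rightarrow> 0\<close> of graded modules with finitely generated
  graded free modules \<open>F\<^sub>0\<close> and \<open>F\<^sub>1\<close>.\<close>

definition fin_presented ::
    "('g, 'y) monoid_scheme \<Rightarrow> ('k, 'b, 'g) graded \<Rightarrow> ('b, 'm, 'g) graded \<Rightarrow> bool" where
  "fin_presented G B X \<longleftrightarrow> (\<exists>gs hs \<phi> \<epsilon>. set gs \<subseteq> carrier G \<and> set hs \<subseteq> carrier G \<and>
     \<phi> \<in> graded_hom G B (free_graded G B hs) (free_graded G B gs) \<and>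
     \<epsilon> \<in> graded_hom G B (free_graded G B gs) X \<and>
     \<epsilon> ` carrier (free_graded G B gs) = carrier X \<and>
     \<phi> ` carrier (free_graded G B hs) = {u \<in> carrier (free_graded G B gs). \<epsilon> u = \<zero>\<^bsub>X\<^esub>})"

definition fp_grMod ::
    "('g, 'y) monoid_scheme \<Rightarrow> ('k, 'b, 'g) graded \<Rightarrow> (('b, 'm, 'g) graded, 'm \<Rightarrow> 'm) cat" where
  "fp_grMod G B = full_subcat (grMod G B) (fin_presented G B)"

section \<open>Change of grading group and refinements\<close>

definition pushforward ::
    "('g \<Rightarrow> 'h) \<Rightarrow> ('g, 'y) monoid_scheme \<Rightarrow> ('h, 'z) monoid_scheme
      \<Rightarrow> ('b, 'm, 'g) graded \<Rightarrow> ('b, 'm, 'h) graded" where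
  "pushforward \<pi> G H X =
     \<lparr>carrier = carrier X, mult = mult X, one = one X, zero = zero X, add = add X,
      smult = smult X,
      grade = (\<lambda>h\<in>carrier H. {\<Oplus>\<^bsub>X\<^esub>g\<in>S. c g | S c.
        finite S \<and> S \<subseteq> {g \<in> carrier G. \<pi> g = h} \<and> c \<in> (\<Pi> g\<in>S. grade X g)})\<rparr>"

definition is_refinement ::
    "('k, 'w) ring_scheme \<Rightarrow> ('h, 'y) monoid_scheme \<Rightarrow> ('a, 'z) monoid_scheme
      \<Rightarrow> ('k, 'b, 'h) graded \<Rightarrow> ('k, 'b, 'h \<times> 'a) graded \<Rightarrow> bool" where
  "is_refinement K H A R Rb \<longleftrightarrow>
     graded_algebra K (H \<times>\<times> A) Rb \<and> pushforward fst (H \<times>\<times> A) H Rb = R"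

section \<open>Splitting fields and characters\<close>

definition group_algebra ::
    "('k, 'w) ring_scheme \<Rightarrow> ('a, 'y) monoid_scheme \<Rightarrow> ('k, 'a \<Rightarrow> 'k) module" where
  "group_algebra K A =
     \<lparr>carrier = carrier A \<rightarrow>\<^sub>E carrier K,
      mult = (\<lambda>u v. \<lambda>a\<in>carrier A. \<Oplus>\<^bsub>K\<^esub>b\<in>carrier A. u b \<otimes>\<^bsub>K\<^esub> v (inv\<^bsub>A\<^esub> b \<otimes>\<^bsub>A\<^esub> a)),
      one = (\<lambda>a\<in>carrier A. if a = \<one>\<^bsub>A\<^esub> then \<one>\<^bsub>K\<^esub> else \<zero>\<^bsub>K\<^esub>),
      zero = (\<lambda>a\<in>carrier A. \<zero>\<^bsub>K\<^esub>),
      add = (\<lambda>u v. \<lambda>a\<in>carrier A. u a \<oplus>\<^bsub>K\<^esub> v a),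
      smult = (\<lambda>t u. \<lambda>a\<in>carrier A. t \<otimes>\<^bsub>K\<^esub> u a)\<rparr>"

definition product_algebra :: "('k, 'w) ring_scheme \<Rightarrow> nat \<Rightarrow> ('k, nat \<Rightarrow> 'k) module" where
  "product_algebra K n =
     \<lparr>carrier = {..<n} \<rightarrow>\<^sub>E carrier K,
      mult = (\<lambda>u v. \<lambda>i\<in>{..<n}. u i \<otimes>\<^bsub>K\<^esub> v i),
      one = (\<lambda>i\<in>{..<n}. \<one>\<^bsub>K\<^esub>),
      zero = (\<lambda>i\<in>{..<n}. \<zero>\<^bsub>K\<^esub>),
      add = (\<lambda>u v. \<lambda>i\<in>{..<n}. u i \<oplus>\<^bsub>K\<^esub> v i),
      smult = (\<lambda>t u. \<lambda>i\<in>{..<n}. t \<otimes>\<^bsub>K\<^esub> u i)\<rparr>"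

text \<open>The number of copies of \<open>K\<close> may be taken finite because the group algebra of a finite
  group is finite-dimensional.\<close>

definition splitting_field :: "('k, 'w) ring_scheme \<Rightarrow> ('a, 'y) monoid_scheme \<Rightarrow> bool" where
  "splitting_field K A \<longleftrightarrow>
     (\<exists>n. \<exists>\<Phi>\<in>ring_iso (group_algebra K A) (product_algebra K n).
        \<forall>t\<in>carrier K. \<forall>u\<in>carrier (group_algebra K A).
          \<Phi> (t \<odot>\<^bsub>group_algebra K A\<^esub> u) = t \<odot>\<^bsub>product_algebra K n\<^esub> \<Phi> u)"

definition char_group :: "('k, 'w) ring_scheme \<Rightarrow> ('a, 'y) monoid_scheme \<Rightarrow> ('a \<Rightarrow> 'k) monoid" where
  "char_group K A =
     \<lparr>carrier = hom A (units_of K) \<inter> extensional (carrier A),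
      mult = (\<lambda>\<chi> \<psi>. \<lambda>a\<in>carrier A. \<chi> a \<otimes>\<^bsub>K\<^esub> \<psi> a),
      one = (\<lambda>a\<in>carrier A. \<one>\<^bsub>K\<^esub>)\<rparr>"

section \<open>The twisting action and the functor \<open>\<Gamma>\<close>\<close>

text \<open>The additive extension of \<open>\<chi>.r = \<chi>(a) r\<close> for homogeneous \<open>r\<close> of degree \<open>(h, a)\<close>.\<close>

definition char_act ::
    "('h, 'y) monoid_scheme \<Rightarrow> ('a, 'z) monoid_scheme \<Rightarrow> ('k, 'b, 'h \<times> 'a) graded
      \<Rightarrow> ('a \<Rightarrow> 'k) \<Rightarrow> 'b \<Rightarrow> 'b" where
  "char_act H A Rb \<chi> = (\<lambda>r\<in>carrier Rb. let c = hparts (H \<times>\<times> A) Rb r in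
     \<Oplus>\<^bsub>Rb\<^esub>p\<in>hsupport (H \<times>\<times> A) Rb c. \<chi> (snd p) \<odot>\<^bsub>Rb\<^esub> c p)"

definition twist ::
    "('k, 'b, 'h) graded \<Rightarrow> ('b \<Rightarrow> 'b) \<Rightarrow> ('b, 'm, 'h) graded \<Rightarrow> ('b, 'm, 'h) graded" where
  "twist R \<sigma> X = X \<lparr>smult := (\<lambda>r\<in>carrier R. \<lambda>x\<in>carrier X. ract X x (\<sigma> r))\<rparr>"

definition twisting_action ::
    "('k, 'w) ring_scheme \<Rightarrow> ('h, 'y) monoid_scheme \<Rightarrow> ('a, 'z) monoid_scheme
      \<Rightarrow> ('k, 'b, 'h) graded \<Rightarrow> ('k, 'b, 'h \<times> 'a) graded \<Rightarrow> ('a \<Rightarrow> 'k)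
      \<Rightarrow> (('b, 'm, 'h) graded, 'm \<Rightarrow> 'm, ('b, 'm, 'h) graded, 'm \<Rightarrow> 'm) cfun" where
  "twisting_action K H A R Rb \<chi> =
     \<lparr>fobj = twist R (char_act H A Rb (inv\<^bsub>char_group K A\<^esub> \<chi>)),
      fmor = (\<lambda>X Y f. f)\<rparr>"

text \<open>The additive extension of \<open>x \<mapsto> \<chi>\<^sup>-\<^sup>1(a) x\<close> for homogeneous \<open>x\<close> of degree \<open>(h, a)\<close>. A scalar
  \<open>t\<close> of the ground field acts on a module through the element \<open>t.1\<close> of the algebra.\<close>

definition gamma ::
    "('k, 'w) ring_scheme \<Rightarrow> ('h, 'y) monoid_scheme \<Rightarrow> ('a, 'z) monoid_scheme
      \<Rightarrow> ('k, 'b, 'h \<times> 'a) graded \<Rightarrow> ('b, 'm, 'h \<times> 'a) graded \<Rightarrow> ('a \<Rightarrow> 'k) \<Rightarrow> 'm \<Rightarrow> 'm" where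
  "gamma K H A Rb X \<chi> = (\<lambda>x\<in>carrier X. let c = hparts (H \<times>\<times> A) X x in
     \<Oplus>\<^bsub>X\<^esub>p\<in>hsupport (H \<times>\<times> A) X c.
       ract X (c p) ((inv\<^bsub>char_group K A\<^esub> \<chi>) (snd p) \<odot>\<^bsub>Rb\<^esub> \<one>\<^bsub>Rb\<^esub>))"

definition Gamma ::
    "('k, 'w) ring_scheme \<Rightarrow> ('h, 'y) monoid_scheme \<Rightarrow> ('a, 'z) monoid_scheme
      \<Rightarrow> ('k, 'b, 'h \<times> 'a) graded
      \<Rightarrow> (('b, 'm, 'h \<times> 'a) graded, 'm \<Rightarrow> 'm,
          ('b, 'm, 'h) graded \<times> (('a \<Rightarrow> 'k) \<Rightarrow> 'm \<Rightarrow> 'm), 'm \<Rightarrow> 'm) cfun" where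
  "Gamma K H A Rb =
     \<lparr>fobj = (\<lambda>X. (pushforward fst (H \<times>\<times> A) H X,
                    \<lambda>\<chi>\<in>carrier (char_group K A). gamma K H A Rb X \<chi>)),
      fmor = (\<lambda>X Y f. f)\<rparr>"

end

theory Submission
  imports Defs "HOL-Algebra.Polynomial_Divisibility"
begin

no_notation var (\<open>X\<index>\<close>)
hide_const (open) Multiset.mult

text \<open>
  The inverse of \<open>\<Gamma>\<close> equips an equivariant object \<open>(X, \<alpha>)\<close> with the grading whose component of
  degree \<open>(h, a)\<close> consists of the \<open>x\<close> in \<open>X\<^sub>h\<close> with \<open>\<alpha>\<^sub>\<chi>(x) = \<chi>\<^sup>-\<^sup>1(a) x\<close> for all characters \<open>\<chi>\<close>.
  Since \<open>k\<close> is a splitting field, characters separate the elements of \<open>A\<close>, there are finitely many of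
  them and the order of \<open>A\<close> is invertible in \<open>k\<close>; hence the maps \<open>|A|\<^sup>-\<^sup>1 \<Sum>\<^sub>\<chi> \<chi>(a) \<alpha>\<^sub>\<chi>\<close> are the projections onto these
  components. For the second claim, a graded module is finitely presented as a graded module iff it is
  finitely presented as an ungraded module: homogeneous components of generators generate, and by Schanuel's
  argument the kernel of any map from a finitely generated free module onto a finitely presented module is
  finitely generated. So finite presentability is not affected by forgetting the second degree.
\<close>

section \<open>Graded abelian groups\<close>

text \<open>Both passages keep the underlying module and all maps and trade a grading for a family
  of maps, so they can invert each other up to equality. The eigenspaces respect the action because
  \<open>\<alpha> \<chi>\<close> is linear only up to the automorphism \<open>\<chi>^-1\<close> of
  the algebra: on a product \<open>x r\<close> of an eigenvector and a homogeneous element the two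
  eigenvalues multiply, as degrees do. That the averaging map for \<open>a\<close> fixes the vectors
  of degree \<open>a\<close> comes out of two orthogonality relations. Summing over \<open>A\<close>
  leaves the trivial character alone, so the averaging maps add up to the identity; summing over
  characters, the map for \<open>b\<close> kills degree \<open>a\<close> if
  \<open>b \<noteq> a\<close>, as some character separates the two. Only the map for
  \<open>a\<close> remains. The obstacle in the second claim is that a presentation by
  \<open>H\<close>-graded free modules has generators and relations that are homogeneous for the
  first degree only. Making the generators homogeneous in both changes the family, and its relations
  have to be shown finitely generated anew.\<close>

lemma (in abelian_monoid) finsum_swap:
  assumes "finite I" "\<And>i j. i \<in> I \<Longrightarrow> j \<in> J \<Longrightarrow> f i j \<in> carrier G"
  shows "(\<Oplus>i\<in>I. \<Oplus>j\<in>J. f i j) = (\<Oplus>j\<in>J. \<Oplus>i\<in>I. f i j)"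
  using assms
proof (induction I rule: finite_induct)
  case (insert i I)
  have "(\<Oplus>j\<in>J. \<Oplus>i\<in>insert i I. f i j) = (\<Oplus>j\<in>J. f i j \<oplus> (\<Oplus>i\<in>I. f i j))"
    using insert by (intro finsum_cong') (auto intro!: finsum_insert finsum_closed)
  also have "\<dots> = (\<Oplus>j\<in>J. f i j) \<oplus> (\<Oplus>j\<in>J. \<Oplus>i\<in>I. f i j)"
    using insert by (intro finsum_addf) (auto intro!: finsum_closed)
  finally show ?case
    using insert by (subst finsum_insert) (auto intro!: finsum_closed)
qed simp

text \<open>Only the additive group and its grading, so that the lemmas serve algebras and modules
  alike, graded by \<open>H\<close> or by \<open>H \<times>\<times> A\<close>.\<close>

locale graded_group = abelian_group X
  for G :: "('g, 'y) monoid_scheme" and X :: "('b, 'm, 'g) graded" (structure) +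
  assumes is_grading: "is_grading G X"
begin

lemma grade_extensional: "grade X \<in> extensional (carrier G)"
  using is_grading by (simp add: is_grading_def)

lemma grade_subgroup: "g \<in> carrier G \<Longrightarrow> additive_subgroup (grade X g) X"
  using is_grading by (simp add: is_grading_def)

lemma grade_carrier: "g \<in> carrier G \<Longrightarrow> x \<in> grade X g \<Longrightarrow> x \<in> carrier X"
  using additive_subgroup.a_subset[OF grade_subgroup] by blast

lemma grade_zero: "g \<in> carrier G \<Longrightarrow> \<zero> \<in> grade X g"
  by (rule additive_subgroup.zero_closed[OF grade_subgroup])

lemma grade_add: "g \<in> carrier G \<Longrightarrow> x \<in> grade X g \<Longrightarrow> y \<in> grade X g \<Longrightarrow> x \<oplus> y \<in> grade X g"
  by (rule additive_subgroup.a_closed[OF grade_subgroup])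

lemma grade_finsum:
  assumes "g \<in> carrier G" "\<And>i. i \<in> I \<Longrightarrow> f i \<in> grade X g"
  shows "(\<Oplus>i\<in>I. f i) \<in> grade X g"
  using assms
proof (induction I rule: infinite_finite_induct)
  case (insert i I)
  then have "f \<in> I \<rightarrow> carrier X" "f i \<in> carrier X" by (auto intro: grade_carrier)
  with insert show ?case by (simp add: grade_add)
qed (auto simp: grade_zero)

lemma decomposition_unique:
  assumes "is_decomposition G X x c"
  shows "hparts G X x = c"
proof -
  have "c g \<in> carrier X" if "g \<in> carrier G" for g
    using assms that by (auto simp: is_decomposition_def PiE_iff intro: grade_carrier)
  then have "x \<in> carrier X"
    using assms by (auto simp: is_decomposition_def hsupport_def intro!: finsum_closed)
  then have "\<exists>!c. is_decomposition G X x c"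
    using is_grading by (simp add: is_grading_def)
  then show ?thesis
    unfolding hparts_def by (rule the1_equality) (rule assms)
qed

lemma decomposition_hparts: "x \<in> carrier X \<Longrightarrow> is_decomposition G X x (hparts G X x)"
  unfolding hparts_def
  by (rule theI'[of "is_decomposition G X x"]) (use is_grading in \<open>simp add: is_grading_def\<close>)

lemma hparts_extensional: "x \<in> carrier X \<Longrightarrow> hparts G X x \<in> extensional (carrier G)"
  using decomposition_hparts by (auto simp: is_decomposition_def PiE_iff)

lemma hparts_grade: "x \<in> carrier X \<Longrightarrow> g \<in> carrier G \<Longrightarrow> hparts G X x g \<in> grade X g"
  using decomposition_hparts by (auto simp: is_decomposition_def PiE_iff)

lemma hparts_closed: "x \<in> carrier X \<Longrightarrow> g \<in> carrier G \<Longrightarrow> hparts G X x g \<in> carrier X"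
  using hparts_grade grade_carrier by blast

lemma finite_hsupport: "x \<in> carrier X \<Longrightarrow> finite (hsupport G X (hparts G X x))"
  using decomposition_hparts by (auto simp: is_decomposition_def)

lemma sum_hparts: "x \<in> carrier X \<Longrightarrow> (\<Oplus>g\<in>hsupport G X (hparts G X x). hparts G X x g) = x"
  using decomposition_hparts by (auto simp: is_decomposition_def)

text \<open>\<open>S\<close> may exceed the support of \<open>c\<close>. A pointwise operation on
  two decompositions then needs no computation of the new support: the union of the old ones will
  do.\<close>

lemma decompositionI:
  assumes "finite S" "S \<subseteq> carrier G" "\<And>g. g \<in> carrier G \<Longrightarrow> c g \<in> grade X g"
    and "\<And>g. g \<in> carrier G - S \<Longrightarrow> c g = \<zero>" and "x = (\<Oplus>g\<in>S. c g)"
  shows "is_decomposition G X x (restrict c (carrier G))"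
proof -
  have sub: "hsupport G X (restrict c (carrier G)) \<subseteq> S"
    using assms(4) by (auto simp: hsupport_def)
  have "(\<Oplus>g\<in>S. c g) = (\<Oplus>g\<in>hsupport G X (restrict c (carrier G)). restrict c (carrier G) g)"
    using assms(1,2,3) sub
    by (intro add.finprod_mono_neutral_cong_right)
      (auto simp: hsupport_def intro: grade_carrier)
  then show ?thesis
    using assms finite_subset[OF sub] by (auto simp: is_decomposition_def)
qed

lemma hparts_homogeneous:
  assumes "g \<in> carrier G" "x \<in> grade X g" "h \<in> carrier G"
  shows "hparts G X x h = (if h = g then x else \<zero>)"
proof -
  have "is_decomposition G X x (restrict (\<lambda>h. if h = g then x else \<zero>) (carrier G))"
    using assms by (intro decompositionI[of "{g}"]) (auto simp: grade_zero grade_carrier)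
  then show ?thesis
    using assms by (simp add: decomposition_unique)
qed

lemma sum_hparts_superset:
  assumes "x \<in> carrier X" "finite S" "hsupport G X (hparts G X x) \<subseteq> S" "S \<subseteq> carrier G"
  shows "x = (\<Oplus>g\<in>S. hparts G X x g)"
proof -
  have "(\<Oplus>g\<in>S. hparts G X x g) = (\<Oplus>g\<in>hsupport G X (hparts G X x). hparts G X x g)"
    using assms by (intro add.finprod_mono_neutral_cong_right)
      (auto simp: hsupport_def intro: hparts_closed)
  then show ?thesis using assms sum_hparts by simp
qed

lemma hparts_add:
  assumes "x \<in> carrier X" "y \<in> carrier X" "g \<in> carrier G"
  shows "hparts G X (x \<oplus> y) g = hparts G X x g \<oplus> hparts G X y g"
proof -
  let ?S = "hsupport G X (hparts G X x) \<union> hsupport G X (hparts G X y)"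
  have S: "finite ?S" "?S \<subseteq> carrier G"
    using assms finite_hsupport by (auto simp: hsupport_def)
  have fx: "hparts G X x \<in> ?S \<rightarrow> carrier X" and fy: "hparts G X y \<in> ?S \<rightarrow> carrier X"
    using assms by (auto simp: hsupport_def intro: hparts_closed)
  have ex: "x = (\<Oplus>g\<in>?S. hparts G X x g)" and ey: "y = (\<Oplus>g\<in>?S. hparts G X y g)"
    by (rule sum_hparts_superset[OF assms(1) S(1) _ S(2)], simp,
      rule sum_hparts_superset[OF assms(2) S(1) _ S(2)], simp)
  have e: "x \<oplus> y = (\<Oplus>g\<in>?S. hparts G X x g \<oplus> hparts G X y g)"
    unfolding finsum_addf[OF fx fy] ex[symmetric] ey[symmetric] by (rule refl)
  have "is_decomposition G X (x \<oplus> y)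
      (restrict (\<lambda>g. hparts G X x g \<oplus> hparts G X y g) (carrier G))"
    using S e assms(1,2)
    by (intro decompositionI[of ?S]) (auto simp: hparts_grade grade_add hsupport_def)
  then show ?thesis
    using assms by (simp add: decomposition_unique)
qed

lemma hparts_zero: "g \<in> carrier G \<Longrightarrow> hparts G X \<zero> g = \<zero>"
  using hparts_homogeneous[of g \<zero> g] grade_zero by simp

lemma hparts_eqI:
  assumes "x \<in> carrier X" "y \<in> carrier X"
    and "\<And>g. g \<in> carrier G \<Longrightarrow> hparts G X x g = hparts G X y g"
  shows "x = y"
proof -
  have "hparts G X x = hparts G X y"
    using assms by (intro extensionalityI[of _ "carrier G"] hparts_extensional) auto
  then have "(\<Oplus>g\<in>hsupport G X (hparts G X x). hparts G X x g)
      = (\<Oplus>g\<in>hsupport G X (hparts G X y). hparts G X y g)" by (simp only:)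
  then show ?thesis by (simp only: sum_hparts assms(1,2))
qed

text \<open>An element is a finite sum of its components, so a property stable under addition has to
  be checked on homogeneous elements only. Identities between additive maps are proved in this way
  throughout.\<close>

lemma homogeneous_induct [consumes 1, case_names zero add homogeneous]:
  assumes "x \<in> carrier X" and "P \<zero>"
    and "\<And>x y. x \<in> carrier X \<Longrightarrow> y \<in> carrier X \<Longrightarrow> P x \<Longrightarrow> P y \<Longrightarrow> P (x \<oplus> y)"
    and "\<And>g x. g \<in> carrier G \<Longrightarrow> x \<in> grade X g \<Longrightarrow> P x"
  shows "P x"
proof -
  have "P (\<Oplus>g\<in>S. hparts G X x g)" if "S \<subseteq> carrier G" "finite S" for S
    using that(2,1)
  proof (induction S rule: finite_induct)
    case (insert g S)
    moreover have "hparts G X x \<in> S \<rightarrow> carrier X" "hparts G X x g \<in> carrier X"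
      using insert.prems hparts_closed[OF assms(1)] by auto
    ultimately show ?case
      using assms(3)[of "hparts G X x g"] assms(4)[of g "hparts G X x g"]
        hparts_grade[OF assms(1), of g] by (simp add: finsum_closed)
  qed (simp add: assms(2))
  from this[OF _ finite_hsupport[OF assms(1)]] show ?thesis
    unfolding sum_hparts[OF assms(1)] by (auto simp: hsupport_def)
qed

section \<open>Maps that act degree by degree\<close>

definition gradewise :: "('g \<Rightarrow> 'm \<Rightarrow> 'm) \<Rightarrow> 'm \<Rightarrow> 'm" where
  "gradewise s x = (\<Oplus>p\<in>hsupport G X (hparts G X x). s p (hparts G X x p))"

text \<open>The instances are the scaling of degree \<open>(h, a)\<close> by a character value, on
  the algebra and on modules, and the projection that keeps the degrees over one \<open>h\<close>.
  Since \<open>gradewise\<close> sums over the support alone, each \<open>s p\<close> has to map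
  zero to zero; additivity ensures this.\<close>

definition gradewise_additive :: "('g \<Rightarrow> 'm \<Rightarrow> 'm) \<Rightarrow> bool" where
  "gradewise_additive s \<longleftrightarrow> (\<forall>p\<in>carrier G. \<forall>x\<in>grade X p. s p x \<in> grade X p \<and>
     (\<forall>y\<in>grade X p. s p (x \<oplus> y) = s p x \<oplus> s p y))"

lemma gradewise_additive_zero:
  assumes "gradewise_additive s" "p \<in> carrier G"
  shows "s p \<zero> = \<zero>"
proof -
  have z: "\<zero> \<in> grade X p" by (rule grade_zero[OF assms(2)])
  then have "s p (\<zero> \<oplus> \<zero>) = s p \<zero> \<oplus> s p \<zero>" "s p \<zero> \<in> grade X p"
    using assms z unfolding gradewise_additive_def by blast+
  moreover from this have "s p \<zero> \<in> carrier X"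
    using assms(2) by (blast intro: grade_carrier)
  ultimately show ?thesis
    by (metis add.l_cancel_one' l_zero zero_closed)
qed

context
  fixes s :: "'g \<Rightarrow> 'm \<Rightarrow> 'm"
  assumes s: "gradewise_additive s"
begin

lemma gradewise_decomposition:
  assumes "x \<in> carrier X"
  shows "is_decomposition G X (gradewise s x) (\<lambda>p\<in>carrier G. s p (hparts G X x p))"
  unfolding gradewise_def
proof (rule decompositionI[OF finite_hsupport[OF assms]])
  show "hsupport G X (hparts G X x) \<subseteq> carrier G" by (auto simp: hsupport_def)
  show "s g (hparts G X x g) \<in> grade X g" if "g \<in> carrier G" for g
    using s that hparts_grade[OF assms that] by (auto simp: gradewise_additive_def)
  show "s g (hparts G X x g) = \<zero>" if "g \<in> carrier G - hsupport G X (hparts G X x)" for g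
    using that gradewise_additive_zero[OF s] by (auto simp: hsupport_def)
qed simp

lemma hparts_gradewise:
  "x \<in> carrier X \<Longrightarrow> p \<in> carrier G \<Longrightarrow> hparts G X (gradewise s x) p = s p (hparts G X x p)"
  by (simp add: decomposition_unique[OF gradewise_decomposition])

lemma gradewise_closed: "x \<in> carrier X \<Longrightarrow> gradewise s x \<in> carrier X"
  using s unfolding gradewise_def gradewise_additive_def
  by (intro finsum_closed) (auto simp: hsupport_def intro: hparts_grade grade_carrier)

lemma gradewise_homogeneous:
  assumes "p \<in> carrier G" "x \<in> grade X p"
  shows "gradewise s x = s p x"
proof (rule hparts_eqI)
  have m: "s p x \<in> grade X p" using s assms by (auto simp: gradewise_additive_def)
  then show "s p x \<in> carrier X" using assms grade_carrier by blast
  show "gradewise s x \<in> carrier X" using assms grade_carrier gradewise_closed by blast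
  show "hparts G X (gradewise s x) g = hparts G X (s p x) g" if "g \<in> carrier G" for g
    using m assms that grade_carrier
    by (auto simp: hparts_gradewise hparts_homogeneous gradewise_additive_zero[OF s])
qed

lemma gradewise_zero: "gradewise s \<zero> = \<zero>"
  by (rule hparts_eqI) (auto simp: hparts_gradewise gradewise_closed hparts_zero
    gradewise_additive_zero[OF s])

lemma gradewise_add:
  assumes "x \<in> carrier X" "y \<in> carrier X"
  shows "gradewise s (x \<oplus> y) = gradewise s x \<oplus> gradewise s y"
proof (rule hparts_eqI)
  show "hparts G X (gradewise s (x \<oplus> y)) g = hparts G X (gradewise s x \<oplus> gradewise s y) g"
    if "g \<in> carrier G" for g
    using assms that s hparts_grade[OF assms(1) that] hparts_grade[OF assms(2) that]
    by (simp add: hparts_gradewise hparts_add gradewise_closed gradewise_additive_def)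
qed (use assms in \<open>auto simp: gradewise_closed\<close>)

end

end

section \<open>A criterion for gradings\<close>

inductive_set grade_span :: "('g, 'y) monoid_scheme \<Rightarrow> ('b, 'm, 'g) graded \<Rightarrow> 'm set"
  for G and X :: "('b, 'm, 'g) graded" where
  zero: "\<zero>\<^bsub>X\<^esub> \<in> grade_span G X"
| homogeneous: "g \<in> carrier G \<Longrightarrow> x \<in> grade X g \<Longrightarrow> x \<in> grade_span G X"
| add: "x \<in> grade_span G X \<Longrightarrow> y \<in> grade_span G X \<Longrightarrow> x \<oplus>\<^bsub>X\<^esub> y \<in> grade_span G X"

lemma grade_span_finsum:
  fixes X :: "('b, 'm, 'g) graded" (structure)
  assumes "abelian_group X" "finite I" "\<And>i. i \<in> I \<Longrightarrow> f i \<in> grade_span G X"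
    and "\<And>i. i \<in> I \<Longrightarrow> f i \<in> carrier X"
  shows "finsum X f I \<in> grade_span G X"
proof -
  interpret abelian_group X by fact
  show ?thesis using assms(2-)
  proof (induction I rule: finite_induct)
    case (insert i I)
    then have "f \<in> I \<rightarrow> carrier X" "f i \<in> carrier X" by auto
    with insert show ?case by (simp add: grade_span.add)
  qed (simp add: grade_span.zero)
qed

text \<open>Additive projections that fix one degree and kill the others replace unique
  decompositions. The span yields existence; uniqueness holds because \<open>proj g\<close> recovers
  the coefficient of degree \<open>g\<close> from any decomposition. Each component is a subgroup,
  being the set of fixed points of an additive map.\<close>

lemma is_gradingI:
  fixes X :: "('b, 'm, 'g) graded" (structure)
  assumes "abelian_group X" "grade X \<in> extensional (carrier G)"
    and grade_closed: "\<And>g. g \<in> carrier G \<Longrightarrow> grade X g \<subseteq> carrier X"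
    and proj_grade: "\<And>g x. g \<in> carrier G \<Longrightarrow> x \<in> carrier X \<Longrightarrow> proj g x \<in> grade X g"
    and span: "carrier X \<subseteq> grade_span G X"
    and proj_add: "\<And>g x y. g \<in> carrier G \<Longrightarrow> x \<in> carrier X \<Longrightarrow> y \<in> carrier X \<Longrightarrow>
      proj g (x \<oplus> y) = proj g x \<oplus> proj g y"
    and proj_homogeneous: "\<And>g h x. g \<in> carrier G \<Longrightarrow> h \<in> carrier G \<Longrightarrow> x \<in> grade X h \<Longrightarrow>
      proj g x = (if g = h then x else \<zero>)"
  shows "is_grading G X"
proof -
  interpret abelian_group X by fact
  have gc: "x \<in> carrier X" if "g \<in> carrier G" "x \<in> grade X g" for g x
    using grade_closed that by blast
  have proj_zero: "proj g \<zero> = \<zero>" if "g \<in> carrier G" for g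
    using proj_add[OF that zero_closed zero_closed] gc[OF that proj_grade[OF that zero_closed]]
    by (metis add.l_cancel_one' l_zero zero_closed)
  have sub: "additive_subgroup (grade X g) X" if g: "g \<in> carrier G" for g
  proof (intro additive_subgroupI add.subgroupI)
    note inG = proj_grade[OF g] and fixed = proj_homogeneous[OF g g]
    show "grade X g \<subseteq> carrier X" by (rule grade_closed[OF g])
    show "grade X g \<noteq> {}" using inG[OF zero_closed] by blast
    fix x assume x: "x \<in> grade X g"
    have xc: "x \<in> carrier X" by (rule gc[OF g x])
    \<comment> \<open>\<open>proj g\<close> is additive and fixes \<open>x\<close>, so
      \<open>\<ominus> x\<close> equals its own projection, which lies in
      \<open>grade X g\<close>.\<close>
    have "proj g (\<ominus> x) \<oplus> x = \<zero>"
      using proj_add[OF g, of "\<ominus> x" x] fixed[OF x] xc by (simp add: l_neg proj_zero[OF g])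
    then have "\<ominus> x = proj g (\<ominus> x)"
      using xc gc[OF g inG] by (intro minus_equality) auto
    then show "\<ominus> x \<in> grade X g" using inG[of "\<ominus> x"] xc by simp
    fix y assume y: "y \<in> grade X g"
    show "x \<oplus> y \<in> grade X g"
      using inG[of "x \<oplus> y"] proj_add[OF g xc gc[OF g y]] fixed[OF x] fixed[OF y] xc gc[OF g y] by simp
  qed
  have gz: "\<zero> \<in> grade X g" if "g \<in> carrier G" for g
    using additive_subgroup.zero_closed[OF sub] that by blast
  have proj_sum: "proj g (\<Oplus>h\<in>S. c h) = (if g \<in> S then c g else \<zero>)"
    if "finite S" "S \<subseteq> carrier G" "g \<in> carrier G"
      and c: "\<And>h. h \<in> S \<Longrightarrow> c h \<in> grade X h" for S c g
    using that
  proof (induction S rule: finite_induct)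
    case (insert h S)
    then have "c \<in> S \<rightarrow> carrier X" "c h \<in> carrier X" by (auto intro: gc)
    moreover have "proj g (c h) = (if g = h then c h else \<zero>)"
      using insert.prems by (intro proj_homogeneous) auto
    moreover from insert have "g \<in> S \<Longrightarrow> c g \<in> carrier X" by (auto intro: gc)
    ultimately show ?case using insert by (auto simp: proj_add)
  qed (simp add: proj_zero)
  \<comment> \<open>Membership in the span comes without a chosen decomposition; induction shows
    that the projections themselves form one.\<close>
  have dec: "finite {g\<in>carrier G. proj g x \<noteq> \<zero>} \<and>
      x = (\<Oplus>g\<in>{g\<in>carrier G. proj g x \<noteq> \<zero>}. proj g x) \<and> x \<in> carrier X"
    if "x \<in> grade_span G X" for x
    using that
  proof induction
    case zero
    then show ?case by (auto simp: proj_zero gz cong: conj_cong)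
  next
    case (homogeneous g x)
    have "{h\<in>carrier G. proj h x \<noteq> \<zero>} = (if x = \<zero> then {} else {g})"
      using homogeneous proj_homogeneous[OF _ homogeneous] by (auto split: if_splits)
    then show ?case
      using homogeneous proj_homogeneous[OF _ homogeneous] gc gz by auto
  next
    case (add x y)
    let ?S = "{g\<in>carrier G. proj g x \<noteq> \<zero>} \<union> {g\<in>carrier G. proj g y \<noteq> \<zero>}"
    let ?T = "{g\<in>carrier G. proj g (x \<oplus> y) \<noteq> \<zero>}"
    have xy: "x \<in> carrier X" "y \<in> carrier X" using add by auto
    have pc: "proj g x \<in> carrier X" "proj g y \<in> carrier X" if "g \<in> carrier G" for g
      using gc proj_grade xy that by auto
    have S: "finite ?S" "?T \<subseteq> ?S"
      using add.IH xy by (auto simp: proj_add)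
    have "x = (\<Oplus>g\<in>{g\<in>carrier G. proj g x \<noteq> \<zero>}. proj g x)" using add.IH by blast
    also have "\<dots> = (\<Oplus>g\<in>?S. proj g x)"
      using S pc by (intro add.finprod_mono_neutral_cong_left) auto
    finally have ex: "x = (\<Oplus>g\<in>?S. proj g x)" .
    have "y = (\<Oplus>g\<in>{g\<in>carrier G. proj g y \<noteq> \<zero>}. proj g y)" using add.IH by blast
    also have "\<dots> = (\<Oplus>g\<in>?S. proj g y)"
      using S pc by (intro add.finprod_mono_neutral_cong_left) auto
    finally have ey: "y = (\<Oplus>g\<in>?S. proj g y)" .
    have "x \<oplus> y = (\<Oplus>g\<in>?S. proj g x \<oplus> proj g y)"
      by (subst finsum_addf) (use pc ex[symmetric] ey[symmetric] in auto)
    also have "\<dots> = (\<Oplus>g\<in>?T. proj g (x \<oplus> y))"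
      using S pc xy by (intro add.finprod_mono_neutral_cong_right) (auto simp: proj_add)
    finally have "x \<oplus> y = (\<Oplus>g\<in>?T. proj g (x \<oplus> y))" .
    then show ?case
      using S xy finite_subset by auto
  qed
  have "\<exists>!c. is_decomposition G X x c" if x: "x \<in> carrier X" for x
  proof
    have sp: "x \<in> grade_span G X" using x span by blast
    let ?c = "\<lambda>g\<in>carrier G. proj g x"
    have supp: "hsupport G X ?c = {g\<in>carrier G. proj g x \<noteq> \<zero>}"
      by (auto simp: hsupport_def)
    have "(\<Oplus>g\<in>hsupport G X ?c. ?c g) = (\<Oplus>g\<in>{g\<in>carrier G. proj g x \<noteq> \<zero>}. proj g x)"
      unfolding supp using proj_grade[OF _ x] by (intro finsum_cong') (auto intro: gc)
    then show "is_decomposition G X x ?c"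
      using dec[OF sp] supp proj_grade[OF _ x] by (auto simp: is_decomposition_def)
    fix c assume c: "is_decomposition G X x c"
    show "c = ?c"
    proof (rule extensionalityI[of _ "carrier G"])
      show "c \<in> extensional (carrier G)" using c by (auto simp: is_decomposition_def PiE_iff)
      fix g assume g: "g \<in> carrier G"
      have "proj g x = (if g \<in> hsupport G X c then c g else \<zero>)"
        using c g proj_sum[of "hsupport G X c" g c]
        by (auto simp: is_decomposition_def hsupport_def PiE_iff)
      then show "c g = ?c g" using g by (auto simp: hsupport_def)
    qed simp
  qed
  then show ?thesis
    using assms(2) sub by (simp add: is_grading_def)
qed

section \<open>Finitely presented right modules\<close>

locale right_module = B: ring B + abelian_group X
  for B :: "('b, 'w) ring_scheme" and X :: "('b, 'm, 'z) module_scheme" (structure) +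
  assumes ract_closed: "\<lbrakk>x \<in> carrier X; r \<in> carrier B\<rbrakk> \<Longrightarrow> ract X x r \<in> carrier X"
    and ract_add_left: "\<lbrakk>x \<in> carrier X; y \<in> carrier X; r \<in> carrier B\<rbrakk> \<Longrightarrow>
        ract X (x \<oplus> y) r = ract X x r \<oplus> ract X y r"
    and ract_add_right: "\<lbrakk>x \<in> carrier X; r \<in> carrier B; s \<in> carrier B\<rbrakk> \<Longrightarrow>
        ract X x (r \<oplus>\<^bsub>B\<^esub> s) = ract X x r \<oplus> ract X x s"
    and ract_mult: "\<lbrakk>x \<in> carrier X; r \<in> carrier B; s \<in> carrier B\<rbrakk> \<Longrightarrow>
        ract X x (r \<otimes>\<^bsub>B\<^esub> s) = ract X (ract X x r) s"
    and ract_one: "x \<in> carrier X \<Longrightarrow> ract X x \<one>\<^bsub>B\<^esub> = x"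
begin

lemma ract_zero_left: "r \<in> carrier B \<Longrightarrow> ract X \<zero> r = \<zero>"
  using ract_add_left[of \<zero> \<zero> r] ract_closed[of \<zero> r]
  by (metis add.l_cancel_one' l_zero zero_closed)

lemma ract_zero_right: "x \<in> carrier X \<Longrightarrow> ract X x \<zero>\<^bsub>B\<^esub> = \<zero>"
  using ract_add_right[of x "\<zero>\<^bsub>B\<^esub>" "\<zero>\<^bsub>B\<^esub>"] ract_closed[of x "\<zero>\<^bsub>B\<^esub>"]
  by (metis B.l_zero B.zero_closed add.l_cancel_one')

lemma ract_finsum_left:
  assumes "r \<in> carrier B" "\<And>i. i \<in> I \<Longrightarrow> f i \<in> carrier X"
  shows "ract X (\<Oplus>i\<in>I. f i) r = (\<Oplus>i\<in>I. ract X (f i) r)"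
  using assms(2)
proof (induction I rule: infinite_finite_induct)
  case (insert i I)
  moreover from insert.prems have "f \<in> I \<rightarrow> carrier X" "f i \<in> carrier X"
    "(\<lambda>i. ract X (f i) r) \<in> I \<rightarrow> carrier X"
    using assms(1) ract_closed by auto
  ultimately show ?case using assms(1) by (simp add: ract_add_left ract_closed)
qed (auto simp: ract_zero_left assms)

lemma ract_finsum_right:
  assumes "x \<in> carrier X" "\<And>i. i \<in> I \<Longrightarrow> f i \<in> carrier B"
  shows "ract X x (finsum B f I) = (\<Oplus>i\<in>I. ract X x (f i))"
  using assms(2)
proof (induction I rule: infinite_finite_induct)
  case (insert i I)
  moreover from insert.prems have "f \<in> I \<rightarrow> carrier B" "f i \<in> carrier B"
    "(\<lambda>i. ract X x (f i)) \<in> I \<rightarrow> carrier X"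
    using assms(1) ract_closed by auto
  ultimately show ?case using assms(1) by (simp add: ract_add_right ract_closed)
qed (auto simp: ract_zero_right assms)

end

text \<open>Only members of \<open>S\<close> are multiplied in the last clause; stability under the
  whole ring then follows from associativity of the action (\<open>rspan_ract\<close>).\<close>

inductive_set rspan :: "('b, 'w) ring_scheme \<Rightarrow> ('b, 'm, 'z) module_scheme \<Rightarrow> 'm set \<Rightarrow> 'm set"
  for B and X :: "('b, 'm, 'z) module_scheme" and S where
  zero: "\<zero>\<^bsub>X\<^esub> \<in> rspan B X S"
| add: "x \<in> rspan B X S \<Longrightarrow> y \<in> rspan B X S \<Longrightarrow> x \<oplus>\<^bsub>X\<^esub> y \<in> rspan B X S"
| gen: "x \<in> S \<Longrightarrow> r \<in> carrier B \<Longrightarrow> ract X x r \<in> rspan B X S"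

text \<open>The homomorphism from the free module of rank \<open>n\<close> that sends the
  \<open>i\<close>-th basis vector to \<open>x i\<close>.\<close>

definition rcomb :: "('b, 'm, 'z) module_scheme \<Rightarrow> nat \<Rightarrow> (nat \<Rightarrow> 'm) \<Rightarrow> (nat \<Rightarrow> 'b) \<Rightarrow> 'm" where
  "rcomb X n x u = (\<Oplus>\<^bsub>X\<^esub>i\<in>{..<n}. ract X (x i) (u i))"

definition rmod_hom :: "('b, 'w) ring_scheme \<Rightarrow> ('b, 'm, 'y) module_scheme
    \<Rightarrow> ('b, 'n, 'z) module_scheme \<Rightarrow> ('m \<Rightarrow> 'n) set" where
  "rmod_hom B X Y = {f \<in> carrier X \<rightarrow> carrier Y.
     (\<forall>x\<in>carrier X. \<forall>y\<in>carrier X. f (x \<oplus>\<^bsub>X\<^esub> y) = f x \<oplus>\<^bsub>Y\<^esub> f y) \<and>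
     (\<forall>x\<in>carrier X. \<forall>r\<in>carrier B. f (ract X x r) = ract Y (f x) r)}"

text \<open>The record of \<open>free_graded\<close> without its grading, so that graded free
  modules over either grading group can be compared with it.\<close>

definition free_mod :: "('b, 'w) ring_scheme \<Rightarrow> nat \<Rightarrow> ('b, nat \<Rightarrow> 'b) module" where
  "free_mod B n = (let C = {..<n} \<rightarrow>\<^sub>E carrier B in
     \<lparr>carrier = C, mult = undefined, one = undefined,
      zero = (\<lambda>i\<in>{..<n}. \<zero>\<^bsub>B\<^esub>),
      add = (\<lambda>u\<in>C. \<lambda>v\<in>C. \<lambda>i\<in>{..<n}. u i \<oplus>\<^bsub>B\<^esub> v i),
      smult = (\<lambda>r\<in>carrier B. \<lambda>u\<in>C. \<lambda>i\<in>{..<n}. u i \<otimes>\<^bsub>B\<^esub> r)\<rparr>)"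

definition single :: "('b, 'w) ring_scheme \<Rightarrow> nat \<Rightarrow> nat \<Rightarrow> 'b \<Rightarrow> nat \<Rightarrow> 'b" where
  "single B n i r = (\<lambda>j\<in>{..<n}. if j = i then r else \<zero>\<^bsub>B\<^esub>)"

text \<open>A finite set \<open>T\<close> generating the relations stands for the second free module
  of a presentation. Degrees are absent, so the property depends on the underlying module
  only.\<close>

definition fin_pres :: "('b, 'w) ring_scheme \<Rightarrow> ('b, 'm, 'z) module_scheme \<Rightarrow> bool" where
  "fin_pres B X \<longleftrightarrow> (\<exists>n x T. x \<in> {..<n} \<rightarrow> carrier X \<and> rspan B X (x ` {..<n}) = carrier X \<and>
     finite T \<and> rspan B (free_mod B n) T = {u \<in> carrier (free_mod B n). rcomb X n x u = \<zero>\<^bsub>X\<^esub>} \<and>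
     T \<subseteq> carrier (free_mod B n))"

lemma carrier_free_mod: "carrier (free_mod B n) = {..<n} \<rightarrow>\<^sub>E carrier B"
  by (simp add: free_mod_def Let_def)

lemma zero_free_mod: "\<zero>\<^bsub>free_mod B n\<^esub> = (\<lambda>i\<in>{..<n}. \<zero>\<^bsub>B\<^esub>)"
  by (simp add: free_mod_def Let_def)

lemma add_free_mod:
  "\<lbrakk>u \<in> carrier (free_mod B n); v \<in> carrier (free_mod B n)\<rbrakk> \<Longrightarrow>
    u \<oplus>\<^bsub>free_mod B n\<^esub> v = (\<lambda>i\<in>{..<n}. u i \<oplus>\<^bsub>B\<^esub> v i)"
  by (simp add: free_mod_def Let_def)

lemma smult_free_mod:
  "\<lbrakk>u \<in> carrier (free_mod B n); r \<in> carrier B\<rbrakk> \<Longrightarrow>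
    ract (free_mod B n) u r = (\<lambda>i\<in>{..<n}. u i \<otimes>\<^bsub>B\<^esub> r)"
  by (simp add: free_mod_def Let_def)

lemma rspan_mono: "S \<subseteq> T \<Longrightarrow> rspan B X S \<subseteq> rspan B X T"
  by (rule subsetI, erule rspan.induct) (auto intro: rspan.intros)

context right_module
begin

lemma rspan_closed:
  assumes "S \<subseteq> carrier X" "x \<in> rspan B X S"
  shows "x \<in> carrier X"
  using assms(2) by induction (use assms(1) ract_closed in auto)

lemma rspan_superset: "S \<subseteq> carrier X \<Longrightarrow> S \<subseteq> rspan B X S"
  using rspan.gen[of _ S "\<one>\<^bsub>B\<^esub>" B X] by (auto simp: ract_one subset_iff)

lemma rspan_ract:
  assumes "S \<subseteq> carrier X" "x \<in> rspan B X S" "r \<in> carrier B"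
  shows "ract X x r \<in> rspan B X S"
  using assms(2)
proof induction
  case (gen x s)
  then have "x \<in> carrier X" using assms(1) by auto
  then show ?case
    using gen assms(3) ract_mult[of x s r] rspan.gen[of x S "s \<otimes>\<^bsub>B\<^esub> r" B X] by simp
qed (use assms in \<open>auto simp: ract_zero_left ract_add_left rspan_closed intro: rspan.intros\<close>)

lemma rspan_minimal:
  assumes "T \<subseteq> carrier X" "S \<subseteq> rspan B X T"
  shows "rspan B X S \<subseteq> rspan B X T"
proof
  fix x assume "x \<in> rspan B X S"
  then show "x \<in> rspan B X T"
    by induction (use assms in \<open>auto intro: rspan.intros rspan_ract\<close>)
qed

lemma rspan_finsum:
  assumes "finite I" "S \<subseteq> carrier X" "\<And>i. i \<in> I \<Longrightarrow> f i \<in> rspan B X S"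
  shows "(\<Oplus>i\<in>I. f i) \<in> rspan B X S"
  using assms(1,3)
proof (induction I rule: finite_induct)
  case (insert i I)
  then have "f \<in> I \<rightarrow> carrier X" "f i \<in> carrier X" using rspan_closed[OF assms(2)] by auto
  with insert show ?case by (simp add: rspan.add)
qed (simp add: rspan.zero)

lemma rcomb_closed:
  "x \<in> {..<n} \<rightarrow> carrier X \<Longrightarrow> u \<in> carrier (free_mod B n) \<Longrightarrow> rcomb X n x u \<in> carrier X"
  unfolding rcomb_def by (intro finsum_closed) (auto simp: carrier_free_mod intro!: ract_closed)

lemma rcomb_add:
  assumes "x \<in> {..<n} \<rightarrow> carrier X" "u \<in> carrier (free_mod B n)" "v \<in> carrier (free_mod B n)"
  shows "rcomb X n x (u \<oplus>\<^bsub>free_mod B n\<^esub> v) = rcomb X n x u \<oplus> rcomb X n x v"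
proof -
  have f: "(\<lambda>i. ract X (x i) (w i)) \<in> {..<n} \<rightarrow> carrier X" if "w \<in> carrier (free_mod B n)" for w
    using that assms(1) by (auto simp: carrier_free_mod intro!: ract_closed)
  have "rcomb X n x (u \<oplus>\<^bsub>free_mod B n\<^esub> v) = (\<Oplus>i\<in>{..<n}. ract X (x i) (u i) \<oplus> ract X (x i) (v i))"
    unfolding rcomb_def using assms f[OF assms(2)] f[OF assms(3)]
    by (intro finsum_cong') (auto simp: add_free_mod carrier_free_mod Pi_iff PiE_iff
      intro!: ract_add_right)
  also have "\<dots> = rcomb X n x u \<oplus> rcomb X n x v"
    unfolding rcomb_def using f assms by (intro finsum_addf) auto
  finally show ?thesis .
qed

lemma rcomb_ract:
  assumes "x \<in> {..<n} \<rightarrow> carrier X" "u \<in> carrier (free_mod B n)" "r \<in> carrier B"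
  shows "rcomb X n x (ract (free_mod B n) u r) = ract X (rcomb X n x u) r"
proof -
  have f: "ract X (x i) (u i) \<in> carrier X" if "i < n" for i
    using that assms by (auto simp: carrier_free_mod intro!: ract_closed)
  have "rcomb X n x (ract (free_mod B n) u r) = (\<Oplus>i\<in>{..<n}. ract X (ract X (x i) (u i)) r)"
    unfolding rcomb_def using assms f
    by (intro finsum_cong') (auto simp: smult_free_mod carrier_free_mod Pi_iff PiE_iff
      intro!: ract_mult ract_closed)
  then show ?thesis
    using ract_finsum_left[of r "{..<n}" "\<lambda>i. ract X (x i) (u i)"] f assms(3)
    by (simp add: rcomb_def)
qed

lemma rcomb_hom: "x \<in> {..<n} \<rightarrow> carrier X \<Longrightarrow> rcomb X n x \<in> rmod_hom B (free_mod B n) X"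
  by (simp add: rmod_hom_def rcomb_closed rcomb_add rcomb_ract)

lemma single_closed: "r \<in> carrier B \<Longrightarrow> single B n i r \<in> carrier (free_mod B n)"
  by (auto simp: single_def carrier_free_mod)

lemma rcomb_single:
  assumes "x \<in> {..<n} \<rightarrow> carrier X" "i < n" "r \<in> carrier B"
  shows "rcomb X n x (single B n i r) = ract X (x i) r"
proof -
  have x: "x j \<in> carrier X" if "j < n" for j using assms(1) that by auto
  have "rcomb X n x (single B n i r) = (\<Oplus>j\<in>{..<n}. if i = j then ract X (x j) r else \<zero>)"
    unfolding rcomb_def
    by (intro finsum_cong') (auto simp: single_def ract_zero_right x ract_closed assms(3))
  also have "\<dots> = ract X (x i) r"
    using assms x by (intro finsum_singleton) (auto intro: ract_closed)
  finally show ?thesis .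
qed

lemma hom_zero:
  assumes "right_module B Y" "f \<in> rmod_hom B X Y"
  shows "f \<zero> = \<zero>\<^bsub>Y\<^esub>"
proof -
  interpret Y: right_module B Y by fact
  have "f (\<zero> \<oplus> \<zero>) = f \<zero> \<oplus>\<^bsub>Y\<^esub> f \<zero>" "f \<zero> \<in> carrier Y"
    using assms(2) zero_closed unfolding rmod_hom_def by blast+
  then show ?thesis by (metis Y.add.l_cancel_one' l_zero zero_closed)
qed

lemma hom_finsum:
  assumes "right_module B Y" "f \<in> rmod_hom B X Y" "\<And>i. i \<in> I \<Longrightarrow> c i \<in> carrier X"
  shows "f (\<Oplus>i\<in>I. c i) = (\<Oplus>\<^bsub>Y\<^esub>i\<in>I. f (c i))"
proof -
  interpret Y: right_module B Y by fact
  show ?thesis using assms(3)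
  proof (induction I rule: infinite_finite_induct)
    case (insert i I)
    moreover from insert.prems have "c \<in> I \<rightarrow> carrier X" "c i \<in> carrier X"
      "(\<lambda>i. f (c i)) \<in> I \<rightarrow> carrier Y" "f (c i) \<in> carrier Y"
      using assms(2) by (auto simp: rmod_hom_def)
    ultimately show ?case using assms(2) by (simp add: rmod_hom_def)
  qed (auto simp: hom_zero[OF assms(1,2)])
qed

lemma hom_rspan:
  assumes "right_module B Y" "f \<in> rmod_hom B X Y" "S \<subseteq> carrier X"
  shows "f ` rspan B X S = rspan B Y (f ` S)"
proof -
  interpret Y: right_module B Y by fact
  have "f x \<in> rspan B Y (f ` S)" if "x \<in> rspan B X S" for x
    using that
  proof induction
    case (add x y)
    then show ?case using assms(2) rspan_closed[OF assms(3)]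
      by (auto simp: rmod_hom_def intro: rspan.add)
  next
    case (gen x r)
    then have "f (ract X x r) = ract Y (f x) r" using assms(2,3) by (auto simp: rmod_hom_def)
    then show ?case using gen by (auto intro: rspan.gen)
  qed (simp add: hom_zero[OF assms(1,2)] rspan.zero)
  moreover have "y \<in> f ` rspan B X S" if "y \<in> rspan B Y (f ` S)" for y
    using that
  proof induction
    case zero
    then show ?case by (metis hom_zero[OF assms(1,2)] imageI rspan.zero)
  next
    case (add x y)
    then obtain x' y' where xy: "x' \<in> rspan B X S" "y' \<in> rspan B X S" "x = f x'" "y = f y'"
      by auto
    then have "x \<oplus>\<^bsub>Y\<^esub> y = f (x' \<oplus> y')"
      using assms(2) rspan_closed[OF assms(3)] by (auto simp: rmod_hom_def)
    then show ?case using xy by (auto intro: rspan.add)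
  next
    case (gen y r)
    then obtain x where x: "x \<in> S" "y = f x" by auto
    then have "ract Y y r = f (ract X x r)"
      using assms(2,3) gen by (auto simp: rmod_hom_def)
    then show ?case using x gen by (auto intro: rspan.gen)
  qed
  ultimately show ?thesis by blast
qed

lemma hom_rcomb:
  assumes "right_module B Y" "f \<in> rmod_hom B X Y"
    and "x \<in> {..<n} \<rightarrow> carrier X" "u \<in> carrier (free_mod B n)"
  shows "f (rcomb X n x u) = rcomb Y n (\<lambda>i. f (x i)) u"
proof -
  interpret Y: right_module B Y by fact
  have xu: "x i \<in> carrier X" "u i \<in> carrier B" if "i < n" for i
    using that assms(3,4) by (auto simp: carrier_free_mod)
  have fx: "f (x i) \<in> carrier Y" "f (ract X (x i) (u i)) = ract Y (f (x i)) (u i)" if "i < n" for i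
    using xu[OF that] assms(2) by (auto simp: rmod_hom_def)
  have "f (rcomb X n x u) = (\<Oplus>\<^bsub>Y\<^esub>i\<in>{..<n}. f (ract X (x i) (u i)))"
    unfolding rcomb_def using xu by (intro hom_finsum[OF assms(1,2)]) (auto intro: ract_closed)
  also have "\<dots> = rcomb Y n (\<lambda>i. f (x i)) u"
    unfolding rcomb_def by (rule Y.finsum_cong') (auto simp: fx xu intro: Y.ract_closed)
  finally show ?thesis .
qed

end

lemma right_module_free_mod:
  assumes "ring B"
  shows "right_module B (free_mod B n)"
proof -
  interpret B: ring B by fact
  let ?F = "free_mod B n"
  have F: "\<And>u i. u \<in> carrier ?F \<Longrightarrow> i < n \<Longrightarrow> u i \<in> carrier B"
    by (auto simp: carrier_free_mod)
  have [simp]: "(\<lambda>i\<in>{..<n}. u i \<oplus>\<^bsub>B\<^esub> v i) \<in> carrier ?F" "(\<lambda>i\<in>{..<n}. u i \<otimes>\<^bsub>B\<^esub> r) \<in> carrier ?F"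
    if "u \<in> carrier ?F" "v \<in> carrier ?F" "r \<in> carrier B" for u v r
    using that by (auto simp: carrier_free_mod)
  have ag: "abelian_group ?F"
  proof (rule abelian_groupI)
    fix u assume u: "u \<in> carrier ?F"
    have "(\<lambda>i\<in>{..<n}. \<ominus>\<^bsub>B\<^esub> u i) \<in> carrier ?F"
      using u by (auto simp: carrier_free_mod)
    moreover from this have "(\<lambda>i\<in>{..<n}. \<ominus>\<^bsub>B\<^esub> u i) \<oplus>\<^bsub>?F\<^esub> u = \<zero>\<^bsub>?F\<^esub>"
      using u F by (auto simp: add_free_mod zero_free_mod B.l_neg)
    ultimately show "\<exists>v\<in>carrier ?F. v \<oplus>\<^bsub>?F\<^esub> u = \<zero>\<^bsub>?F\<^esub>" by blast
    show "\<zero>\<^bsub>?F\<^esub> \<oplus>\<^bsub>?F\<^esub> u = u"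
      using u F[OF u] by (subst add_free_mod)
        (auto simp: zero_free_mod carrier_free_mod PiE_iff extensional_def fun_eq_iff)
  next
    fix u v assume "u \<in> carrier ?F" "v \<in> carrier ?F"
    then show "u \<oplus>\<^bsub>?F\<^esub> v \<in> carrier ?F" "u \<oplus>\<^bsub>?F\<^esub> v = v \<oplus>\<^bsub>?F\<^esub> u"
      using F by (auto simp: add_free_mod carrier_free_mod fun_eq_iff restrict_def intro: B.a_comm)
  next
    fix u v w assume uvw: "u \<in> carrier ?F" "v \<in> carrier ?F" "w \<in> carrier ?F"
    then have "(\<lambda>i\<in>{..<n}. u i \<oplus>\<^bsub>B\<^esub> v i) \<in> carrier ?F" "(\<lambda>i\<in>{..<n}. v i \<oplus>\<^bsub>B\<^esub> w i) \<in> carrier ?F"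
      by (auto simp: carrier_free_mod)
    then show "u \<oplus>\<^bsub>?F\<^esub> v \<oplus>\<^bsub>?F\<^esub> w = u \<oplus>\<^bsub>?F\<^esub> (v \<oplus>\<^bsub>?F\<^esub> w)"
      using uvw F by (auto simp: add_free_mod fun_eq_iff restrict_def intro: B.a_assoc)
  next
    show "\<zero>\<^bsub>?F\<^esub> \<in> carrier ?F" by (auto simp: carrier_free_mod zero_free_mod)
  qed
  interpret abelian_group ?F by (rule ag)
  show ?thesis
  proof unfold_locales
    fix u r s assume u: "u \<in> carrier ?F" and r: "r \<in> carrier B"
    have m: "(\<lambda>i\<in>{..<n}. u i \<otimes>\<^bsub>B\<^esub> r) \<in> carrier ?F" using u r by (auto simp: carrier_free_mod)
    show "ract ?F u r \<in> carrier ?F" using m u r by (simp add: smult_free_mod)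
    assume s: "s \<in> carrier B"
    have m': "(\<lambda>i\<in>{..<n}. u i \<otimes>\<^bsub>B\<^esub> s) \<in> carrier ?F" using u s by (auto simp: carrier_free_mod)
    show "ract ?F u (r \<oplus>\<^bsub>B\<^esub> s) = ract ?F u r \<oplus>\<^bsub>?F\<^esub> ract ?F u s"
      using m m' u r s F[OF u] by (simp add: smult_free_mod add_free_mod)
        (auto simp: fun_eq_iff restrict_def B.r_distr)
    show "ract ?F u (r \<otimes>\<^bsub>B\<^esub> s) = ract ?F (ract ?F u r) s"
      using m m' u r s F[OF u] by (simp add: smult_free_mod)
        (auto simp: fun_eq_iff restrict_def B.m_assoc)
  next
    fix u assume u: "u \<in> carrier ?F"
    show "ract ?F u \<one>\<^bsub>B\<^esub> = u" using u F[OF u]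
      by (subst smult_free_mod) (auto simp: carrier_free_mod PiE_iff extensional_def fun_eq_iff)
  next
    fix u v r assume uv: "u \<in> carrier ?F" "v \<in> carrier ?F" and r: "r \<in> carrier B"
    have "(\<lambda>i\<in>{..<n}. u i \<otimes>\<^bsub>B\<^esub> r) \<in> carrier ?F" "(\<lambda>i\<in>{..<n}. v i \<otimes>\<^bsub>B\<^esub> r) \<in> carrier ?F"
      "(\<lambda>i\<in>{..<n}. u i \<oplus>\<^bsub>B\<^esub> v i) \<in> carrier ?F"
      using uv r by (auto simp: carrier_free_mod)
    then show "ract ?F (u \<oplus>\<^bsub>?F\<^esub> v) r = ract ?F u r \<oplus>\<^bsub>?F\<^esub> ract ?F v r"
      using uv r F[OF uv(1)] F[OF uv(2)] by (simp add: smult_free_mod add_free_mod)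
        (auto simp: fun_eq_iff restrict_def B.l_distr)
  qed
qed

lemma finsum_free_mod:
  assumes "ring B" "\<And>s. s \<in> S \<Longrightarrow> c s \<in> carrier (free_mod B n)" "i < n"
  shows "finsum (free_mod B n) c S i = (\<Oplus>\<^bsub>B\<^esub>s\<in>S. c s i)"
proof -
  interpret B: ring B by fact
  interpret F: right_module B "free_mod B n" by (rule right_module_free_mod[OF assms(1)])
  show ?thesis using assms(2)
  proof (induction S rule: infinite_finite_induct)
    case (insert s S)
    moreover from insert.prems have "c \<in> S \<rightarrow> carrier (free_mod B n)"
      "c s \<in> carrier (free_mod B n)" "(\<lambda>s. c s i) \<in> S \<rightarrow> carrier B" "c s i \<in> carrier B"
      using assms(3) by (auto simp: carrier_free_mod)
    ultimately show ?case using assms(3)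
      by (simp add: add_free_mod F.finsum_closed)
  qed (use assms(3) in \<open>auto simp: zero_free_mod\<close>)
qed

context right_module
begin

abbreviation unit_vector :: "nat \<Rightarrow> nat \<Rightarrow> nat \<Rightarrow> 'b" where
  "unit_vector n i \<equiv> single B n i \<one>\<^bsub>B\<^esub>"

lemma rcomb_unit_vector:
  assumes "u \<in> carrier (free_mod B n)"
  shows "rcomb (free_mod B n) n (unit_vector n) u = u"
proof
  interpret F: right_module B "free_mod B n" by (rule right_module_free_mod) unfold_locales
  have e: "unit_vector n \<in> {..<n} \<rightarrow> carrier (free_mod B n)" by (simp add: single_closed)
  have u: "u j \<in> carrier B" if "j < n" for j using that assms by (auto simp: carrier_free_mod)
  fix i
  show "rcomb (free_mod B n) n (unit_vector n) u i = u i"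
  proof (cases "i < n")
    case True
    have "rcomb (free_mod B n) n (unit_vector n) u i
        = (\<Oplus>\<^bsub>B\<^esub>j\<in>{..<n}. ract (free_mod B n) (unit_vector n j) (u j) i)"
      unfolding rcomb_def using True u
      by (intro finsum_free_mod) (auto intro: B.ring_axioms F.ract_closed single_closed)
    also have "\<dots> = (\<Oplus>\<^bsub>B\<^esub>j\<in>{..<n}. if i = j then u j else \<zero>\<^bsub>B\<^esub>)"
      using True u by (intro B.finsum_cong') (auto simp: smult_free_mod single_closed, auto simp: single_def)
    also have "\<dots> = u i"
      using True u by (intro B.finsum_singleton) auto
    finally show ?thesis .
  next
    case False
    then show ?thesis
      using assms F.rcomb_closed[OF e assms] by (auto simp: carrier_free_mod PiE_iff extensional_def)
  qed
qed

text \<open>The basis vectors generate the free module, so every map out of it is some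
  \<open>rcomb\<close>. This makes presentations by maps and by generating families
  interchangeable.\<close>

lemma hom_eq_rcomb:
  assumes "f \<in> rmod_hom B (free_mod B n) X" "u \<in> carrier (free_mod B n)"
  shows "f u = rcomb X n (\<lambda>i. f (unit_vector n i)) u"
proof -
  interpret F: right_module B "free_mod B n" by (rule right_module_free_mod) unfold_locales
  have "f (rcomb (free_mod B n) n (unit_vector n) u) = rcomb X n (\<lambda>i. f (unit_vector n i)) u"
    using assms by (intro F.hom_rcomb) (auto simp: single_closed right_module_axioms)
  then show ?thesis by (simp add: rcomb_unit_vector[OF assms(2)])
qed

lemma rcomb_image:
  assumes "x \<in> {..<n} \<rightarrow> carrier X"
  shows "rcomb X n x ` carrier (free_mod B n) = rspan B X (x ` {..<n})"
proof -
  interpret F: right_module B "free_mod B n" by (rule right_module_free_mod) unfold_locales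
  have S: "x ` {..<n} \<subseteq> carrier X" using assms by auto
  have "rcomb X n x u \<in> rspan B X (x ` {..<n})" if "u \<in> carrier (free_mod B n)" for u
    unfolding rcomb_def using that
    by (intro rspan_finsum S) (auto simp: carrier_free_mod intro!: rspan.gen)
  moreover have "y \<in> rcomb X n x ` carrier (free_mod B n)" if "y \<in> rspan B X (x ` {..<n})" for y
    using that
  proof induction
    case zero
    show ?case using F.hom_zero[OF right_module_axioms rcomb_hom[OF assms]]
      by (metis F.zero_closed imageI)
  next
    case (add y z)
    then show ?case using rcomb_add[OF assms] by (auto simp: image_iff) (metis F.a_closed)
  next
    case (gen y r)
    then obtain i where i: "i < n" "y = x i" by auto
    have "ract X y r = rcomb X n x (single B n i r)"
      unfolding i(2) by (rule rcomb_single[OF assms i(1) gen(2), symmetric])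
    then show ?case using single_closed[OF gen(2), of n i] by blast
  qed
  ultimately show ?thesis by blast
qed

lemma hom_image:
  assumes "f \<in> rmod_hom B (free_mod B n) X"
  shows "f ` carrier (free_mod B n) = rspan B X ((\<lambda>i. f (unit_vector n i)) ` {..<n})"
proof -
  have "f ` carrier (free_mod B n) = rcomb X n (\<lambda>i. f (unit_vector n i)) ` carrier (free_mod B n)"
    using hom_eq_rcomb[OF assms] by (intro image_cong) auto
  also have "\<dots> = rspan B X ((\<lambda>i. f (unit_vector n i)) ` {..<n})"
    using assms by (intro rcomb_image) (auto simp: rmod_hom_def single_closed)
  finally show ?thesis .
qed

lemma hom_kernel_rspan:
  assumes "right_module B Y" "f \<in> rmod_hom B X Y" "S \<subseteq> {x \<in> carrier X. f x = \<zero>\<^bsub>Y\<^esub>}"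
  shows "rspan B X S \<subseteq> {x \<in> carrier X. f x = \<zero>\<^bsub>Y\<^esub>}"
proof
  interpret Y: right_module B Y by fact
  fix x assume "x \<in> rspan B X S"
  then show "x \<in> {x \<in> carrier X. f x = \<zero>\<^bsub>Y\<^esub>}"
  proof induction
    case (gen x r)
    then have "x \<in> carrier X" "f x = \<zero>\<^bsub>Y\<^esub>" using assms(3) by auto
    moreover from this have "f (ract X x r) = ract Y (f x) r"
      using assms(2) gen by (auto simp: rmod_hom_def)
    ultimately show ?case using gen by (simp add: ract_closed Y.ract_zero_left)
  qed (use assms in \<open>auto simp: rmod_hom_def hom_zero[OF assms(1,2)]\<close>)
qed

text \<open>Schanuel's argument: lift two generating families along each other, by \<open>s\<close> and \<open>t\<close>. The
  kernel of the second is generated by the image under \<open>t\<close> of the kernel of the first and by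
  the elements \<open>e - t (s e)\<close> for the basis vectors \<open>e\<close>.\<close>

lemma fin_pres_kernel:
  assumes "fin_pres B X" and y: "y \<in> {..<m} \<rightarrow> carrier X"
    and gen: "rspan B X (y ` {..<m}) = carrier X"
  obtains T where "finite T" "T \<subseteq> carrier (free_mod B m)"
    "rspan B (free_mod B m) T = {u \<in> carrier (free_mod B m). rcomb X m y u = \<zero>}"
proof -
  obtain n x T where x: "x \<in> {..<n} \<rightarrow> carrier X" and genx: "rspan B X (x ` {..<n}) = carrier X"
    and T: "finite T" "rspan B (free_mod B n) T = {u \<in> carrier (free_mod B n). rcomb X n x u = \<zero>}"
      "T \<subseteq> carrier (free_mod B n)"
    using assms(1) unfolding fin_pres_def by blast
  let ?E = "free_mod B n" and ?F = "free_mod B m"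
  interpret E: right_module B ?E by (rule right_module_free_mod) unfold_locales
  interpret F: right_module B ?F by (rule right_module_free_mod) unfold_locales
  note hx = rcomb_hom[OF x] and hy = rcomb_hom[OF y]
  have "\<exists>w. w \<in> carrier ?E \<and> rcomb X n x w = y j" if "j < m" for j
  proof -
    have "y j \<in> rcomb X n x ` carrier ?E"
      unfolding rcomb_image[OF x] genx using y that by auto
    then show ?thesis by auto
  qed
  then obtain w where w: "\<And>j. j < m \<Longrightarrow> w j \<in> carrier ?E" "\<And>j. j < m \<Longrightarrow> rcomb X n x (w j) = y j"
    by metis
  have "\<exists>v. v \<in> carrier ?F \<and> rcomb X m y v = x i" if "i < n" for i
  proof -
    have "x i \<in> rcomb X m y ` carrier ?F"
      unfolding rcomb_image[OF y] gen using x that by auto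
    then show ?thesis by auto
  qed
  then obtain v where v: "\<And>i. i < n \<Longrightarrow> v i \<in> carrier ?F" "\<And>i. i < n \<Longrightarrow> rcomb X m y (v i) = x i"
    by metis
  define s where "s = rcomb ?E m w"
  define t where "t = rcomb ?F n v"
  define d where "d u = u \<ominus>\<^bsub>?F\<^esub> t (s u)" for u
  have sh: "s \<in> rmod_hom B ?F ?E" unfolding s_def by (rule E.rcomb_hom) (simp add: w)
  have th: "t \<in> rmod_hom B ?E ?F" unfolding t_def by (rule F.rcomb_hom) (simp add: v)
  have sc: "s u \<in> carrier ?E" if "u \<in> carrier ?F" for u using sh that by (auto simp: rmod_hom_def)
  have tc: "t u \<in> carrier ?F" if "u \<in> carrier ?E" for u using th that by (auto simp: rmod_hom_def)
  \<comment> \<open>Both \<open>s\<close> and \<open>t\<close> lift the identity of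
    \<open>X\<close>: each basis vector is sent to a combination with the same image in
    \<open>X\<close>.\<close>
  have ys: "rcomb X n x (s u) = rcomb X m y u" if "u \<in> carrier ?F" for u
    unfolding s_def
    by (subst E.hom_rcomb[OF right_module_axioms hx _ that])
      (use w that y in \<open>auto simp: rcomb_def carrier_free_mod intro!: finsum_cong' ract_closed\<close>)
  have xt: "rcomb X m y (t u) = rcomb X n x u" if "u \<in> carrier ?E" for u
    unfolding t_def
    by (subst F.hom_rcomb[OF right_module_axioms hy _ that])
      (use v that x in \<open>auto simp: rcomb_def carrier_free_mod intro!: finsum_cong' ract_closed\<close>)
  have dc: "d u \<in> carrier ?F" if "u \<in> carrier ?F" for u
    using that by (simp add: d_def sc tc)
  have neg: "\<ominus>\<^bsub>?F\<^esub> (ract ?F u r) = ract ?F (\<ominus>\<^bsub>?F\<^esub> u) r" if "u \<in> carrier ?F" "r \<in> carrier B" for u r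
    using that F.ract_add_left[of "\<ominus>\<^bsub>?F\<^esub> u" u r]
    by (intro F.minus_equality) (auto simp: F.ract_closed F.l_neg F.ract_zero_left)
  have dh: "d \<in> rmod_hom B ?F ?F"
  proof -
    have "d (p \<oplus>\<^bsub>?F\<^esub> q) = d p \<oplus>\<^bsub>?F\<^esub> d q" if p: "p \<in> carrier ?F" and q: "q \<in> carrier ?F" for p q
    proof -
      have "t (s (p \<oplus>\<^bsub>?F\<^esub> q)) = t (s p) \<oplus>\<^bsub>?F\<^esub> t (s q)"
        using sh th p q sc by (simp add: rmod_hom_def)
      then show ?thesis using p q tc[OF sc[OF p]] tc[OF sc[OF q]]
        by (simp add: d_def a_minus_def F.minus_add F.a_ac)
    qed
    moreover have "d (ract ?F p r) = ract ?F (d p) r" if p: "p \<in> carrier ?F" and r: "r \<in> carrier B" for p r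
    proof -
      have "t (s (ract ?F p r)) = ract ?F (t (s p)) r"
        using sh th p r sc by (simp add: rmod_hom_def)
      then show ?thesis using p r tc[OF sc[OF p]]
        by (simp add: d_def a_minus_def neg F.ract_add_left)
    qed
    ultimately show ?thesis using dc by (simp add: rmod_hom_def)
  qed
  \<comment> \<open>Writing \<open>x\<close> and \<open>y\<close> for the maps defined by the two
    families: \<open>y (d u) = y u - y (t (s u)) = y u - x (s u) = y u - y u\<close>.\<close>
  have yd: "rcomb X m y (d u) = \<zero>" if u: "u \<in> carrier ?F" for u
  proof -
    have "rcomb X m y (d u) \<oplus> rcomb X m y (t (s u)) = rcomb X m y u"
      using u dc[OF u] tc[OF sc[OF u]]
      by (subst rcomb_add[OF y, symmetric])
        (simp_all add: d_def a_minus_def F.a_assoc F.l_neg)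
    then have "rcomb X m y (d u) \<oplus> rcomb X m y u = rcomb X m y u"
      using xt[OF sc[OF u]] ys[OF u] by simp
    then show ?thesis using rcomb_closed[OF y] dc[OF u] u by (simp add: add.r_cancel_one)
  qed
  let ?D = "(\<lambda>i. d (unit_vector m i)) ` {..<m}"
  let ?T = "t ` T \<union> ?D"
  have Tsub: "T \<subseteq> {u \<in> carrier ?E. rcomb X n x u = \<zero>}"
    using T(2) E.rspan_superset[OF T(3)] by simp
  have Tc: "?T \<subseteq> {u \<in> carrier ?F. rcomb X m y u = \<zero>}"
    using Tsub tc dc yd single_closed xt by auto
  have Tc': "?T \<subseteq> carrier ?F" using Tc by auto
  \<comment> \<open>Split \<open>u\<close> into \<open>d u\<close> and \<open>t (s u)\<close>. If
    \<open>u\<close> is a relation among the \<open>y j\<close>, then \<open>s u\<close> is one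
    among the \<open>x i\<close> and hence lies in the span of \<open>T\<close>.\<close>
  have "u \<in> rspan B ?F ?T" if u: "u \<in> carrier ?F" "rcomb X m y u = \<zero>" for u
  proof -
    have "s u \<in> rspan B ?E T" using ys[OF u(1)] u T(2) sc by simp
    then have "t (s u) \<in> rspan B ?F (t ` T)"
      using E.hom_rspan[OF F.right_module_axioms th T(3)] by blast
    then have 1: "t (s u) \<in> rspan B ?F ?T" using rspan_mono[of "t ` T" ?T] by blast
    have "d u \<in> rspan B ?F ?D" using F.hom_image[OF dh] u by blast
    then have 2: "d u \<in> rspan B ?F ?T" using rspan_mono[of ?D ?T] by blast
    have "d u \<oplus>\<^bsub>?F\<^esub> t (s u) = u"
      using u tc[OF sc[OF u(1)]] by (simp add: d_def a_minus_def F.a_assoc F.l_neg)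
    then show ?thesis using rspan.add[OF 2 1] by simp
  qed
  moreover have "rspan B ?F ?T \<subseteq> {u \<in> carrier ?F. rcomb X m y u = \<zero>}"
    by (rule F.hom_kernel_rspan[OF right_module_axioms hy Tc])
  ultimately have "rspan B ?F ?T = {u \<in> carrier ?F. rcomb X m y u = \<zero>}" by blast
  moreover have "finite ?T" using T(1) by simp
  ultimately show ?thesis using that Tc' by blast
qed

end

section \<open>Graded modules\<close>

text \<open>The two sides may be graded by different groups and then have different types, so
  agreement of the underlying modules is stated field by field. Forgetting a degree, refining a
  grading and passing from \<open>free_mod\<close> to \<open>free_graded\<close> are of this
  kind.\<close>

definition same_module :: "('b, 'm, 'y) module_scheme \<Rightarrow> ('b, 'm, 'z) module_scheme \<Rightarrow> bool" where
  "same_module X Y \<longleftrightarrow> carrier Y = carrier X \<and> zero Y = zero X \<and> add Y = add X \<and> smult Y = smult X"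

lemma same_module_finsum: "same_module X Y \<Longrightarrow> finsum Y = finsum X"
  by (intro ext) (simp add: same_module_def finsum_def finprod_def)

lemma same_module_abelian_group: "same_module X Y \<Longrightarrow> abelian_group Y \<longleftrightarrow> abelian_group X"
  by (simp add: same_module_def abelian_group_def abelian_group_axioms_def abelian_monoid_def
    comm_group_def comm_monoid_def comm_monoid_axioms_def Group.group_def group_axioms_def
    Group.monoid_def Units_def)

lemma same_module_right_module: "same_module X Y \<Longrightarrow> right_module B Y \<longleftrightarrow> right_module B X"
  by (simp add: right_module_def right_module_axioms_def same_module_abelian_group)
    (simp add: same_module_def)

lemma same_module_rspan:
  assumes "same_module X Y" and "carrier C = carrier B"
  shows "rspan C Y S = rspan B X S"
proof (intro equalityI subsetI)
  fix x
  show "x \<in> rspan B X S" if "x \<in> rspan C Y S"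
    using that by induction (use assms in \<open>auto simp: same_module_def intro: rspan.intros\<close>)
  show "x \<in> rspan C Y S" if "x \<in> rspan B X S"
    using that
  proof induction
    case zero
    then show ?case using assms rspan.zero[of Y C S] by (simp add: same_module_def)
  next
    case (add x y)
    then show ?case using assms rspan.add[of x C Y S y] by (simp add: same_module_def)
  next
    case (gen x r)
    then show ?case using assms rspan.gen[of x S r C Y] by (simp add: same_module_def)
  qed
qed

lemma same_module_rcomb: "same_module X Y \<Longrightarrow> rcomb Y = rcomb X"
  by (simp add: rcomb_def fun_eq_iff same_module_finsum) (simp add: same_module_def)

lemma same_module_rmod_hom:
  "same_module X Y \<Longrightarrow> same_module X' Y' \<Longrightarrow> rmod_hom B Y Y' = rmod_hom B X X'"
  by (simp add: rmod_hom_def same_module_def)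

text \<open>The rings are matched field by field as well: \<open>R\<close> and \<open>Rb\<close> are
  one ring but differ in the type of their degrees.\<close>

lemma same_module_fin_pres:
  assumes "same_module X Y" "carrier C = carrier B" "zero C = zero B" "add C = add B" "mult C = mult B"
  shows "fin_pres C Y \<longleftrightarrow> fin_pres B X"
proof -
  have F: "free_mod C n = free_mod B n" for n
    using assms by (simp add: free_mod_def)
  have Z: "\<zero>\<^bsub>Y\<^esub> = \<zero>\<^bsub>X\<^esub>" "carrier Y = carrier X" using assms by (auto simp: same_module_def)
  have S: "rspan C Y S = rspan B X S" "rspan C (free_mod B n) T = rspan B (free_mod B n) T" for S n T
    using assms by (auto intro!: same_module_rspan simp: same_module_def)
  show ?thesis
    unfolding fin_pres_def F Z S same_module_rcomb[OF assms(1)] by (rule refl)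
qed

lemma same_module_free_graded: "same_module (free_mod B (length gs)) (free_graded G B gs)"
  by (simp add: same_module_def free_mod_def free_graded_def Let_def)

section \<open>Graded rings and graded free modules\<close>

locale graded_ring = G: group G + B: ring B
  for G :: "('g, 'y) monoid_scheme" and B :: "('k, 'b, 'g) graded" +
  assumes grading: "is_grading G B"
    and grade_mult: "\<lbrakk>g \<in> carrier G; h \<in> carrier G; x \<in> grade B g; y \<in> grade B h\<rbrakk> \<Longrightarrow>
        x \<otimes>\<^bsub>B\<^esub> y \<in> grade B (g \<otimes>\<^bsub>G\<^esub> h)"

sublocale graded_ring \<subseteq> gr: graded_group G B
  by unfold_locales (rule grading)

lemma graded_algebra_graded_ring: "graded_algebra K G B \<Longrightarrow> graded_ring G B"
  unfolding graded_ring_def graded_ring_axioms_def graded_algebra_def graded_algebra_axioms_def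
  by blast

context graded_ring
begin

text \<open>Let \<open>e\<close> be the neutral component of the unit. Comparing components of
  degree \<open>h\<close> in \<open>r = r 1\<close> gives \<open>r = r e\<close> for
  \<open>r\<close> of degree \<open>h\<close>, hence for all \<open>r\<close>, and
  \<open>r = 1\<close> yields \<open>1 = e\<close>. Scalars \<open>t.1\<close> are therefore of
  neutral degree, on which all later eigenvalue computations rest.\<close>

lemma one_homogeneous: "\<one>\<^bsub>B\<^esub> \<in> grade B \<one>\<^bsub>G\<^esub>"
proof -
  let ?e = "hparts G B \<one>\<^bsub>B\<^esub>"
  have e: "?e g \<in> grade B g" "?e g \<in> carrier B" if "g \<in> carrier G" for g
    using that gr.hparts_grade gr.hparts_closed by auto
  have "r \<otimes>\<^bsub>B\<^esub> ?e \<one>\<^bsub>G\<^esub> = r" if "r \<in> carrier B" for r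
    using that
  proof (induction r rule: gr.homogeneous_induct)
    case (homogeneous h r)
    have rc: "r \<in> carrier B" using homogeneous gr.grade_carrier by blast
    \<comment> \<open>Left multiplication by \<open>r\<close> moves degree \<open>g\<close> to
      \<open>h g\<close>, which equals \<open>h\<close> for the neutral \<open>g\<close>
      only.\<close>
    have parts: "hparts G B (r \<otimes>\<^bsub>B\<^esub> y) h = r \<otimes>\<^bsub>B\<^esub> hparts G B y \<one>\<^bsub>G\<^esub>" if "y \<in> carrier B" for y
      using that
    proof (induction y rule: gr.homogeneous_induct)
      case zero
      show ?case using homogeneous rc by (simp add: gr.hparts_zero)
    next
      case (add x y)
      then show ?case using homogeneous rc
        by (simp add: B.r_distr gr.hparts_add gr.hparts_closed)
    next
      case (homogeneous g y)
      have "h = h \<otimes>\<^bsub>G\<^esub> g \<longleftrightarrow> \<one>\<^bsub>G\<^esub> = g"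
        using \<open>h \<in> carrier G\<close> homogeneous(1) by (metis G.l_cancel_one')
      then show ?case
        using homogeneous rc \<open>h \<in> carrier G\<close> grade_mult[OF \<open>h \<in> carrier G\<close> homogeneous(1) \<open>r \<in> grade B h\<close> homogeneous(2)]
        by (subst gr.hparts_homogeneous[of "h \<otimes>\<^bsub>G\<^esub> g"]) (auto simp: gr.hparts_homogeneous)
    qed
    have "r \<otimes>\<^bsub>B\<^esub> ?e \<one>\<^bsub>G\<^esub> = hparts G B (r \<otimes>\<^bsub>B\<^esub> \<one>\<^bsub>B\<^esub>) h"
      by (simp add: parts)
    also have "\<dots> = r" using homogeneous rc by (simp add: gr.hparts_homogeneous)
    finally show ?case .
  qed (auto simp: e B.l_distr)
  from this[of "\<one>\<^bsub>B\<^esub>"] e[of "\<one>\<^bsub>G\<^esub>"] show ?thesis by simp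
qed

lemma right_module_free_graded: "right_module B (free_graded G B gs)"
  using same_module_right_module[OF same_module_free_graded] right_module_free_mod[OF B.ring_axioms]
  by blast

lemma grade_free_graded:
  "g \<in> carrier G \<Longrightarrow> grade (free_graded G B gs) g
    = (\<Pi>\<^sub>E i\<in>{..<length gs}. grade B (inv\<^bsub>G\<^esub> (gs ! i) \<otimes>\<^bsub>G\<^esub> g))"
  by (simp add: free_graded_def Let_def)

lemma carrier_free_graded: "carrier (free_graded G B gs) = {..<length gs} \<rightarrow>\<^sub>E carrier B"
  by (simp add: free_graded_def Let_def)

lemma zero_free_graded: "\<zero>\<^bsub>free_graded G B gs\<^esub> = (\<lambda>i\<in>{..<length gs}. \<zero>\<^bsub>B\<^esub>)"
  by (simp add: free_graded_def Let_def)

lemma add_free_graded: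
  "\<lbrakk>u \<in> carrier (free_graded G B gs); v \<in> carrier (free_graded G B gs)\<rbrakk> \<Longrightarrow>
    u \<oplus>\<^bsub>free_graded G B gs\<^esub> v = (\<lambda>i\<in>{..<length gs}. u i \<oplus>\<^bsub>B\<^esub> v i)"
  by (simp add: free_graded_def Let_def)

lemma smult_free_graded:
  "\<lbrakk>u \<in> carrier (free_graded G B gs); r \<in> carrier B\<rbrakk> \<Longrightarrow>
    ract (free_graded G B gs) u r = (\<lambda>i\<in>{..<length gs}. u i \<otimes>\<^bsub>B\<^esub> r)"
  by (simp add: free_graded_def Let_def)

text \<open>The projections act entrywise, with degrees shifted by the inverse of
  \<open>gs ! i\<close>. A vector is the sum of its entries placed at single positions, and an entry
  of degree \<open>h\<close> at position \<open>i\<close> is homogeneous of degree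
  \<open>(gs ! i) h\<close>.\<close>

lemma is_grading_free_graded:
  assumes gs: "set gs \<subseteq> carrier G"
  shows "is_grading G (free_graded G B gs)"
proof (rule is_gradingI[where proj = "\<lambda>g u. \<lambda>i\<in>{..<length gs}. hparts G B (u i) (inv\<^bsub>G\<^esub> (gs ! i) \<otimes>\<^bsub>G\<^esub> g)"])
  let ?F = "free_graded G B gs" and ?n = "length gs"
  interpret F: right_module B ?F by (rule right_module_free_graded)
  have gi: "gs ! i \<in> carrier G" if "i < ?n" for i using gs that by auto
  then have ig: "inv\<^bsub>G\<^esub> (gs ! i) \<otimes>\<^bsub>G\<^esub> g \<in> carrier G" if "i < ?n" "g \<in> carrier G" for i g
    using that by auto
  show "abelian_group ?F" by (rule F.abelian_group_axioms)
  show "grade ?F \<in> extensional (carrier G)"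
    by (simp add: free_graded_def Let_def)
  show "grade ?F g \<subseteq> carrier ?F" if "g \<in> carrier G" for g
    using that ig by (auto simp: grade_free_graded carrier_free_graded PiE_iff intro: gr.grade_carrier)
  show "(\<lambda>i\<in>{..<?n}. hparts G B (u i) (inv\<^bsub>G\<^esub> (gs ! i) \<otimes>\<^bsub>G\<^esub> g)) \<in> grade ?F g"
    if "g \<in> carrier G" "u \<in> carrier ?F" for g u
    using that ig by (auto simp: grade_free_graded carrier_free_graded PiE_iff intro: gr.hparts_grade)
  have single: "single B ?n i r \<in> grade_span G ?F" if "r \<in> carrier B" "i < ?n" for i r
    using that(1)
  proof (induction r rule: gr.homogeneous_induct)
    case zero
    have "single B ?n i \<zero>\<^bsub>B\<^esub> = \<zero>\<^bsub>?F\<^esub>"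
      by (auto simp: single_def zero_free_graded)
    then show ?case by (simp add: grade_span.zero)
  next
    case (add r s)
    have "single B ?n i (r \<oplus>\<^bsub>B\<^esub> s) = single B ?n i r \<oplus>\<^bsub>?F\<^esub> single B ?n i s"
      using add(1,2)
      by (subst add_free_graded) (auto simp: single_def carrier_free_graded fun_eq_iff)
    then show ?case using add by (simp add: grade_span.add)
  next
    case (homogeneous h r)
    have "inv\<^bsub>G\<^esub> (gs ! i) \<otimes>\<^bsub>G\<^esub> (gs ! i \<otimes>\<^bsub>G\<^esub> h) = h"
      using homogeneous gi[OF that(2)] by (simp add: G.m_assoc[symmetric])
    then have "single B ?n i r \<in> grade ?F (gs ! i \<otimes>\<^bsub>G\<^esub> h)"
      using homogeneous gi[OF that(2)] ig
      by (auto simp: grade_free_graded single_def gr.grade_zero)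
    then show ?case using homogeneous gi[OF that(2)] by (auto intro: grade_span.homogeneous)
  qed
  show "carrier ?F \<subseteq> grade_span G ?F"
  proof
    fix u assume u: "u \<in> carrier ?F"
    have uc: "u i \<in> carrier B" if "i < ?n" for i
      using u that by (auto simp: carrier_free_graded)
    interpret M: right_module B "free_mod B ?n" by (rule right_module_free_mod[OF B.ring_axioms])
    have F: "carrier (free_mod B ?n) = carrier ?F" "smult (free_mod B ?n) = smult ?F"
      using same_module_free_graded[of B gs G] by (auto simp: same_module_def)
    have "ract ?F (M.unit_vector ?n i) (u i) = single B ?n i (u i)" if "i < ?n" for i
      using uc[OF that]
      by (subst smult_free_graded) (auto simp: carrier_free_graded single_def fun_eq_iff)
    then have "(\<Oplus>\<^bsub>?F\<^esub>i\<in>{..<?n}. ract ?F (M.unit_vector ?n i) (u i)) \<in> grade_span G ?F"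
      using single uc by (intro grade_span_finsum[OF F.abelian_group_axioms])
        (auto simp: F(1)[symmetric] M.single_closed)
    moreover have "(\<Oplus>\<^bsub>?F\<^esub>i\<in>{..<?n}. ract ?F (M.unit_vector ?n i) (u i)) = u"
      using M.rcomb_unit_vector[of u ?n] u
      unfolding rcomb_def F same_module_finsum[OF same_module_free_graded[of B gs G], symmetric] by simp
    ultimately show "u \<in> grade_span G ?F" by simp
  qed
  show "(\<lambda>i\<in>{..<?n}. hparts G B ((u \<oplus>\<^bsub>?F\<^esub> v) i) (inv\<^bsub>G\<^esub> (gs ! i) \<otimes>\<^bsub>G\<^esub> g))
      = (\<lambda>i\<in>{..<?n}. hparts G B (u i) (inv\<^bsub>G\<^esub> (gs ! i) \<otimes>\<^bsub>G\<^esub> g)) \<oplus>\<^bsub>?F\<^esub>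
        (\<lambda>i\<in>{..<?n}. hparts G B (v i) (inv\<^bsub>G\<^esub> (gs ! i) \<otimes>\<^bsub>G\<^esub> g))"
    if "g \<in> carrier G" "u \<in> carrier ?F" "v \<in> carrier ?F" for g u v
  proof -
    have uc: "u i \<in> carrier B" "v i \<in> carrier B" if "i < ?n" for i
      using \<open>u \<in> carrier ?F\<close> \<open>v \<in> carrier ?F\<close> that by (auto simp: carrier_free_graded)
    have c: "(\<lambda>i\<in>{..<?n}. hparts G B (w i) (inv\<^bsub>G\<^esub> (gs ! i) \<otimes>\<^bsub>G\<^esub> g)) \<in> carrier ?F"
      if "\<And>i. i < ?n \<Longrightarrow> w i \<in> carrier B" for w
      using that ig \<open>g \<in> carrier G\<close> by (auto simp: carrier_free_graded gr.hparts_closed)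
    have cu: "(\<lambda>i\<in>{..<?n}. hparts G B (u i) (inv\<^bsub>G\<^esub> (gs ! i) \<otimes>\<^bsub>G\<^esub> g)) \<in> carrier ?F"
      by (rule c) (rule uc)
    have cv: "(\<lambda>i\<in>{..<?n}. hparts G B (v i) (inv\<^bsub>G\<^esub> (gs ! i) \<otimes>\<^bsub>G\<^esub> g)) \<in> carrier ?F"
      by (rule c) (rule uc)
    show ?thesis
      unfolding add_free_graded[OF cu cv] add_free_graded[OF that(2,3)]
      using uc ig \<open>g \<in> carrier G\<close> by (auto simp: gr.hparts_add fun_eq_iff)
  qed
  show "(\<lambda>i\<in>{..<?n}. hparts G B (u i) (inv\<^bsub>G\<^esub> (gs ! i) \<otimes>\<^bsub>G\<^esub> g)) = (if g = h then u else \<zero>\<^bsub>?F\<^esub>)"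
    if "g \<in> carrier G" "h \<in> carrier G" "u \<in> grade ?F h" for g h u
  proof -
    have u: "u \<in> (\<Pi>\<^sub>E i\<in>{..<?n}. grade B (inv\<^bsub>G\<^esub> (gs ! i) \<otimes>\<^bsub>G\<^esub> h))"
      using that grade_free_graded by blast
    have "hparts G B (u i) (inv\<^bsub>G\<^esub> (gs ! i) \<otimes>\<^bsub>G\<^esub> g) = (if g = h then u i else \<zero>\<^bsub>B\<^esub>)" if "i < ?n" for i
      using u that ig gi \<open>g \<in> carrier G\<close> \<open>h \<in> carrier G\<close>
      by (subst gr.hparts_homogeneous[of "inv\<^bsub>G\<^esub> (gs ! i) \<otimes>\<^bsub>G\<^esub> h"]) auto
    then show ?thesis
      using u by (auto simp: zero_free_graded fun_eq_iff PiE_iff extensional_def)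
  qed
qed

lemma graded_module_free_graded:
  assumes "set gs \<subseteq> carrier G"
  shows "graded_module G B (free_graded G B gs)"
proof -
  let ?F = "free_graded G B gs"
  interpret F: right_module B ?F by (rule right_module_free_graded)
  show ?thesis
  proof unfold_locales
    show "is_grading G ?F" by (rule is_grading_free_graded[OF assms])
    show "ract ?F u r \<in> grade ?F (g \<otimes>\<^bsub>G\<^esub> h)"
      if "g \<in> carrier G" "h \<in> carrier G" "u \<in> grade ?F g" "r \<in> grade B h" for g h u r
    proof -
      have gi: "gs ! i \<in> carrier G" if "i < length gs" for i using assms that by auto
      have u: "u i \<in> grade B (inv\<^bsub>G\<^esub> (gs ! i) \<otimes>\<^bsub>G\<^esub> g)" if "i < length gs" for i
        using that \<open>u \<in> grade ?F g\<close> \<open>g \<in> carrier G\<close> by (auto simp: grade_free_graded)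
      have "u i \<in> carrier B" if "i < length gs" for i
        using gr.grade_carrier[OF _ u[OF that]] gi[OF that] \<open>g \<in> carrier G\<close> by simp
      then have "u \<in> carrier ?F"
        using that by (auto simp: grade_free_graded carrier_free_graded PiE_iff)
      moreover have "r \<in> carrier B" using that gr.grade_carrier by blast
      moreover have "u i \<otimes>\<^bsub>B\<^esub> r \<in> grade B (inv\<^bsub>G\<^esub> (gs ! i) \<otimes>\<^bsub>G\<^esub> (g \<otimes>\<^bsub>G\<^esub> h))" if "i < length gs" for i
        using grade_mult[OF _ \<open>h \<in> carrier G\<close> u[OF that] \<open>r \<in> grade B h\<close>] gi[OF that]
          \<open>g \<in> carrier G\<close> \<open>h \<in> carrier G\<close> by (simp add: G.m_assoc)
      ultimately show ?thesis
        using that by (simp add: smult_free_graded grade_free_graded)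
    qed
  qed (simp_all add: F.ract_closed F.ract_add_left F.ract_add_right F.ract_mult F.ract_one,
      auto simp: free_graded_def Let_def fun_eq_iff restrict_def)
qed

end

section \<open>Graded maps, homogeneous generators and finite presentations\<close>

lemma graded_module_right_module:
  assumes "graded_module G B X"
  shows "right_module B X"
proof -
  interpret M: graded_module G B X by fact
  show ?thesis
    by unfold_locales
      (simp_all add: M.ract_closed M.ract_add_left M.ract_add_right M.ract_mult M.ract_one)
qed

lemma graded_module_graded_group:
  assumes "graded_module G B X"
  shows "graded_group G X"
proof -
  interpret M: graded_module G B X by fact
  show ?thesis by unfold_locales (rule M.module_grading)
qed

lemma graded_hom_closed: "f \<in> graded_hom G B X Y \<Longrightarrow> x \<in> carrier X \<Longrightarrow> f x \<in> carrier Y"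
  by (auto simp: graded_hom_def)

lemma graded_hom_grade:
  "f \<in> graded_hom G B X Y \<Longrightarrow> g \<in> carrier G \<Longrightarrow> x \<in> grade X g \<Longrightarrow> f x \<in> grade Y g"
  unfolding graded_hom_def by blast

lemma graded_hom_rmod_hom: "f \<in> graded_hom G B X Y \<Longrightarrow> f \<in> rmod_hom B X Y"
  by (auto simp: graded_hom_def rmod_hom_def)

text \<open>A degree-preserving map carries the decomposition of \<open>x\<close> to that of
  \<open>f x\<close>. Consequently the components of an element of its kernel lie in the
  kernel.\<close>

lemma graded_hom_hparts:
  assumes "graded_module G B X" "graded_module G B Y" "f \<in> graded_hom G B X Y"
    and "x \<in> carrier X" "g \<in> carrier G"
  shows "hparts G Y (f x) g = f (hparts G X x g)"
proof -
  interpret X: graded_group G X by (rule graded_module_graded_group[OF assms(1)])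
  interpret Y: graded_group G Y by (rule graded_module_graded_group[OF assms(2)])
  interpret MX: right_module B X by (rule graded_module_right_module[OF assms(1)])
  have f0: "f \<zero>\<^bsub>X\<^esub> = \<zero>\<^bsub>Y\<^esub>"
    using assms by (intro MX.hom_zero[of Y] graded_hom_rmod_hom graded_module_right_module)
  note fc = graded_hom_closed[OF assms(3)]
  show ?thesis using assms(4)
  proof (induction x rule: X.homogeneous_induct)
    case zero
    then show ?case using assms(5) f0 by (simp add: X.hparts_zero Y.hparts_zero)
  next
    case (add x y)
    moreover have "f (x \<oplus>\<^bsub>X\<^esub> y) = f x \<oplus>\<^bsub>Y\<^esub> f y"
      "f (hparts G X x g \<oplus>\<^bsub>X\<^esub> hparts G X y g) = f (hparts G X x g) \<oplus>\<^bsub>Y\<^esub> f (hparts G X y g)"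
      using assms(3) X.hparts_closed[OF _ assms(5)] add(1,2) unfolding graded_hom_def by blast+
    ultimately show ?case using assms(5) fc by (simp add: X.hparts_add Y.hparts_add)
  next
    case (homogeneous h x)
    then have "f x \<in> grade Y h" by (rule graded_hom_grade[OF assms(3)])
    then show ?case using homogeneous assms(5) f0 by (simp add: X.hparts_homogeneous Y.hparts_homogeneous)
  qed
qed

text \<open>An element is the sum of its components, so the components of the members of
  \<open>T\<close> span \<open>T\<close>. The fourth conclusion records where each of them comes
  from: if \<open>T\<close> consists of relations, it shows that the new elements are relations,
  too.\<close>

lemma homogeneous_generators:
  assumes X: "graded_module G B X" and T: "finite T" "T \<subseteq> carrier X"
  obtains gs y where "set gs \<subseteq> carrier G" "y \<in> {..<length gs} \<rightarrow> carrier X"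
    "\<And>i. i < length gs \<Longrightarrow> y i \<in> grade X (gs ! i)"
    "\<And>i. i < length gs \<Longrightarrow> \<exists>x\<in>T. y i = hparts G X x (gs ! i)"
    "T \<subseteq> rspan B X (y ` {..<length gs})"
proof -
  interpret X: graded_group G X by (rule graded_module_graded_group[OF X])
  interpret MX: right_module B X by (rule graded_module_right_module[OF X])
  let ?P = "\<Union>x\<in>T. (\<lambda>g. (g, hparts G X x g)) ` hsupport G X (hparts G X x)"
  have "finite ?P" using T X.finite_hsupport by auto
  then obtain ps where ps: "set ps = ?P" by (rule finite_list[THEN exE])
  define gs where "gs = map fst ps"
  define y where "y i = snd (ps ! i)" for i
  have part: "gs ! i \<in> carrier G \<and> (\<exists>x\<in>T. y i = hparts G X x (gs ! i))" if "i < length gs" for i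
  proof -
    have "ps ! i \<in> ?P" using that nth_mem[of i ps] unfolding ps gs_def by simp
    then show ?thesis using that by (auto simp: gs_def y_def hsupport_def)
  qed
  have gr: "y i \<in> grade X (gs ! i)" if "i < length gs" for i
    using part[OF that] T(2) by (auto intro!: X.hparts_grade)
  have yc: "y \<in> {..<length gs} \<rightarrow> carrier X"
    using X.grade_carrier[OF _ gr] part by auto
  have yS: "y ` {..<length gs} = snd ` ?P"
    unfolding ps[symmetric] by (auto simp: y_def gs_def set_conv_nth)
  have "x \<in> rspan B X (y ` {..<length gs})" if x: "x \<in> T" for x
  proof -
    have "(\<Oplus>\<^bsub>X\<^esub>g\<in>hsupport G X (hparts G X x). hparts G X x g) \<in> rspan B X (y ` {..<length gs})"
    proof (rule MX.rspan_finsum)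
      show "y ` {..<length gs} \<subseteq> carrier X" using yc by blast
      show "finite (hsupport G X (hparts G X x))" using X.finite_hsupport x T(2) by blast
      show "hparts G X x g \<in> rspan B X (y ` {..<length gs})" if "g \<in> hsupport G X (hparts G X x)" for g
      proof -
        have "hparts G X x g \<in> y ` {..<length gs}"
          unfolding yS using x that by (auto simp: image_iff)
        then show ?thesis using MX.rspan_superset[of "y ` {..<length gs}"] yc by blast
      qed
    qed
    then show ?thesis using X.sum_hparts x T(2) by auto
  qed
  moreover have "set gs \<subseteq> carrier G" using part by (auto simp: set_conv_nth)
  ultimately show ?thesis using that[OF _ yc gr] part by blast
qed

context graded_ring
begin

text \<open>A vector of degree \<open>g\<close> has its \<open>i\<close>-th entry in degree
  \<open>(gs ! i)^-1 g\<close>, and multiplying \<open>x i\<close> by it leads back to degree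
  \<open>g\<close>.\<close>

lemma rcomb_graded_hom:
  assumes X: "graded_module G B X" and gs: "set gs \<subseteq> carrier G"
    and x: "\<And>i. i < length gs \<Longrightarrow> x i \<in> grade X (gs ! i)"
  shows "restrict (rcomb X (length gs) x) (carrier (free_graded G B gs))
      \<in> graded_hom G B (free_graded G B gs) X"
proof -
  let ?F = "free_graded G B gs" and ?n = "length gs"
  interpret X: graded_group G X by (rule graded_module_graded_group[OF X])
  interpret MX: right_module B X by (rule graded_module_right_module[OF X])
  interpret F: right_module B ?F by (rule right_module_free_graded)
  interpret FG: graded_group G ?F by (rule graded_module_graded_group[OF graded_module_free_graded[OF gs]])
  have gi: "gs ! i \<in> carrier G" if "i < ?n" for i using gs that by auto
  have "x \<in> {..<?n} \<rightarrow> carrier X" using x gi X.grade_carrier by auto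
  moreover have "rmod_hom B ?F X = rmod_hom B (free_mod B ?n) X"
    by (rule same_module_rmod_hom[OF same_module_free_graded]) (simp add: same_module_def)
  ultimately have "rcomb X ?n x \<in> rmod_hom B ?F X"
    using MX.rcomb_hom by blast
  moreover have "rcomb X ?n x u \<in> grade X g" if "g \<in> carrier G" "u \<in> grade ?F g" for g u
    unfolding rcomb_def
  proof (rule X.grade_finsum[OF that(1)])
    fix i assume "i \<in> {..<?n}"
    then have i: "i < ?n" by simp
    have "ract X (x i) (u i) \<in> grade X (gs ! i \<otimes>\<^bsub>G\<^esub> (inv\<^bsub>G\<^esub> (gs ! i) \<otimes>\<^bsub>G\<^esub> g))"
      using that gi[OF i] i x[OF i]
      by (intro graded_module.grade_ract[OF X]) (auto simp: grade_free_graded)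
    then show "ract X (x i) (u i) \<in> grade X g"
      using that gi[OF i] by (simp add: G.m_assoc[symmetric])
  qed
  ultimately show ?thesis
    using FG.grade_carrier F.ract_closed by (auto simp: graded_hom_def rmod_hom_def)
qed

text \<open>Passing to components makes the generators homogeneous, and afterwards the relations
  among them. In between, a finite set of relations is required for the new generators, whereas the
  hypothesis concerns the old ones; \<open>fin_pres_kernel\<close> bridges this gap.\<close>

theorem fin_presented_iff:
  assumes X: "graded_module G B X"
  shows "fin_presented G B X \<longleftrightarrow> fin_pres B X"
proof
  interpret MX: right_module B X by (rule graded_module_right_module[OF X])
  have hom_free: "rmod_hom B (free_graded G B gs) Y = rmod_hom B (free_mod B (length gs)) Y"
    for gs and Y :: "('b, 'n, 'z) module_scheme"
    by (rule same_module_rmod_hom[OF same_module_free_graded]) (simp add: same_module_def)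
  have hom_free': "rmod_hom B Y (free_graded G B gs) = rmod_hom B Y (free_mod B (length gs))"
    for gs and Y :: "('b, 'n, 'z) module_scheme"
    by (rule same_module_rmod_hom[OF _ same_module_free_graded]) (simp add: same_module_def)
  have carrier_free: "carrier (free_graded G B gs) = carrier (free_mod B (length gs))" for gs
    using same_module_free_graded[of B gs G] by (simp add: same_module_def)
  {
    assume "fin_presented G B X"
    then obtain gs hs \<phi> \<epsilon> where "set gs \<subseteq> carrier G" "set hs \<subseteq> carrier G" and
      \<phi>: "\<phi> \<in> graded_hom G B (free_graded G B hs) (free_graded G B gs)" and
      \<epsilon>: "\<epsilon> \<in> graded_hom G B (free_graded G B gs) X" and
      surj: "\<epsilon> ` carrier (free_graded G B gs) = carrier X" and
      ker: "\<phi> ` carrier (free_graded G B hs) = {u \<in> carrier (free_graded G B gs). \<epsilon> u = \<zero>\<^bsub>X\<^esub>}"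
      unfolding fin_presented_def by (elim exE conjE)
    let ?F = "free_mod B (length gs)" and ?E = "free_mod B (length hs)"
    interpret F: right_module B ?F by (rule right_module_free_mod[OF B.ring_axioms])
    have e: "\<epsilon> \<in> rmod_hom B ?F X" using graded_hom_rmod_hom[OF \<epsilon>] hom_free by blast
    have p: "\<phi> \<in> rmod_hom B ?E ?F" using graded_hom_rmod_hom[OF \<phi>] hom_free hom_free' by blast
    let ?x = "\<lambda>i. \<epsilon> (MX.unit_vector (length gs) i)"
    let ?T = "(\<lambda>i. \<phi> (MX.unit_vector (length hs) i)) ` {..<length hs}"
    have "?x \<in> {..<length gs} \<rightarrow> carrier X"
      using e MX.single_closed by (auto simp: rmod_hom_def)
    moreover have "rspan B X (?x ` {..<length gs}) = carrier X"
      using MX.hom_image[OF e] surj by (simp add: carrier_free)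
    moreover have "finite ?T" "?T \<subseteq> carrier ?F"
      using p MX.single_closed by (auto simp: rmod_hom_def)
    moreover have "rspan B ?F ?T = {u \<in> carrier ?F. rcomb X (length gs) ?x u = \<zero>\<^bsub>X\<^esub>}"
      using F.hom_image[OF p] ker MX.hom_eq_rcomb[OF e] by (auto simp: carrier_free)
    ultimately show "fin_pres B X" unfolding fin_pres_def by blast
  next
    assume fp: "fin_pres B X"
    then obtain n :: nat and x where x: "x \<in> {..<n} \<rightarrow> carrier X" "rspan B X (x ` {..<n}) = carrier X"
      unfolding fin_pres_def by blast
    have "finite (x ` {..<n})" "x ` {..<n} \<subseteq> carrier X" using x by auto
    then obtain gs y where gs: "set gs \<subseteq> carrier G" and yc: "y \<in> {..<length gs} \<rightarrow> carrier X"
      and yg: "\<And>i. i < length gs \<Longrightarrow> y i \<in> grade X (gs ! i)"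
      and ys: "x ` {..<n} \<subseteq> rspan B X (y ` {..<length gs})"
      by (rule homogeneous_generators[OF X]) blast
    interpret XG: graded_group G X by (rule graded_module_graded_group[OF X])
    have yS: "y ` {..<length gs} \<subseteq> carrier X" using yc by blast
    have gen: "rspan B X (y ` {..<length gs}) = carrier X"
      using MX.rspan_minimal[OF yS ys] x(2) MX.rspan_closed[OF yS] by auto
    obtain T where T: "finite T" "T \<subseteq> carrier (free_mod B (length gs))"
      "rspan B (free_mod B (length gs)) T
        = {u \<in> carrier (free_mod B (length gs)). rcomb X (length gs) y u = \<zero>\<^bsub>X\<^esub>}"
      using MX.fin_pres_kernel[OF fp yc gen] by blast
    let ?F = "free_graded G B gs"
    have FG: "graded_module G B ?F" by (rule graded_module_free_graded[OF gs])
    interpret F: right_module B ?F by (rule right_module_free_graded)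
    interpret FG: graded_group G ?F by (rule graded_module_graded_group[OF FG])
    define \<epsilon> where "\<epsilon> = restrict (rcomb X (length gs) y) (carrier ?F)"
    have \<epsilon>: "\<epsilon> \<in> graded_hom G B ?F X"
      unfolding \<epsilon>_def by (rule rcomb_graded_hom[OF X gs yg])
    have surj: "\<epsilon> ` carrier ?F = carrier X"
      using MX.rcomb_image[OF yc] gen by (simp add: \<epsilon>_def carrier_free)
    have spanF: "rspan B ?F S = rspan B (free_mod B (length gs)) S" for S
      by (rule same_module_rspan[OF same_module_free_graded refl])
    have ker: "{u \<in> carrier ?F. \<epsilon> u = \<zero>\<^bsub>X\<^esub>} = rspan B ?F T"
      unfolding spanF T(3) by (auto simp: \<epsilon>_def carrier_free)
    have TF: "T \<subseteq> carrier ?F" using T(2) by (simp add: carrier_free)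
    obtain hs z where hs: "set hs \<subseteq> carrier G" and zc: "z \<in> {..<length hs} \<rightarrow> carrier ?F"
      and zg: "\<And>i. i < length hs \<Longrightarrow> z i \<in> grade ?F (hs ! i)"
      and zT: "\<And>i. i < length hs \<Longrightarrow> \<exists>u\<in>T. z i = hparts G ?F u (hs ! i)"
      and zs: "T \<subseteq> rspan B ?F (z ` {..<length hs})"
      by (rule homogeneous_generators[OF FG T(1) TF]) blast
    define \<phi> where "\<phi> = restrict (rcomb ?F (length hs) z) (carrier (free_graded G B hs))"
    have \<phi>: "\<phi> \<in> graded_hom G B (free_graded G B hs) ?F"
      unfolding \<phi>_def by (rule rcomb_graded_hom[OF FG hs zg])
    have "\<phi> ` carrier (free_graded G B hs) = rspan B ?F (z ` {..<length hs})"
      using F.rcomb_image[OF zc] by (simp add: \<phi>_def carrier_free)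
    also have "\<dots> = rspan B ?F T"
    proof
      show "rspan B ?F T \<subseteq> rspan B ?F (z ` {..<length hs})"
        using zc by (intro F.rspan_minimal[OF _ zs]) blast
      \<comment> \<open>A component of a relation is again a relation, because
        \<open>\<epsilon>\<close> preserves degrees.\<close>
      have "z i \<in> rspan B ?F T" if i: "i < length hs" for i
      proof -
        obtain u where u: "u \<in> T" "z i = hparts G ?F u (hs ! i)" using zT[OF i] by blast
        have h: "hs ! i \<in> carrier G" using hs i by auto
        have uc: "u \<in> carrier ?F" and "\<epsilon> u = \<zero>\<^bsub>X\<^esub>"
          using u TF F.rspan_superset[OF TF] ker by auto
        then have "\<epsilon> (z i) = \<zero>\<^bsub>X\<^esub>"
          using graded_hom_hparts[OF FG X \<epsilon> uc h] XG.hparts_zero[OF h] u by simp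
        then show ?thesis using ker FG.hparts_closed[OF uc h] u(2) by auto
      qed
      then show "rspan B ?F (z ` {..<length hs}) \<subseteq> rspan B ?F T"
        by (intro F.rspan_minimal[OF TF]) blast
    qed
    finally have "\<phi> ` carrier (free_graded G B hs) = {u \<in> carrier ?F. \<epsilon> u = \<zero>\<^bsub>X\<^esub>}"
      using ker by simp
    with gs hs \<phi> \<epsilon> surj show "fin_presented G B X"
      unfolding fin_presented_def by blast
  }
qed

end


section \<open>Characters over a splitting field\<close>

text \<open>They are roots of \<open>X^n - 1\<close>, a nonzero polynomial over a field.\<close>

lemma (in field) finite_roots_of_unity:
  assumes "0 < n"
  shows "finite {x \<in> carrier R. x [^] (n :: nat) = \<one>}"
proof -
  \<comment> \<open>This is \<open>X^n - 1\<close> with the leading coefficient first: the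
    \<open>n - 1\<close> zeros between the outer coefficients make the degree
    \<open>n\<close>.\<close>
  let ?p = "\<one> # replicate (n - 1) \<zero> @ [\<ominus> \<one>]"
  have "eval (replicate m \<zero> @ [\<ominus> \<one>]) x = \<ominus> \<one>" if "x \<in> carrier R" for m x
    using that by (induction m) simp_all
  then have "{x \<in> carrier R. x [^] n = \<one>} \<subseteq> {x. is_root ?p x}"
    using assms by (auto simp: is_root_def r_neg)
  moreover have "?p \<in> carrier (poly_ring R)"
    by (auto simp: univ_poly_carrier[symmetric] polynomial_def)
  ultimately show ?thesis
    using finite_number_of_roots finite_subset by blast
qed

section \<open>The group of characters\<close>

locale char_setup = K: field K + A: comm_group A
  for K :: "('k, 'w) ring_scheme" (structure) and A :: "('a, 'z) monoid_scheme"
begin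

abbreviation characters :: "('a \<Rightarrow> 'k) set" where
  "characters \<equiv> carrier (char_group K A)"

abbreviation char_times :: "('a \<Rightarrow> 'k) \<Rightarrow> ('a \<Rightarrow> 'k) \<Rightarrow> 'a \<Rightarrow> 'k" (infixl \<open>\<star>\<close> 70) where
  "\<chi> \<star> \<psi> \<equiv> \<chi> \<otimes>\<^bsub>char_group K A\<^esub> \<psi>"

abbreviation char_unit :: "'a \<Rightarrow> 'k" where
  "char_unit \<equiv> \<one>\<^bsub>char_group K A\<^esub>"

abbreviation cinv :: "('a \<Rightarrow> 'k) \<Rightarrow> 'a \<Rightarrow> 'k" where
  "cinv \<chi> \<equiv> inv\<^bsub>char_group K A\<^esub> \<chi>"

lemma characters_iff: "\<chi> \<in> characters \<longleftrightarrow> \<chi> \<in> extensional (carrier A) \<and>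
    (\<forall>a\<in>carrier A. \<chi> a \<in> Units K) \<and>
    (\<forall>a\<in>carrier A. \<forall>b\<in>carrier A. \<chi> (a \<otimes>\<^bsub>A\<^esub> b) = \<chi> a \<otimes> \<chi> b)"
  by (auto simp: char_group_def hom_def units_of_def)

lemma char_Units: "\<chi> \<in> characters \<Longrightarrow> a \<in> carrier A \<Longrightarrow> \<chi> a \<in> Units K"
  by (simp add: characters_iff)

lemma char_closed: "\<chi> \<in> characters \<Longrightarrow> a \<in> carrier A \<Longrightarrow> \<chi> a \<in> carrier K"
  by (simp add: char_Units K.Units_closed)

lemma char_mult:
  "\<chi> \<in> characters \<Longrightarrow> a \<in> carrier A \<Longrightarrow> b \<in> carrier A \<Longrightarrow> \<chi> (a \<otimes>\<^bsub>A\<^esub> b) = \<chi> a \<otimes> \<chi> b"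
  by (simp add: characters_iff)

lemma char_one:
  assumes "\<chi> \<in> characters"
  shows "\<chi> \<one>\<^bsub>A\<^esub> = \<one>"
proof -
  have "\<chi> \<one>\<^bsub>A\<^esub> \<otimes> \<chi> \<one>\<^bsub>A\<^esub> = \<chi> \<one>\<^bsub>A\<^esub> \<otimes> \<one>"
    using assms char_mult[of \<chi> "\<one>\<^bsub>A\<^esub>" "\<one>\<^bsub>A\<^esub>"] char_closed[of \<chi> "\<one>\<^bsub>A\<^esub>"] by simp
  then show ?thesis
    using assms char_Units[of \<chi> "\<one>\<^bsub>A\<^esub>"] char_closed[of \<chi> "\<one>\<^bsub>A\<^esub>"]
    by (subst (asm) K.Units_l_cancel) auto
qed

lemma char_group_mult: "\<chi> \<star> \<psi> = (\<lambda>a\<in>carrier A. \<chi> a \<otimes> \<psi> a)"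
  by (simp add: char_group_def)

lemma char_group_one: "char_unit = (\<lambda>a\<in>carrier A. \<one>)"
  by (simp add: char_group_def)

lemma char_inverse:
  assumes "\<chi> \<in> characters"
  shows "(\<lambda>a\<in>carrier A. inv (\<chi> a)) \<in> characters"
proof -
  have swap: "x \<otimes> y \<otimes> (x' \<otimes> y') = (x \<otimes> x') \<otimes> (y \<otimes> y')"
    if "x \<in> carrier K" "x' \<in> carrier K" "y \<in> carrier K" "y' \<in> carrier K" for x x' y y'
    using that by (simp add: K.m_ac)
  have "inv (\<chi> (a \<otimes>\<^bsub>A\<^esub> b)) = inv (\<chi> a) \<otimes> inv (\<chi> b)"
    if a: "a \<in> carrier A" and b: "b \<in> carrier A" for a b
  proof (rule K.comm_inv_char)
    have "\<chi> a \<otimes> \<chi> b \<otimes> (inv (\<chi> a) \<otimes> inv (\<chi> b))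
        = (\<chi> a \<otimes> inv (\<chi> a)) \<otimes> (\<chi> b \<otimes> inv (\<chi> b))"
      using char_Units[OF assms a] char_Units[OF assms b] by (intro swap) auto
    then show "\<chi> (a \<otimes>\<^bsub>A\<^esub> b) \<otimes> (inv (\<chi> a) \<otimes> inv (\<chi> b)) = \<one>"
      using char_Units[OF assms a] char_Units[OF assms b] char_mult[OF assms a b]
      by (simp add: K.Units_r_inv)
  qed (use a b char_closed[OF assms] char_Units[OF assms] in auto)
  then show ?thesis
    using char_Units[OF assms] by (simp add: characters_iff K.Units_inv_Units)
qed

lemma group_char_group: "group (char_group K A)"
proof (rule groupI)
  fix \<chi> assume \<chi>: "\<chi> \<in> characters"
  show "char_unit \<star> \<chi> = \<chi>"
    using \<chi> char_closed[OF \<chi>]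
    by (auto simp: char_group_mult char_group_one characters_iff extensional_def fun_eq_iff)
  show "\<exists>\<psi>\<in>characters. \<psi> \<star> \<chi> = char_unit"
    using char_inverse[OF \<chi>] char_Units[OF \<chi>]
    by (intro bexI[of _ "\<lambda>a\<in>carrier A. inv (\<chi> a)"])
      (auto simp: char_group_mult char_group_one fun_eq_iff K.Units_l_inv)
next
  fix \<chi> \<psi> assume \<chi>: "\<chi> \<in> characters" and \<psi>: "\<psi> \<in> characters"
  have "\<chi> a \<otimes> \<chi> b \<otimes> (\<psi> a \<otimes> \<psi> b) = \<chi> a \<otimes> \<psi> a \<otimes> (\<chi> b \<otimes> \<psi> b)"
    if "a \<in> carrier A" "b \<in> carrier A" for a b
    using that char_closed[OF \<chi>] char_closed[OF \<psi>] by (simp add: K.m_ac)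
  then show "\<chi> \<star> \<psi> \<in> characters"
    using \<chi> \<psi> by (simp add: characters_iff char_group_mult)
  fix \<phi> assume \<phi>: "\<phi> \<in> characters"
  show "\<chi> \<star> \<psi> \<star> \<phi>
      = \<chi> \<star> (\<psi> \<star> \<phi>)"
    using char_closed[OF \<chi>] char_closed[OF \<psi>] char_closed[OF \<phi>]
    by (auto simp: char_group_mult fun_eq_iff K.m_assoc)
next
  show "char_unit \<in> characters" by (simp add: characters_iff char_group_one)
qed

sublocale D: group "char_group K A" by (rule group_char_group)

lemma inv_char:
  assumes "\<chi> \<in> characters"
  shows "cinv \<chi> = (\<lambda>a\<in>carrier A. inv (\<chi> a))"
  using assms char_inverse[OF assms] char_Units[OF assms]
  by (intro D.inv_equality) (auto simp: char_group_mult char_group_one fun_eq_iff K.Units_l_inv)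

lemma inv_char_mult:
  assumes "\<chi> \<in> characters" "a \<in> carrier A"
  shows "cinv \<chi> a \<otimes> \<chi> a = \<one>" "\<chi> a \<otimes> cinv \<chi> a = \<one>"
  using assms char_Units[OF assms] by (simp_all add: inv_char)

end

section \<open>Consequences of the splitting of the group algebra\<close>

locale split_char_setup = char_setup K A
  for K :: "('k, 'w) ring_scheme" (structure) and A :: "('a, 'z) monoid_scheme" +
  assumes finite_A: "finite (carrier A)" and split: "splitting_field K A"
begin

text \<open>The basis element of the group algebra that belongs to \<open>a\<close>.\<close>

definition delta :: "'a \<Rightarrow> 'a \<Rightarrow> 'k" where
  "delta a = (\<lambda>b\<in>carrier A. if b = a then \<one> else \<zero>)"

abbreviation KA :: "('k, 'a \<Rightarrow> 'k) module" where
  "KA \<equiv> group_algebra K A"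

lemma KA_simps:
  "carrier KA = carrier A \<rightarrow>\<^sub>E carrier K"
  "u \<otimes>\<^bsub>KA\<^esub> v = (\<lambda>a\<in>carrier A. \<Oplus>b\<in>carrier A. u b \<otimes> v (inv\<^bsub>A\<^esub> b \<otimes>\<^bsub>A\<^esub> a))"
  "\<one>\<^bsub>KA\<^esub> = (\<lambda>a\<in>carrier A. if a = \<one>\<^bsub>A\<^esub> then \<one> else \<zero>)"
  "smult KA t u = (\<lambda>a\<in>carrier A. t \<otimes> u a)"
  by (simp_all add: group_algebra_def)

lemma product_algebra_simps:
  "carrier (product_algebra K n) = {..<n} \<rightarrow>\<^sub>E carrier K"
  "u \<otimes>\<^bsub>product_algebra K n\<^esub> v = (\<lambda>a\<in>{..<n}. u a \<otimes> v a)"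
  "\<one>\<^bsub>product_algebra K n\<^esub> = (\<lambda>a\<in>{..<n}. \<one>)"
  "smult (product_algebra K n) t u = (\<lambda>a\<in>{..<n}. t \<otimes> u a)"
  by (simp_all add: product_algebra_def)

lemma delta_closed: "a \<in> carrier A \<Longrightarrow> delta a \<in> carrier KA"
  by (auto simp: delta_def KA_simps)

lemma delta_mult:
  assumes "a \<in> carrier A" "u \<in> carrier KA" "c \<in> carrier A"
  shows "(delta a \<otimes>\<^bsub>KA\<^esub> u) c = u (inv\<^bsub>A\<^esub> a \<otimes>\<^bsub>A\<^esub> c)"
proof -
  have u: "u (inv\<^bsub>A\<^esub> b \<otimes>\<^bsub>A\<^esub> c) \<in> carrier K" if "b \<in> carrier A" for b
    using assms that by (auto simp: KA_simps)
  have "(delta a \<otimes>\<^bsub>KA\<^esub> u) c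
      = (\<Oplus>b\<in>carrier A. if a = b then u (inv\<^bsub>A\<^esub> b \<otimes>\<^bsub>A\<^esub> c) else \<zero>)"
    using assms u by (auto simp: KA_simps(2) delta_def intro!: K.finsum_cong')
  also have "\<dots> = u (inv\<^bsub>A\<^esub> a \<otimes>\<^bsub>A\<^esub> c)"
    using assms u finite_A by (intro K.finsum_singleton) auto
  finally show ?thesis .
qed

lemma delta_delta: "a \<in> carrier A \<Longrightarrow> b \<in> carrier A \<Longrightarrow> delta a \<otimes>\<^bsub>KA\<^esub> delta b = delta (a \<otimes>\<^bsub>A\<^esub> b)"
proof (rule extensionalityI[of _ "carrier A"])
  assume ab: "a \<in> carrier A" "b \<in> carrier A"
  fix c assume c: "c \<in> carrier A"
  have "inv\<^bsub>A\<^esub> a \<otimes>\<^bsub>A\<^esub> c = b \<longleftrightarrow> c = a \<otimes>\<^bsub>A\<^esub> b"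
    using ab c by (metis A.inv_closed A.inv_solve_left A.m_closed)
  then show "(delta a \<otimes>\<^bsub>KA\<^esub> delta b) c = delta (a \<otimes>\<^bsub>A\<^esub> b) c"
    using ab c by (simp add: delta_mult delta_closed) (simp add: delta_def)
qed (auto simp: KA_simps delta_def)

lemma delta_one: "delta \<one>\<^bsub>A\<^esub> = \<one>\<^bsub>KA\<^esub>"
  by (simp add: delta_def KA_simps)

text \<open>The isomorphism is read coordinatewise: every coordinate is a multiplicative map to
  \<open>K\<close>, and by injectivity the coordinates together separate the elements of the group
  algebra.\<close>

lemma splitting_iso:
  obtains n :: nat and \<Phi> where "inj_on \<Phi> (carrier KA)" "\<Phi> \<in> carrier KA \<rightarrow> ({..<n} \<rightarrow>\<^sub>E carrier K)"
    "\<And>u v. u \<in> carrier KA \<Longrightarrow> v \<in> carrier KA \<Longrightarrow> \<Phi> (u \<otimes>\<^bsub>KA\<^esub> v) = (\<lambda>i\<in>{..<n}. \<Phi> u i \<otimes> \<Phi> v i)"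
    "\<Phi> \<one>\<^bsub>KA\<^esub> = (\<lambda>i\<in>{..<n}. \<one>)"
    "\<And>t u. t \<in> carrier K \<Longrightarrow> u \<in> carrier KA \<Longrightarrow> \<Phi> (smult KA t u) = (\<lambda>i\<in>{..<n}. t \<otimes> \<Phi> u i)"
proof -
  obtain n \<Phi> where iso: "\<Phi> \<in> ring_iso KA (product_algebra K n)"
    and sm: "\<forall>t\<in>carrier K. \<forall>u\<in>carrier KA. \<Phi> (t \<odot>\<^bsub>KA\<^esub> u) = t \<odot>\<^bsub>product_algebra K n\<^esub> \<Phi> u"
    using split unfolding splitting_field_def by blast
  show ?thesis
    using that[of \<Phi> n] iso sm
    by (simp add: ring_iso_def ring_hom_def product_algebra_simps bij_betw_def)
qed

text \<open>A coordinate of \<open>\<Phi>\<close> is multiplicative and sends the unit to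
  \<open>\<one>\<close>. Its value at \<open>delta a\<close> is invertible because the values at
  \<open>delta a\<close> and at \<open>delta\<close> of the inverse of \<open>a\<close> multiply to
  \<open>\<one>\<close>.\<close>

lemma char_of_splitting:
  fixes n :: nat
  assumes "\<Phi> \<in> carrier KA \<rightarrow> ({..<n} \<rightarrow>\<^sub>E carrier K)"
    and "\<And>u v. u \<in> carrier KA \<Longrightarrow> v \<in> carrier KA \<Longrightarrow> \<Phi> (u \<otimes>\<^bsub>KA\<^esub> v) = (\<lambda>i\<in>{..<n}. \<Phi> u i \<otimes> \<Phi> v i)"
    and "\<Phi> \<one>\<^bsub>KA\<^esub> = (\<lambda>i\<in>{..<n}. \<one>)" and i: "i < n"
  shows "(\<lambda>a\<in>carrier A. \<Phi> (delta a) i) \<in> characters"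
proof -
  have c: "\<Phi> (delta a) i \<in> carrier K" if "a \<in> carrier A" for a
    using funcset_mem[OF assms(1) delta_closed[OF that]] i by auto
  have m: "\<Phi> (delta (a \<otimes>\<^bsub>A\<^esub> b)) i = \<Phi> (delta a) i \<otimes> \<Phi> (delta b) i"
    if "a \<in> carrier A" "b \<in> carrier A" for a b
    using that assms(2)[OF delta_closed delta_closed, of a b] i by (simp add: delta_delta)
  have one: "\<Phi> (delta \<one>\<^bsub>A\<^esub>) i = \<one>" using assms(3) i by (simp add: delta_one)
  have "\<Phi> (delta a) i \<in> Units K" if a: "a \<in> carrier A" for a
  proof -
    have "\<Phi> (delta (inv\<^bsub>A\<^esub> a)) i \<otimes> \<Phi> (delta a) i = \<one>"
      using m[of "inv\<^bsub>A\<^esub> a" a] a one by simp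
    then show ?thesis
      using c[OF a] c[of "inv\<^bsub>A\<^esub> a"] a K.m_comm unfolding Units_def by fastforce
  qed
  with m show ?thesis by (simp add: characters_iff)
qed

text \<open>Distinct group elements are distinct in the group algebra, so some coordinate of the
  splitting tells them apart.\<close>

lemma characters_separate:
  assumes "a \<in> carrier A" "b \<in> carrier A" "a \<noteq> b"
  obtains \<chi> where "\<chi> \<in> characters" "\<chi> a \<noteq> \<chi> b"
proof -
  obtain n :: nat and \<Phi> where inj: "inj_on \<Phi> (carrier KA)"
    and P: "\<Phi> \<in> carrier KA \<rightarrow> ({..<n} \<rightarrow>\<^sub>E carrier K)"
    "\<And>u v. u \<in> carrier KA \<Longrightarrow> v \<in> carrier KA \<Longrightarrow> \<Phi> (u \<otimes>\<^bsub>KA\<^esub> v) = (\<lambda>i\<in>{..<n}. \<Phi> u i \<otimes> \<Phi> v i)"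
    "\<Phi> \<one>\<^bsub>KA\<^esub> = (\<lambda>i\<in>{..<n}. \<one>)" by (rule splitting_iso) blast
  have "delta a a \<noteq> delta b a" using assms by (simp add: delta_def)
  then have "\<Phi> (delta a) \<noteq> \<Phi> (delta b)"
    using assms delta_closed inj by (auto dest: inj_onD)
  moreover have "\<Phi> (delta c) \<in> {..<n} \<rightarrow>\<^sub>E carrier K" if "c \<in> carrier A" for c
    by (rule funcset_mem[OF P(1) delta_closed[OF that]])
  ultimately obtain i where "i < n" "\<Phi> (delta a) i \<noteq> \<Phi> (delta b) i"
    using assms PiE_ext[of "\<Phi> (delta a)" "{..<n}" _ "\<Phi> (delta b)"] by (metis lessThan_iff)
  then show ?thesis
    using that[OF char_of_splitting[OF P]] assms by simp
qed

text \<open>The sum \<open>s\<close> of all group elements satisfies \<open>s s = |A| s\<close>. If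
  \<open>|A|\<close> were zero in the field, \<open>s\<close> would be nonzero with square zero, but
  a product of copies of a field is reduced.\<close>

lemma card_nonzero: "(\<Oplus>a\<in>carrier A. \<one>) \<noteq> \<zero>"
proof
  assume z: "(\<Oplus>a\<in>carrier A. \<one>) = \<zero>"
  obtain n :: nat and \<Phi> where inj: "inj_on \<Phi> (carrier KA)"
    and P: "\<Phi> \<in> carrier KA \<rightarrow> ({..<n} \<rightarrow>\<^sub>E carrier K)"
    "\<And>u v. u \<in> carrier KA \<Longrightarrow> v \<in> carrier KA \<Longrightarrow> \<Phi> (u \<otimes>\<^bsub>KA\<^esub> v) = (\<lambda>i\<in>{..<n}. \<Phi> u i \<otimes> \<Phi> v i)"
    "\<And>t u. t \<in> carrier K \<Longrightarrow> u \<in> carrier KA \<Longrightarrow> \<Phi> (smult KA t u) = (\<lambda>i\<in>{..<n}. t \<otimes> \<Phi> u i)"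
    by (rule splitting_iso) blast
  let ?s = "\<lambda>a\<in>carrier A. \<one>" and ?z = "\<lambda>a\<in>carrier A. \<zero>"
  have s: "?s \<in> carrier KA" by (auto simp: KA_simps)
  have zz: "?z \<in> carrier KA" by (auto simp: KA_simps)
  have Ps: "\<Phi> ?s i \<in> carrier K" if "i < n" for i
    using funcset_mem[OF P(1) s] that by auto
  \<comment> \<open>Zero is the multiple of \<open>?s\<close> by the scalar \<open>\<zero>\<close>,
    so compatibility with scalars shows that \<open>\<Phi>\<close> sends zero to zero.\<close>
  have "\<Phi> (smult KA \<zero> ?s) = (\<lambda>i\<in>{..<n}. \<zero>)"
    using P(3)[OF K.zero_closed s] Ps by (auto simp: fun_eq_iff)
  moreover have "smult KA \<zero> ?s = ?z" by (simp add: KA_simps fun_eq_iff)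
  ultimately have Pz: "\<Phi> ?z = (\<lambda>i\<in>{..<n}. \<zero>)" by simp
  \<comment> \<open>Each coefficient of the convolution square of \<open>?s\<close> counts the
    elements of \<open>A\<close>.\<close>
  have "(\<Oplus>b\<in>carrier A. ?s b \<otimes> ?s (inv\<^bsub>A\<^esub> b \<otimes>\<^bsub>A\<^esub> a)) = (\<Oplus>b\<in>carrier A. \<one>)"
    if "a \<in> carrier A" for a
    using that by (intro K.finsum_cong') auto
  then have "?s \<otimes>\<^bsub>KA\<^esub> ?s = ?z" using z by (simp add: KA_simps(2) fun_eq_iff)
  then have "(\<lambda>i\<in>{..<n}. \<Phi> ?s i \<otimes> \<Phi> ?s i) = (\<lambda>i\<in>{..<n}. \<zero>)"
    using P(2)[OF s s] Pz by simp
  then have sq: "(\<lambda>i\<in>{..<n}. \<Phi> ?s i \<otimes> \<Phi> ?s i) i = (\<lambda>i\<in>{..<n}. \<zero>) i" for i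
    by (rule fun_cong)
  have "\<Phi> ?s i \<otimes> \<Phi> ?s i = \<zero>" if "i < n" for i
    using sq[of i] that by simp
  then have "\<Phi> ?s i = \<zero>" if "i < n" for i
    using that Ps[OF that] K.integral by blast
  moreover have "\<Phi> ?s \<in> {..<n} \<rightarrow>\<^sub>E carrier K" by (rule funcset_mem[OF P(1) s])
  ultimately have "\<Phi> ?s = \<Phi> ?z"
    unfolding Pz by (auto simp: fun_eq_iff PiE_iff extensional_def)
  then have "?s = ?z" using inj_onD[OF inj] s zz by blast
  then have "?s \<one>\<^bsub>A\<^esub> = ?z \<one>\<^bsub>A\<^esub>" by simp
  then show False by simp
qed

text \<open>Each element of \<open>A\<close> has trivial \<open>|A|\<close>-th power, so a character
  takes values in the finite set of \<open>|A|\<close>-th roots of unity.\<close>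

lemma finite_characters: "finite characters"
proof -
  let ?n = "card (carrier A)"
  let ?U = "{x \<in> carrier K. x [^] ?n = \<one>}"
  have pow: "\<chi> (a [^]\<^bsub>A\<^esub> n) = \<chi> a [^] n" if "\<chi> \<in> characters" "a \<in> carrier A" for \<chi> a and n :: nat
    using that by (induction n) (simp_all add: char_one char_mult)
  have sub: "characters \<subseteq> carrier A \<rightarrow>\<^sub>E ?U"
  proof
    fix \<chi> assume \<chi>: "\<chi> \<in> characters"
    have "\<chi> a \<in> ?U" if "a \<in> carrier A" for a
      using that \<chi> pow[OF \<chi> that, of ?n] A.power_order_eq_one[OF finite_A that]
      by (simp add: char_closed char_one)
    then show "\<chi> \<in> carrier A \<rightarrow>\<^sub>E ?U" using \<chi> by (simp add: characters_iff PiE_iff)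
  qed
  have "0 < ?n" using finite_A by (auto simp: card_gt_0_iff)
  then show ?thesis
    by (intro finite_subset[OF sub] finite_PiE finite_A K.finite_roots_of_unity)
qed

text \<open>Translating the summation variable by an \<open>a\<close> with
  \<open>\<chi> a \<noteq> \<one>\<close> multiplies the sum by \<open>\<chi> a\<close> without
  changing it.\<close>

lemma char_sum:
  assumes \<chi>: "\<chi> \<in> characters"
  shows "(\<Oplus>a\<in>carrier A. \<chi> a)
    = (if \<chi> = char_unit then \<Oplus>a\<in>carrier A. \<one> else \<zero>)"
proof (cases "\<chi> = char_unit")
  case True
  then show ?thesis by (auto simp: char_group_one intro!: K.finsum_cong')
next
  case False
  then obtain a where a: "a \<in> carrier A" "\<chi> a \<noteq> \<one>"
    using \<chi> by (auto simp: char_group_one characters_iff extensional_def fun_eq_iff split: if_splits)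
  let ?s = "\<Oplus>c\<in>carrier A. \<chi> c"
  have bij: "bij_betw (\<lambda>c. a \<otimes>\<^bsub>A\<^esub> c) (carrier A) (carrier A)"
    using a by (intro bij_betw_byWitness[where f' = "\<lambda>c. inv\<^bsub>A\<^esub> a \<otimes>\<^bsub>A\<^esub> c"])
      (auto simp: A.m_assoc[symmetric])
  have sc: "?s \<in> carrier K" using char_closed[OF \<chi>] by (auto intro!: K.finsum_closed)
  have "?s = (\<Oplus>c\<in>(\<lambda>c. a \<otimes>\<^bsub>A\<^esub> c) ` carrier A. \<chi> c)"
    unfolding bij_betw_imp_surj_on[OF bij] by (rule refl)
  also have "\<dots> = (\<Oplus>c\<in>carrier A. \<chi> (a \<otimes>\<^bsub>A\<^esub> c))"
    using a char_closed[OF \<chi>] bij_betw_imp_inj_on[OF bij] by (intro K.finsum_reindex) auto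
  also have "\<dots> = (\<Oplus>c\<in>carrier A. \<chi> a \<otimes> \<chi> c)"
    using a char_closed[OF \<chi>] by (intro K.finsum_cong') (auto simp: char_mult[OF \<chi>])
  also have "\<dots> = \<chi> a \<otimes> ?s"
    using a char_closed[OF \<chi>] by (subst K.finsum_rdistr) (auto simp: finite_A)
  finally have "\<one> \<otimes> ?s = \<chi> a \<otimes> ?s" using sc by simp
  then have "?s = \<zero>"
    using K.m_rcancel[of ?s "\<one>" "\<chi> a"] sc a char_closed[OF \<chi> a(1)]
    by (metis K.one_closed)
  with False show ?thesis by simp
qed

text \<open>The same argument inside the character group: multiplying the summation variable by a
  character \<open>\<psi>\<close> that separates \<open>a\<close> and \<open>b\<close> multiplies
  the sum by \<open>\<psi>(a) \<psi>(b)^-1\<close>, which differs from \<open>1\<close>. Such a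
  \<open>\<psi>\<close> exists because the field splits \<open>A\<close>.\<close>

lemma char_sum_dual:
  assumes a: "a \<in> carrier A" and b: "b \<in> carrier A" "a \<noteq> b"
  shows "(\<Oplus>\<chi>\<in>characters. \<chi> a \<otimes> cinv \<chi> b) = \<zero>"
proof -
  obtain \<psi> where \<psi>: "\<psi> \<in> characters" "\<psi> a \<noteq> \<psi> b" using characters_separate[OF a b] by blast
  let ?f = "\<lambda>\<chi>. \<chi> a \<otimes> cinv \<chi> b"
  let ?t = "\<psi> a \<otimes> cinv \<psi> b"
  let ?s = "\<Oplus>\<chi>\<in>characters. ?f \<chi>"
  have fc: "?f \<chi> \<in> carrier K" if "\<chi> \<in> characters" for \<chi>
    using that char_closed a b by simp
  have t1: "?t \<noteq> \<one>"
  proof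
    assume "?t = \<one>"
    then have "\<psi> a \<otimes> cinv \<psi> b \<otimes> \<psi> b = \<psi> b" using char_closed[OF \<psi>(1) b(1)] by simp
    then show False
      using \<psi> a b char_closed[OF \<psi>(1)] char_closed[OF D.inv_closed[OF \<psi>(1)]] inv_char_mult[OF \<psi>(1) b(1)]
      by (simp add: K.m_assoc)
  qed
  have bij: "bij_betw (\<lambda>\<chi>. \<psi> \<star> \<chi>) characters characters"
    using \<psi> by (intro bij_betw_byWitness[where f' = "\<lambda>\<chi>. cinv \<psi> \<star> \<chi>"])
      (auto simp: D.m_assoc[symmetric])
  have sc: "?s \<in> carrier K" using fc by (auto intro!: K.finsum_closed)
  have tc: "?t \<in> carrier K" using fc \<psi> by blast
  have "?s = (\<Oplus>\<chi>\<in>(\<lambda>\<chi>. \<psi> \<star> \<chi>) ` characters. ?f \<chi>)"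
    unfolding bij_betw_imp_surj_on[OF bij] by (rule refl)
  also have "\<dots> = (\<Oplus>\<chi>\<in>characters. ?f (\<psi> \<star> \<chi>))"
    using fc \<psi> bij_betw_imp_inj_on[OF bij] by (intro K.finsum_reindex) auto
  also have "\<dots> = (\<Oplus>\<chi>\<in>characters. ?t \<otimes> ?f \<chi>)"
  proof (intro K.finsum_cong' refl)
    fix \<chi> assume \<chi>: "\<chi> \<in> characters"
    have "cinv (\<psi> \<star> \<chi>)
        = cinv \<chi> \<star> cinv \<psi>"
      by (rule D.inv_mult_group[OF \<psi>(1) \<chi>])
    then show "?f (\<psi> \<star> \<chi>) = ?t \<otimes> ?f \<chi>"
      using \<chi> \<psi> a b char_closed[OF \<chi>] char_closed[OF \<psi>(1)] char_closed[OF D.inv_closed[OF \<psi>(1)]]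
        char_closed[OF D.inv_closed[OF \<chi>]]
      by (simp add: char_group_mult K.m_ac)
  qed (use fc tc in auto)
  also have "\<dots> = ?t \<otimes> ?s"
    using fc tc by (subst K.finsum_rdistr) (auto simp: finite_characters)
  finally have "\<one> \<otimes> ?s = ?t \<otimes> ?s" using sc by simp
  then show ?thesis
    using K.m_rcancel[of ?s "\<one>" ?t] sc tc t1 by (metis K.one_closed)
qed

end

section \<open>Forgetting the second degree\<close>

declare carrier_DirProd [simp del]

lemma graded_hom_compose:
  assumes "graded_module G B X" "f \<in> graded_hom G B X Y" "g \<in> graded_hom G B Y Z"
  shows "compose (carrier X) g f \<in> graded_hom G B X Z"
proof -
  interpret X: graded_group G X by (rule graded_module_graded_group[OF assms(1)])
  interpret MX: right_module B X by (rule graded_module_right_module[OF assms(1)])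
  note f = graded_hom_closed[OF assms(2)] and g = graded_hom_closed[OF assms(3)]
  have "compose (carrier X) g f (x \<oplus>\<^bsub>X\<^esub> y) = compose (carrier X) g f x \<oplus>\<^bsub>Z\<^esub> compose (carrier X) g f y"
    if "x \<in> carrier X" "y \<in> carrier X" for x y
    using assms(2,3) that f by (simp add: compose_def graded_hom_def)
  moreover have "compose (carrier X) g f (ract X x r) = ract Z (compose (carrier X) g f x) r"
    if "x \<in> carrier X" "r \<in> carrier B" for x r
    using assms(2,3) that f MX.ract_closed by (simp add: compose_def graded_hom_def)
  moreover have "compose (carrier X) g f x \<in> grade Z h" if "h \<in> carrier G" "x \<in> grade X h" for h x
    using that graded_hom_grade[OF assms(2)] graded_hom_grade[OF assms(3)] X.grade_carrier
    by (simp add: compose_def)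
  ultimately show ?thesis
    using f g unfolding graded_hom_def by (auto simp: compose_eq image_subset_iff PiE_iff)
qed

lemma same_module_pushforward: "same_module X (pushforward \<pi> G H X)"
  by (simp add: same_module_def pushforward_def)

locale product_graded_group = H: group H + A: group A + graded_group "H \<times>\<times> A" X
  for H :: "('h, 'y) monoid_scheme" and A :: "('a, 'z) monoid_scheme"
    and X :: "('b, 'm, 'h \<times> 'a) graded" (structure)
begin

abbreviation PX :: "('b, 'm, 'h) graded" where
  "PX \<equiv> pushforward fst (H \<times>\<times> A) H X"

text \<open>Taking components is additive, so a sum of elements whose degrees lie over
  \<open>h\<close> has no other components, and conversely. In this form membership can be tested
  degree by degree.\<close>

lemma grade_pushforward:
  assumes "h \<in> carrier H"
  shows "grade PX h = {x \<in> carrier X. \<forall>p\<in>carrier (H \<times>\<times> A). fst p \<noteq> h \<longrightarrow> hparts (H \<times>\<times> A) X x p = \<zero>}"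
    (is "_ = ?S")
proof
  show "grade PX h \<subseteq> ?S"
  proof
    fix x assume "x \<in> grade PX h"
    then obtain S c where S: "finite S" "S \<subseteq> {g \<in> carrier (H \<times>\<times> A). fst g = h}"
      "\<And>g. g \<in> S \<Longrightarrow> c g \<in> grade X g" "x = (\<Oplus>g\<in>S. c g)"
      using assms by (auto simp: pushforward_def Pi_iff)
    have "(\<Oplus>g\<in>S. c g) \<in> ?S" using S(1-3)
    proof (induction S rule: finite_induct)
      case (insert g S)
      then have g: "g \<in> carrier (H \<times>\<times> A)" "fst g = h" "c g \<in> grade X g" by blast+
      then have cg: "c g \<in> carrier X" using grade_carrier by blast
      have c: "c \<in> S \<rightarrow> carrier X"
      proof
        fix s assume "s \<in> S"
        then show "c s \<in> carrier X" using insert.prems grade_carrier[of s "c s"] by blast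
      qed
      have IH: "(\<Oplus>g\<in>S. c g) \<in> ?S" using insert by blast
      have "hparts (H \<times>\<times> A) X (c g) p = \<zero>" if "p \<in> carrier (H \<times>\<times> A)" "fst p \<noteq> h" for p
        using g that hparts_homogeneous[OF g(1,3) that(1)] by auto
      then show ?case using insert.hyps IH c cg by (simp add: hparts_add)
    qed (simp add: hparts_zero)
    then show "x \<in> ?S" using S(4) by simp
  qed
  show "?S \<subseteq> grade PX h"
  proof
    fix x assume x: "x \<in> ?S"
    then have xc: "x \<in> carrier X" by blast
    let ?T = "hsupport (H \<times>\<times> A) X (hparts (H \<times>\<times> A) X x)"
    have "finite ?T" "x = (\<Oplus>g\<in>?T. hparts (H \<times>\<times> A) X x g)"
      using finite_hsupport[OF xc] sum_hparts[OF xc] by simp_all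
    moreover have "?T \<subseteq> {g \<in> carrier (H \<times>\<times> A). fst g = h}"
      using x by (auto simp: hsupport_def)
    moreover have "hparts (H \<times>\<times> A) X x \<in> (\<Pi> g\<in>?T. grade X g)"
      using hparts_grade[OF xc] by (auto simp: hsupport_def)
    ultimately show "x \<in> grade PX h"
      using assms unfolding pushforward_def by auto
  qed
qed

lemma grade_pushforward_homogeneous:
  assumes "p \<in> carrier (H \<times>\<times> A)" "x \<in> grade X p"
  shows "x \<in> grade PX (fst p)"
proof -
  have "fst p \<in> carrier H" using assms by (auto simp: DirProd_def)
  then show ?thesis
    using assms grade_carrier[OF assms] by (auto simp: grade_pushforward hparts_homogeneous)
qed

text \<open>The projection to \<open>h\<close> keeps the components of degree \<open>(h, a)\<close>
  for all \<open>a\<close> and erases the others.\<close>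

lemma is_grading_pushforward: "is_grading H PX"
proof (rule is_gradingI[where proj = "\<lambda>h. gradewise (\<lambda>p x. if fst p = h then x else \<zero>)"])
  have P: "carrier PX = carrier X" "\<zero>\<^bsub>PX\<^esub> = \<zero>" "add PX = add X"
    by (simp_all add: pushforward_def)
  show ag: "abelian_group PX"
    using abelian_group_axioms same_module_abelian_group[OF same_module_pushforward] by blast
  show "grade PX \<in> extensional (carrier H)" by (simp add: pushforward_def)
  have ga: "gradewise_additive (\<lambda>p x. if fst p = h then x else \<zero>)" for h
    by (auto simp: gradewise_additive_def grade_zero)
  have eq: "gradewise (\<lambda>p x. if fst p = g then x else \<zero>) x = (if g = h then x else \<zero>)"
    if "g \<in> carrier H" "h \<in> carrier H" "x \<in> grade PX h" for g h x
  proof (rule hparts_eqI)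
    have x: "x \<in> carrier X" and z: "\<And>p. p \<in> carrier (H \<times>\<times> A) \<Longrightarrow> fst p \<noteq> h \<Longrightarrow> hparts (H \<times>\<times> A) X x p = \<zero>"
      using that by (simp_all add: grade_pushforward)
    show "gradewise (\<lambda>p x. if fst p = g then x else \<zero>) x \<in> carrier X"
      by (rule gradewise_closed[OF ga x])
    show "(if g = h then x else \<zero>) \<in> carrier X" using x by simp
    fix p assume p: "p \<in> carrier (H \<times>\<times> A)"
    show "hparts (H \<times>\<times> A) X (gradewise (\<lambda>p x. if fst p = g then x else \<zero>) x) p
        = hparts (H \<times>\<times> A) X (if g = h then x else \<zero>) p"
      unfolding hparts_gradewise[OF ga x p] using z[OF p] hparts_zero[OF p] by auto
  qed
  show "grade PX h \<subseteq> carrier PX" if "h \<in> carrier H" for h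
    using that by (auto simp: grade_pushforward P)
  show "gradewise (\<lambda>p x. if fst p = h then x else \<zero>) x \<in> grade PX h"
    if "h \<in> carrier H" "x \<in> carrier PX" for h x
    using that by (simp add: grade_pushforward P gradewise_closed[OF ga] hparts_gradewise[OF ga])
  show "carrier PX \<subseteq> grade_span H PX"
  proof
    fix x assume "x \<in> carrier PX"
    then have "x \<in> carrier X" by (simp add: P)
    then show "x \<in> grade_span H PX"
    proof (induction x rule: homogeneous_induct)
      case zero
      show ?case using grade_span.zero[of PX H] by (simp add: P)
    next
      case (add x y)
      then show ?case using grade_span.add[of x H PX y] by (simp add: P)
    next
      case (homogeneous p x)
      then show ?case using grade_pushforward_homogeneous
        by (intro grade_span.homogeneous[of "fst p"]) (auto simp: DirProd_def)
    qed
  qed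
  show "gradewise (\<lambda>p x. if fst p = h then x else \<zero>) (x \<oplus>\<^bsub>PX\<^esub> y)
      = gradewise (\<lambda>p x. if fst p = h then x else \<zero>) x \<oplus>\<^bsub>PX\<^esub> gradewise (\<lambda>p x. if fst p = h then x else \<zero>) y"
    if "x \<in> carrier PX" "y \<in> carrier PX" for h x y
    using that by (simp add: P gradewise_add[OF ga])
  show "gradewise (\<lambda>p x. if fst p = g then x else \<zero>) x = (if g = h then x else \<zero>\<^bsub>PX\<^esub>)"
    if "g \<in> carrier H" "h \<in> carrier H" "x \<in> grade PX h" for g h x
    using eq[OF that] by (simp add: P)
qed

sublocale P: graded_group H PX
  by (intro graded_group.intro graded_group_axioms.intro is_grading_pushforward)
    (use abelian_group_axioms same_module_abelian_group[OF same_module_pushforward] in blast)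

end

section \<open>The twisting action and the functor \<open>\<Gamma>\<close>\<close>

locale refinement_setup = split_char_setup K A + H: group H
  for K :: "('k, 'w) ring_scheme" (structure) and A :: "('a, 'z) monoid_scheme"
    and H :: "('h, 'y) monoid_scheme" +
  fixes R :: "('k, 'b, 'h) graded" and Rb :: "('k, 'b, 'h \<times> 'a) graded"
  assumes graded_R: "graded_algebra K H R" and refinement: "is_refinement K H A R Rb"
begin

abbreviation G :: "('h \<times> 'a) monoid" where
  "G \<equiv> H \<times>\<times> A"

lemma graded_Rb: "graded_algebra K G Rb" and R_eq: "pushforward fst G H Rb = R"
  using refinement by (auto simp: is_refinement_def)

sublocale RG: graded_ring G Rb by (rule graded_algebra_graded_ring[OF graded_Rb])

sublocale RH: graded_ring H R by (rule graded_algebra_graded_ring[OF graded_R])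

sublocale RP: product_graded_group H A Rb
  by (intro product_graded_group.intro RG.gr.graded_group_axioms H.group_axioms A.group_axioms)

sublocale RA: graded_algebra K G Rb by (rule graded_Rb)

lemma carrier_R [simp]: "carrier R = carrier Rb" "\<zero>\<^bsub>R\<^esub> = \<zero>\<^bsub>Rb\<^esub>" "\<one>\<^bsub>R\<^esub> = \<one>\<^bsub>Rb\<^esub>"
    "r \<oplus>\<^bsub>R\<^esub> s = r \<oplus>\<^bsub>Rb\<^esub> s" "r \<otimes>\<^bsub>R\<^esub> s = r \<otimes>\<^bsub>Rb\<^esub> s"
  by (simp_all add: R_eq[symmetric] pushforward_def)

lemma carrier_G: "p \<in> carrier G \<longleftrightarrow> fst p \<in> carrier H \<and> snd p \<in> carrier A"
  by (cases p) (auto simp: DirProd_def)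

lemma grade_R: "p \<in> carrier G \<Longrightarrow> r \<in> grade Rb p \<Longrightarrow> r \<in> grade R (fst p)"
  using RP.grade_pushforward_homogeneous by (simp add: R_eq)

text \<open>The element of the algebra through which the scalar \<open>t\<close> acts on modules. It
  commutes with all of \<open>Rb\<close> and has neutral degree, so multiplication by it is linear
  and preserves components.\<close>

definition scal :: "'k \<Rightarrow> 'b" where
  "scal t = t \<odot>\<^bsub>Rb\<^esub> \<one>\<^bsub>Rb\<^esub>"

lemma scal_closed [simp]: "t \<in> carrier K \<Longrightarrow> scal t \<in> carrier Rb"
  by (simp add: scal_def)

lemma scal_right: "t \<in> carrier K \<Longrightarrow> r \<in> carrier Rb \<Longrightarrow> r \<otimes>\<^bsub>Rb\<^esub> scal t = t \<odot>\<^bsub>Rb\<^esub> r"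
  using RA.smult_mult_right[of t r "\<one>\<^bsub>Rb\<^esub>"] by (simp add: scal_def)

lemma scal_left: "t \<in> carrier K \<Longrightarrow> r \<in> carrier Rb \<Longrightarrow> scal t \<otimes>\<^bsub>Rb\<^esub> r = t \<odot>\<^bsub>Rb\<^esub> r"
  using RA.smult_mult_left[of t "\<one>\<^bsub>Rb\<^esub>" r] by (simp add: scal_def)

lemma scal_one: "scal \<one> = \<one>\<^bsub>Rb\<^esub>"
  by (simp add: scal_def)

lemma scal_mult: "t \<in> carrier K \<Longrightarrow> u \<in> carrier K \<Longrightarrow> scal t \<otimes>\<^bsub>Rb\<^esub> scal u = scal (t \<otimes> u)"
  by (simp add: scal_left) (simp add: scal_def RA.smult_assoc1)

lemma scal_add: "t \<in> carrier K \<Longrightarrow> u \<in> carrier K \<Longrightarrow> scal (t \<oplus> u) = scal t \<oplus>\<^bsub>Rb\<^esub> scal u"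
  by (simp add: scal_def RA.smult_l_distr)

lemma smult_grade: "p \<in> carrier G \<Longrightarrow> r \<in> grade Rb p \<Longrightarrow> t \<in> carrier K \<Longrightarrow> t \<odot>\<^bsub>Rb\<^esub> r \<in> grade Rb p"
  using submodule.smult_closed[OF RA.grade_subspace] by blast

lemma scal_grade: "t \<in> carrier K \<Longrightarrow> scal t \<in> grade Rb \<one>\<^bsub>G\<^esub>"
  unfolding scal_def by (intro smult_grade RG.one_homogeneous RG.G.one_closed)

lemma scal_zero: "scal \<zero> = \<zero>\<^bsub>Rb\<^esub>"
  by (simp add: scal_def)

lemma scal_finsum:
  "(\<And>i. i \<in> I \<Longrightarrow> f i \<in> carrier K) \<Longrightarrow> scal (finsum K f I) = (\<Oplus>\<^bsub>Rb\<^esub>i\<in>I. scal (f i))"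
proof (induction I rule: infinite_finite_induct)
  case (insert i I)
  then have "f \<in> I \<rightarrow> carrier K" "f i \<in> carrier K" "(\<lambda>i. scal (f i)) \<in> I \<rightarrow> carrier Rb" by auto
  with insert show ?case by (simp add: scal_add)
qed (auto simp: scal_zero)

lemma right_module_R: "right_module R X \<longleftrightarrow> right_module Rb X"
proof -
  have "ring R" "ring Rb" by (rule RH.B.ring_axioms, rule RG.B.ring_axioms)
  then show ?thesis by (simp add: right_module_def right_module_axioms_def)
qed

lemma
  assumes "right_module Rb X" "x \<in> carrier X" "t \<in> carrier K"
  shows ract_scal_mult: "u \<in> carrier K \<Longrightarrow> ract X (ract X x (scal t)) (scal u) = ract X x (scal (t \<otimes> u))"
    and ract_scal_commute: "r \<in> carrier Rb \<Longrightarrow> ract X (ract X x (scal t)) r = ract X (ract X x r) (scal t)"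
    and ract_smult: "r \<in> carrier Rb \<Longrightarrow> ract X x (t \<odot>\<^bsub>Rb\<^esub> r) = ract X (ract X x r) (scal t)"
proof -
  interpret right_module Rb X by fact
  show "ract X (ract X x (scal t)) (scal u) = ract X x (scal (t \<otimes> u))" if "u \<in> carrier K"
    using assms that ract_mult[of x "scal t" "scal u"] by (simp add: scal_mult)
  show *: "ract X x (t \<odot>\<^bsub>Rb\<^esub> r) = ract X (ract X x r) (scal t)" if "r \<in> carrier Rb"
    using assms that ract_mult[of x r "scal t"] by (simp add: scal_right)
  show "ract X (ract X x (scal t)) r = ract X (ract X x r) (scal t)" if "r \<in> carrier Rb"
    using assms that ract_mult[of x "scal t" r] * by (simp add: scal_left)
qed

text \<open>The difference \<open>t - u\<close> kills \<open>x\<close> and is invertible in the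
  field.\<close>

lemma ract_scal_eq_zero:
  assumes X: "right_module Rb X" and x: "x \<in> carrier X" and t: "t \<in> carrier K" "u \<in> carrier K" "t \<noteq> u"
    and eq: "ract X x (scal t) = ract X x (scal u)"
  shows "x = \<zero>\<^bsub>X\<^esub>"
proof -
  interpret right_module Rb X by fact
  let ?d = "t \<ominus> u"
  have dt: "?d \<oplus> u = t" using t by (simp add: a_minus_def K.a_assoc K.l_neg)
  then have d: "?d \<in> carrier K" "?d \<noteq> \<zero>" using t by auto
  then have U: "?d \<in> Units K" by (simp add: K.field_Units)
  have "ract X x (scal ?d) \<oplus>\<^bsub>X\<^esub> ract X x (scal u) = ract X x (scal t)"
    using ract_add_right[of x "scal ?d" "scal u"] x t d by (simp add: scal_add[symmetric] dt)
  then have "ract X x (scal ?d) \<oplus>\<^bsub>X\<^esub> ract X x (scal u) = ract X x (scal u)" using eq by simp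
  then have "ract X x (scal ?d) = \<zero>\<^bsub>X\<^esub>"
    using x t d ract_closed by (simp add: add.r_cancel_one)
  then have "ract X (ract X x (scal ?d)) (scal (inv ?d)) = \<zero>\<^bsub>X\<^esub>"
    using U by (simp add: ract_zero_left)
  then show ?thesis
    using ract_scal_mult[OF X x d(1), of "inv ?d"] U x by (simp add: scal_one ract_one)
qed

context
  fixes \<chi> :: "'a \<Rightarrow> 'k"
  assumes \<chi>: "\<chi> \<in> characters"
begin

lemma char_act_gradewise:
  "r \<in> carrier Rb \<Longrightarrow> char_act H A Rb \<chi> r = RG.gr.gradewise (\<lambda>p x. \<chi> (snd p) \<odot>\<^bsub>Rb\<^esub> x) r"
  by (simp add: char_act_def RG.gr.gradewise_def Let_def)

lemma gradewise_additive_char_act: "RG.gr.gradewise_additive (\<lambda>p x. \<chi> (snd p) \<odot>\<^bsub>Rb\<^esub> x)"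
  using char_closed[OF \<chi>] RG.gr.grade_carrier
  by (auto simp: RG.gr.gradewise_additive_def carrier_G smult_grade RA.smult_r_distr)

lemma char_act_closed: "r \<in> carrier Rb \<Longrightarrow> char_act H A Rb \<chi> r \<in> carrier Rb"
  using RG.gr.gradewise_closed[OF gradewise_additive_char_act] by (simp add: char_act_gradewise)

lemma char_act_homogeneous:
  "p \<in> carrier G \<Longrightarrow> r \<in> grade Rb p \<Longrightarrow> char_act H A Rb \<chi> r = \<chi> (snd p) \<odot>\<^bsub>Rb\<^esub> r"
  using RG.gr.gradewise_homogeneous[OF gradewise_additive_char_act] RG.gr.grade_carrier
  by (simp add: char_act_gradewise)

lemma char_act_zero: "char_act H A Rb \<chi> \<zero>\<^bsub>Rb\<^esub> = \<zero>\<^bsub>Rb\<^esub>"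
  using RG.gr.gradewise_zero[OF gradewise_additive_char_act] by (simp add: char_act_gradewise)

lemma char_act_add: "r \<in> carrier Rb \<Longrightarrow> s \<in> carrier Rb \<Longrightarrow>
    char_act H A Rb \<chi> (r \<oplus>\<^bsub>Rb\<^esub> s) = char_act H A Rb \<chi> r \<oplus>\<^bsub>Rb\<^esub> char_act H A Rb \<chi> s"
  using RG.gr.gradewise_add[OF gradewise_additive_char_act] by (simp add: char_act_gradewise)

lemma char_act_scal: "t \<in> carrier K \<Longrightarrow> char_act H A Rb \<chi> (scal t) = scal t"
  using char_act_homogeneous[OF _ scal_grade, of t] char_one[OF \<chi>] by (simp add: carrier_G)

lemma char_act_one: "char_act H A Rb \<chi> \<one>\<^bsub>Rb\<^esub> = \<one>\<^bsub>Rb\<^esub>"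
  using char_act_scal[of "\<one>"] by (simp add: scal_one)

text \<open>On homogeneous elements this is the multiplicativity of \<open>\<chi>\<close> on the
  second degrees; both sides are additive in \<open>r\<close> and in \<open>s\<close>.\<close>

lemma char_act_mult:
  assumes "r \<in> carrier Rb" "s \<in> carrier Rb"
  shows "char_act H A Rb \<chi> (r \<otimes>\<^bsub>Rb\<^esub> s) = char_act H A Rb \<chi> r \<otimes>\<^bsub>Rb\<^esub> char_act H A Rb \<chi> s"
  using assms(1)
proof (induction r rule: RG.gr.homogeneous_induct)
  case zero
  then show ?case using assms(2) by (simp add: char_act_zero char_act_closed)
next
  case (add x y)
  then show ?case using assms(2) by (simp add: char_act_add char_act_closed RG.B.l_distr)
next
  case (homogeneous p r)
  have r: "r \<in> carrier Rb" using homogeneous RG.gr.grade_carrier by blast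
  show ?case using assms(2)
  proof (induction s rule: RG.gr.homogeneous_induct)
    case zero
    then show ?case using r by (simp add: char_act_zero char_act_closed)
  next
    case (add x y)
    then show ?case using r by (simp add: char_act_add char_act_closed RG.B.r_distr)
  next
    case (homogeneous q s)
    have s: "s \<in> carrier Rb" using homogeneous RG.gr.grade_carrier by blast
    have pq: "p \<otimes>\<^bsub>G\<^esub> q \<in> carrier G" "snd (p \<otimes>\<^bsub>G\<^esub> q) = snd p \<otimes>\<^bsub>A\<^esub> snd q"
      using \<open>p \<in> carrier G\<close> homogeneous by (auto simp: DirProd_def)
    have c: "\<chi> (snd p) \<in> carrier K" "\<chi> (snd q) \<in> carrier K"
      using \<open>p \<in> carrier G\<close> homogeneous char_closed[OF \<chi>] by (auto simp: carrier_G)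
    have "char_act H A Rb \<chi> (r \<otimes>\<^bsub>Rb\<^esub> s) = (\<chi> (snd p) \<otimes> \<chi> (snd q)) \<odot>\<^bsub>Rb\<^esub> (r \<otimes>\<^bsub>Rb\<^esub> s)"
      using \<open>p \<in> carrier G\<close> \<open>r \<in> grade Rb p\<close> homogeneous pq
      by (subst char_act_homogeneous[of "p \<otimes>\<^bsub>G\<^esub> q"])
        (auto simp: RG.grade_mult char_mult[OF \<chi>] carrier_G)
    also have "\<dots> = (\<chi> (snd p) \<odot>\<^bsub>Rb\<^esub> r) \<otimes>\<^bsub>Rb\<^esub> (\<chi> (snd q) \<odot>\<^bsub>Rb\<^esub> s)"
      using c r s by (subst K.m_comm) (simp_all add: RA.smult_assoc1 RA.smult_mult_left[symmetric] RA.smult_mult_right[symmetric])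
    finally show ?case
      using \<open>p \<in> carrier G\<close> \<open>r \<in> grade Rb p\<close> homogeneous by (simp add: char_act_homogeneous)
  qed
qed

text \<open>Components of degree \<open>(h, a)\<close> are scaled one by one, so those that vanish
  stay zero and the common first degree is kept.\<close>

lemma char_act_grade:
  assumes "h \<in> carrier H" "r \<in> grade R h"
  shows "char_act H A Rb \<chi> r \<in> grade R h"
proof -
  have r: "r \<in> carrier Rb" "\<And>p. p \<in> carrier G \<Longrightarrow> fst p \<noteq> h \<Longrightarrow> hparts G Rb r p = \<zero>\<^bsub>Rb\<^esub>"
    using assms by (auto simp: R_eq[symmetric] RP.grade_pushforward)
  have "hparts G Rb (char_act H A Rb \<chi> r) p = \<chi> (snd p) \<odot>\<^bsub>Rb\<^esub> hparts G Rb r p" if "p \<in> carrier G" for p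
    using that r(1) by (simp add: char_act_gradewise RG.gr.hparts_gradewise[OF gradewise_additive_char_act])
  then show ?thesis
    using assms(1) r char_act_closed[OF r(1)] char_closed[OF \<chi>]
    by (simp add: R_eq[symmetric] RP.grade_pushforward carrier_G)
qed

end

lemma char_act_inverse:
  assumes "\<chi> \<in> characters" "r \<in> carrier Rb"
  shows "char_act H A Rb \<chi> (char_act H A Rb (cinv \<chi>) r) = r"
  using assms(2)
proof (induction r rule: RG.gr.homogeneous_induct)
  case zero
  then show ?case using assms(1) by (simp add: char_act_zero)
next
  case (add x y)
  then show ?case using assms(1) by (simp add: char_act_add char_act_closed)
next
  case (homogeneous p r)
  let ?i = "cinv \<chi>"
  have p: "snd p \<in> carrier A" using homogeneous by (simp add: carrier_G)
  have i: "?i (snd p) \<in> carrier K" "\<chi> (snd p) \<in> carrier K"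
    using assms(1) p char_closed by auto
  have r: "r \<in> carrier Rb" using homogeneous RG.gr.grade_carrier by blast
  have "\<chi> (snd p) \<odot>\<^bsub>Rb\<^esub> (?i (snd p) \<odot>\<^bsub>Rb\<^esub> r) = r"
    using i r inv_char_mult(2)[OF assms(1) p] by (simp add: RA.smult_assoc1[symmetric])
  then show ?case
    using assms(1) homogeneous i smult_grade by (simp add: char_act_homogeneous)
qed

text \<open>The new action is an action because \<open>char_act\<close> is additive, multiplicative,
  unital and preserves degrees in \<open>H\<close>. Twisting alters \<open>smult\<close>, so
  \<open>same_module\<close> does not relate the two records; the additive group and the grading are
  compared by unfolding.\<close>

lemma graded_module_twist:
  assumes X: "graded_module H R X" and \<chi>: "\<chi> \<in> characters"
  shows "graded_module H R (twist R (char_act H A Rb \<chi>) X)"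
proof -
  interpret X: graded_module H R X by fact
  interpret XG: graded_group H X by (rule graded_module_graded_group[OF X])
  let ?Y = "twist R (char_act H A Rb \<chi>) X"
  have Y: "carrier ?Y = carrier X" "zero ?Y = zero X" "add ?Y = add X" "grade ?Y = grade X"
    "mult ?Y = mult X" "one ?Y = one X"
    by (simp_all add: twist_def)
  have Yr: "ract ?Y x r = ract X x (char_act H A Rb \<chi> r)" if "x \<in> carrier X" "r \<in> carrier Rb" for x r
    using that by (simp add: twist_def)
  have "abelian_group ?Y \<longleftrightarrow> abelian_group X"
    using Y by (simp add: abelian_group_def abelian_group_axioms_def abelian_monoid_def
      comm_group_def comm_monoid_def comm_monoid_axioms_def Group.group_def group_axioms_def
      Group.monoid_def Units_def)
  then interpret Y: abelian_group ?Y using X.X.abelian_group_axioms by blast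
  have ig: "is_grading H ?Y"
  proof -
    have "finsum ?Y = (finsum X :: _ \<Rightarrow> 'h set \<Rightarrow> _)"
      by (intro ext) (simp add: Y finsum_def finprod_def)
    then have "is_decomposition H ?Y = is_decomposition H X"
      by (intro ext) (simp add: is_decomposition_def Y hsupport_def)
    moreover have "additive_subgroup S ?Y \<longleftrightarrow> additive_subgroup S X" for S
      by (simp add: additive_subgroup_def subgroup_def Y m_inv_def)
    ultimately show ?thesis using X.module_grading by (simp add: is_grading_def Y)
  qed
  note ca = char_act_closed[OF \<chi>]
  show ?thesis
  proof unfold_locales
    show "is_grading H ?Y" by (rule ig)
  next
    fix x r assume "x \<in> carrier ?Y" "r \<in> carrier R"
    then show "ract ?Y x r \<in> carrier ?Y" using ca X.ract_closed by (simp add: Y Yr)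
  next
    fix x y r assume "x \<in> carrier ?Y" "y \<in> carrier ?Y" "r \<in> carrier R"
    then show "ract ?Y (x \<oplus>\<^bsub>?Y\<^esub> y) r = ract ?Y x r \<oplus>\<^bsub>?Y\<^esub> ract ?Y y r"
      using ca X.ract_add_left by (simp add: Y Yr)
  next
    fix x r s assume "x \<in> carrier ?Y" "r \<in> carrier R" "s \<in> carrier R"
    then show "ract ?Y x (r \<oplus>\<^bsub>R\<^esub> s) = ract ?Y x r \<oplus>\<^bsub>?Y\<^esub> ract ?Y x s"
      and "ract ?Y x (r \<otimes>\<^bsub>R\<^esub> s) = ract ?Y (ract ?Y x r) s"
      using ca X.ract_add_right X.ract_mult X.ract_closed
      by (simp_all add: Y Yr char_act_add[OF \<chi>] char_act_mult[OF \<chi>])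
  next
    fix x assume "x \<in> carrier ?Y"
    then show "ract ?Y x \<one>\<^bsub>R\<^esub> = x" using X.ract_one by (simp add: Y Yr char_act_one[OF \<chi>])
  next
    fix g h x r assume gh: "g \<in> carrier H" "h \<in> carrier H" "x \<in> grade ?Y g" "r \<in> grade R h"
    then have "x \<in> carrier X" "r \<in> carrier Rb"
      using XG.grade_carrier RH.gr.grade_carrier by (auto simp: Y)
    then show "ract ?Y x r \<in> grade ?Y (g \<otimes>\<^bsub>H\<^esub> h)"
      using gh X.grade_ract[OF gh(1,2)] char_act_grade[OF \<chi> gh(2,4)] by (simp add: Y Yr)
  next
    show "mult ?Y = undefined" "one ?Y = undefined"
      using X.mult_irrelevant X.one_irrelevant by (simp_all add: Y)
    show "add ?Y = (\<lambda>x\<in>carrier ?Y. \<lambda>y\<in>carrier ?Y. x \<oplus>\<^bsub>?Y\<^esub> y)"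
      using X.add_ext by (simp add: Y)
    show "smult ?Y = (\<lambda>r\<in>carrier R. \<lambda>x\<in>carrier ?Y. r \<odot>\<^bsub>?Y\<^esub> x)"
      by (auto simp: twist_def fun_eq_iff restrict_def)
  qed
qed

end

section \<open>Categories of graded modules and full subcategories\<close>

lemma graded_hom_id:
  assumes "graded_module G B X"
  shows "(\<lambda>x\<in>carrier X. x) \<in> graded_hom G B X X"
proof -
  interpret X: graded_group G X by (rule graded_module_graded_group[OF assms])
  interpret MX: right_module B X by (rule graded_module_right_module[OF assms])
  show ?thesis
    using X.grade_carrier MX.ract_closed by (auto simp: graded_hom_def)
qed

lemma is_cat_grMod:
  fixes G :: "('g, 'y) monoid_scheme" and B :: "('k, 'b, 'g) graded"
  shows "is_cat (grMod G B :: (('b, 'm, 'g) graded, 'm \<Rightarrow> 'm) cat)"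
proof -
  have id: "compose (carrier X) f (\<lambda>x\<in>carrier X. x) = f"
    "compose (carrier X) (\<lambda>x\<in>carrier Y. x) f = f"
    if "f \<in> graded_hom G B X Y" for X Y :: "('b, 'm, 'g) graded" and f
    using that by (auto simp: graded_hom_def compose_def fun_eq_iff PiE_iff extensional_def)
  have assoc: "compose (carrier W) h (compose (carrier W) g f) = compose (carrier W) (compose (carrier X) h g) f"
    if "f \<in> graded_hom G B W X" for W X :: "('b, 'm, 'g) graded" and f g h
    using that by (auto simp: graded_hom_def compose_def fun_eq_iff PiE_iff)
  show ?thesis
    unfolding is_cat_def grMod_def
    using graded_hom_id graded_hom_compose by (auto simp: id assoc)
qed

context graded_ring
begin

text \<open>Composing the map onto \<open>X\<close> with \<open>f\<close> leaves its kernel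
  unchanged. With \<open>f = \<alpha> \<chi>\<close> this shows that the twists of a finitely
  presented equivariant module are finitely presented.\<close>

lemma fin_presented_iso:
  assumes X: "graded_module G B X" and fp: "fin_presented G B X"
    and f: "is_iso (grMod G B) X Y f"
  shows "fin_presented G B Y"
proof -
  obtain g where Y: "graded_module G B Y" and f: "f \<in> graded_hom G B X Y" and g: "g \<in> graded_hom G B Y X"
    and gf: "compose (carrier X) g f = (\<lambda>x\<in>carrier X. x)" and fg: "compose (carrier Y) f g = (\<lambda>x\<in>carrier Y. x)"
    using f by (auto simp: is_iso_def grMod_def)
  interpret MX: right_module B X by (rule graded_module_right_module[OF X])
  have gf: "g (f x) = x" if "x \<in> carrier X" for x using fun_cong[OF gf, of x] that by (simp add: compose_def)
  have fg: "f (g y) = y" if "y \<in> carrier Y" for y using fun_cong[OF fg, of y] that by (simp add: compose_def)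
  note fc = graded_hom_closed[OF f] and gc = graded_hom_closed[OF g]
  have f0: "f \<zero>\<^bsub>X\<^esub> = \<zero>\<^bsub>Y\<^esub>"
    using MX.hom_zero[OF graded_module_right_module[OF Y] graded_hom_rmod_hom[OF f]] .
  obtain gs hs \<phi> \<epsilon> where gs: "set gs \<subseteq> carrier G" and hs: "set hs \<subseteq> carrier G" and
      \<phi>: "\<phi> \<in> graded_hom G B (free_graded G B hs) (free_graded G B gs)" and
      \<epsilon>: "\<epsilon> \<in> graded_hom G B (free_graded G B gs) X" and
      surj: "\<epsilon> ` carrier (free_graded G B gs) = carrier X" and
      ker: "\<phi> ` carrier (free_graded G B hs) = {u \<in> carrier (free_graded G B gs). \<epsilon> u = \<zero>\<^bsub>X\<^esub>}"
    using fp unfolding fin_presented_def by (elim exE conjE)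
  let ?F = "free_graded G B gs" and ?\<epsilon> = "compose (carrier (free_graded G B gs)) f \<epsilon>"
  have ec: "\<epsilon> u \<in> carrier X" if "u \<in> carrier ?F" for u using surj that by blast
  have hom: "?\<epsilon> \<in> graded_hom G B ?F Y"
    by (rule graded_hom_compose[OF graded_module_free_graded[OF gs] \<epsilon> f])
  have surj': "?\<epsilon> ` carrier ?F = carrier Y"
  proof -
    have "?\<epsilon> ` carrier ?F = f ` (\<epsilon> ` carrier ?F)" by (auto simp: compose_def)
    also have "\<dots> = carrier Y"
    proof
      show "f ` \<epsilon> ` carrier ?F \<subseteq> carrier Y" unfolding surj using fc by blast
      show "carrier Y \<subseteq> f ` \<epsilon> ` carrier ?F"
      proof
        fix y assume "y \<in> carrier Y"
        then show "y \<in> f ` \<epsilon> ` carrier ?F"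
          unfolding surj by (intro image_eqI[of _ _ "g y"]) (simp_all add: fg gc)
      qed
    qed
    finally show ?thesis .
  qed
  have "{u \<in> carrier ?F. ?\<epsilon> u = \<zero>\<^bsub>Y\<^esub>} = {u \<in> carrier ?F. \<epsilon> u = \<zero>\<^bsub>X\<^esub>}"
  proof (intro Collect_cong conj_cong refl)
    fix u assume u: "u \<in> carrier ?F"
    show "?\<epsilon> u = \<zero>\<^bsub>Y\<^esub> \<longleftrightarrow> \<epsilon> u = \<zero>\<^bsub>X\<^esub>"
      using u gf[OF ec[OF u]] gf[OF MX.zero_closed] f0 by (auto simp: compose_def)
  qed
  then have ker': "\<phi> ` carrier (free_graded G B hs) = {u \<in> carrier ?F. ?\<epsilon> u = \<zero>\<^bsub>Y\<^esub>}"
    by (simp only: ker)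
  show ?thesis
    unfolding fin_presented_def
    by (intro exI[of _ gs] exI[of _ hs] exI[of _ \<phi>] exI[of _ ?\<epsilon>] conjI gs hs \<phi> hom surj' ker')
qed

end

lemma full_subcat_simps:
  "Obj (full_subcat C P) = {X \<in> Obj C. P X}" "Mor (full_subcat C P) = Mor C"
  "Idt (full_subcat C P) = Idt C" "Cmp (full_subcat C P) = Cmp C"
  by (simp_all add: full_subcat_def)

text \<open>The inverse restricts as well: \<open>P\<close> at \<open>F' Y\<close> is equivalent to
  \<open>Q\<close> at \<open>F (F' Y)\<close>, which is \<open>Y\<close>.\<close>

lemma cat_isomorphism_full_subcat:
  assumes "cat_isomorphism C D F" and P: "\<And>X. X \<in> Obj C \<Longrightarrow> P X \<longleftrightarrow> Q (fobj F X)"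
  shows "cat_isomorphism (full_subcat C P) (full_subcat D Q) F"
proof -
  obtain F' where F: "is_functor C D F" and F': "is_functor D C F'"
    and inv: "left_inverse C F F'" "left_inverse D F' F"
    using assms(1) by (auto simp: cat_isomorphism_def)
  have sub: "is_cat (full_subcat C P)" if "is_cat C" for C :: "('x, 'y) cat" and P
    using that unfolding is_cat_def full_subcat_simps by (simp add: Ball_def)
  have "is_cat C" "is_cat D" using F by (auto simp: is_functor_def)
  note cats = sub[OF this(1)] sub[OF this(2)]
  have Q: "P (fobj F' Y)" if "Y \<in> Obj D" "Q Y" for Y
    using that P[of "fobj F' Y"] F' inv(2) by (auto simp: is_functor_def left_inverse_def)
  have P': "Q (fobj F X)" if "X \<in> Obj C" "P X" for X
    using P that by blast
  have "is_functor (full_subcat C P) (full_subcat D Q) F"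
    using F P' cats unfolding is_functor_def full_subcat_simps by (simp add: Ball_def)
  moreover have "is_functor (full_subcat D Q) (full_subcat C P) F'"
    using F' Q cats unfolding is_functor_def full_subcat_simps by (simp add: Ball_def)
  moreover have "left_inverse (full_subcat C P) F F'" "left_inverse (full_subcat D Q) F' F"
    using inv by (simp_all add: left_inverse_def full_subcat_simps)
  ultimately show ?thesis by (auto simp: cat_isomorphism_def)
qed

context refinement_setup
begin

section \<open>Equivariant objects for the twisting action\<close>

abbreviation twisted :: "('a \<Rightarrow> 'k) \<Rightarrow> ('b, 'm, 'h) graded \<Rightarrow> ('b, 'm, 'h) graded" where
  "twisted \<chi> X \<equiv> twist R (char_act H A Rb (cinv \<chi>)) X"

abbreviation EC :: "(('b, 'm, 'h) graded \<times> (('a \<Rightarrow> 'k) \<Rightarrow> 'm \<Rightarrow> 'm), 'm \<Rightarrow> 'm) cat" where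
  "EC \<equiv> equivariant_cat (char_group K A) (grMod H R) (twisting_action K H A R Rb)"

text \<open>The twisting functors fix every map, so the cocycle condition turns into an equation
  between composites of plain maps.\<close>

lemma Obj_EC: "(X, \<alpha>) \<in> Obj EC \<longleftrightarrow> graded_module H R X \<and> \<alpha> \<in> extensional characters \<and>
    (\<forall>\<chi>\<in>characters. is_iso (grMod H R) X (twisted \<chi> X) (\<alpha> \<chi>)) \<and>
    (\<forall>\<chi>\<in>characters. \<forall>\<psi>\<in>characters. \<alpha> (\<chi> \<star> \<psi>) = compose (carrier X) (\<alpha> \<psi>) (\<alpha> \<chi>))"
  by (simp add: equivariant_cat_def twisting_action_def grMod_def)

lemma Mor_EC: "Mor EC (X, \<alpha>) (Y, \<beta>) = {\<theta> \<in> graded_hom H R X Y.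
    \<forall>\<chi>\<in>characters. \<forall>x\<in>carrier X. \<beta> \<chi> (\<theta> x) = \<theta> (\<alpha> \<chi> x)}"
  by (auto simp: equivariant_cat_def twisting_action_def grMod_def compose_def fun_eq_iff restrict_def)

lemma Idt_EC: "Idt EC (X, \<alpha>) = (\<lambda>x\<in>carrier X. x)"
  by (simp add: equivariant_cat_def grMod_def)

lemma Cmp_EC: "Cmp EC (X, \<alpha>) (Y, \<beta>) (Z, \<gamma>) g f = compose (carrier X) g f"
  by (simp add: equivariant_cat_def grMod_def)

lemma is_iso_grMod: "is_iso (grMod H R) X Y f \<longleftrightarrow> graded_module H R X \<and> graded_module H R Y \<and>
    f \<in> graded_hom H R X Y \<and> (\<exists>g\<in>graded_hom H R Y X. (\<forall>x\<in>carrier X. g (f x) = x) \<and> (\<forall>y\<in>carrier Y. f (g y) = y))"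
  by (auto simp: is_iso_def grMod_def compose_def fun_eq_iff restrict_def)

lemma twist_simps:
  "carrier (twist R \<sigma> X) = carrier X" "\<zero>\<^bsub>twist R \<sigma> X\<^esub> = \<zero>\<^bsub>X\<^esub>" "add (twist R \<sigma> X) = add X"
  "grade (twist R \<sigma> X) = grade X"
  "x \<in> carrier X \<Longrightarrow> r \<in> carrier Rb \<Longrightarrow> ract (twist R \<sigma> X) x r = ract X x (\<sigma> r)"
  by (simp_all add: twist_def)

text \<open>Read as a map from \<open>X\<close> to itself instead of to its twist,
  \<open>\<alpha> \<chi>\<close> becomes semilinear: it respects the action up to the automorphism
  of the algebra given by the inverse of \<open>\<chi>\<close>.\<close>

lemma equivariant_hom:
  assumes "(X, \<alpha>) \<in> Obj EC" "\<chi> \<in> characters"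
  shows "\<alpha> \<chi> \<in> carrier X \<rightarrow>\<^sub>E carrier X"
    and "\<And>x y. x \<in> carrier X \<Longrightarrow> y \<in> carrier X \<Longrightarrow> \<alpha> \<chi> (x \<oplus>\<^bsub>X\<^esub> y) = \<alpha> \<chi> x \<oplus>\<^bsub>X\<^esub> \<alpha> \<chi> y"
    and "\<And>x r. x \<in> carrier X \<Longrightarrow> r \<in> carrier Rb \<Longrightarrow>
      \<alpha> \<chi> (ract X x r) = ract X (\<alpha> \<chi> x) (char_act H A Rb (cinv \<chi>) r)"
    and "\<And>h x. h \<in> carrier H \<Longrightarrow> x \<in> grade X h \<Longrightarrow> \<alpha> \<chi> x \<in> grade X h"
    and "inj_on (\<alpha> \<chi>) (carrier X)"
proof -
  have iso: "is_iso (grMod H R) X (twisted \<chi> X) (\<alpha> \<chi>)" using assms by (simp add: Obj_EC)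
  then have hom: "\<alpha> \<chi> \<in> graded_hom H R X (twisted \<chi> X)" by (simp add: is_iso_grMod)
  then show c: "\<alpha> \<chi> \<in> carrier X \<rightarrow>\<^sub>E carrier X" by (auto simp: graded_hom_def twist_simps)
  show "\<alpha> \<chi> (x \<oplus>\<^bsub>X\<^esub> y) = \<alpha> \<chi> x \<oplus>\<^bsub>X\<^esub> \<alpha> \<chi> y" if "x \<in> carrier X" "y \<in> carrier X" for x y
    using hom that by (auto simp: graded_hom_def twist_simps)
  show "\<alpha> \<chi> (ract X x r) = ract X (\<alpha> \<chi> x) (char_act H A Rb (cinv \<chi>) r)"
    if "x \<in> carrier X" "r \<in> carrier Rb" for x r
  proof -
    have "\<alpha> \<chi> (ract X x r) = ract (twisted \<chi> X) (\<alpha> \<chi> x) r"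
      using hom that by (auto simp: graded_hom_def)
    moreover have "\<alpha> \<chi> x \<in> carrier X" using c that by auto
    ultimately show ?thesis using that by (simp add: twist_simps)
  qed
  show "\<alpha> \<chi> x \<in> grade X h" if "h \<in> carrier H" "x \<in> grade X h" for h x
    using hom that unfolding graded_hom_def twist_simps by blast
  show "inj_on (\<alpha> \<chi>) (carrier X)"
    using iso unfolding is_iso_grMod by (metis inj_onI)
qed

lemma is_cat_EC: "is_cat (EC :: (('b, 'm, 'h) graded \<times> (('a \<Rightarrow> 'k) \<Rightarrow> 'm \<Rightarrow> 'm), 'm \<Rightarrow> 'm) cat)"
  unfolding is_cat_def
proof (intro conjI ballI)
  fix X :: "('b, 'm, 'h) graded \<times> (('a \<Rightarrow> 'k) \<Rightarrow> 'm \<Rightarrow> 'm)" assume X: "X \<in> Obj EC"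
  obtain X' \<alpha> where X': "X = (X', \<alpha>)" by (cases X)
  then have g: "graded_module H R X'" using X by (simp add: Obj_EC)
  show "Idt EC X \<in> Mor EC X X"
    using graded_hom_id[OF g] equivariant_hom(1)[of X' \<alpha>] X
    by (auto simp: X' Idt_EC Mor_EC)
  fix Y :: "('b, 'm, 'h) graded \<times> (('a \<Rightarrow> 'k) \<Rightarrow> 'm \<Rightarrow> 'm)" assume Y: "Y \<in> Obj EC"
  obtain Y' \<beta> where Y': "Y = (Y', \<beta>)" by (cases Y)
  {
    fix f assume f: "f \<in> Mor EC X Y"
    then show "Cmp EC X X Y f (Idt EC X) = f" "Cmp EC X Y Y (Idt EC Y) f = f"
      by (auto simp: X' Y' Idt_EC Mor_EC Cmp_EC graded_hom_def compose_def fun_eq_iff PiE_iff extensional_def)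
  }
  fix Z :: "('b, 'm, 'h) graded \<times> (('a \<Rightarrow> 'k) \<Rightarrow> 'm \<Rightarrow> 'm)"
  obtain Z' \<gamma> where Z': "Z = (Z', \<gamma>)" by (cases Z)
  fix f g assume f: "f \<in> Mor EC X Y" and g': "g \<in> Mor EC Y Z"
  have fh: "f \<in> graded_hom H R X' Y'" and gh: "g \<in> graded_hom H R Y' Z'"
    using f g' by (auto simp: X' Y' Z' Mor_EC)
  note fc = graded_hom_closed[OF fh]
  have ac: "\<alpha> \<chi> x \<in> carrier X'" if "\<chi> \<in> characters" "x \<in> carrier X'" for \<chi> x
    using equivariant_hom(1)[of X' \<alpha> \<chi>] X that by (auto simp: X')
  show "Cmp EC X Y Z g f \<in> Mor EC X Z"
    using graded_hom_compose[OF g fh gh] f g' fc ac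
    by (auto simp: X' Y' Z' Mor_EC Cmp_EC compose_def)
next
  fix W X Y Z :: "('b, 'm, 'h) graded \<times> (('a \<Rightarrow> 'k) \<Rightarrow> 'm \<Rightarrow> 'm)" and f g h
  assume f: "f \<in> Mor EC W X"
  obtain W' X' Y' Z' \<alpha> \<beta> \<gamma> \<delta> where e: "W = (W', \<alpha>)" "X = (X', \<beta>)" "Y = (Y', \<gamma>)" "Z = (Z', \<delta>)"
    by (cases W; cases X; cases Y; cases Z)
  have "f x \<in> carrier X'" if "x \<in> carrier W'" for x using f that by (auto simp: e Mor_EC graded_hom_def)
  then show "Cmp EC W Y Z h (Cmp EC W X Y g f) = Cmp EC W X Z (Cmp EC X Y Z h g) f"
    by (auto simp: e Cmp_EC compose_def fun_eq_iff)
qed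

end

section \<open>The equivariant structure on a module with forgotten second degree\<close>

locale refinement_module = refinement_setup K A H R Rb
  for K :: "('k, 'w) ring_scheme" (structure) and A :: "('a, 'z) monoid_scheme"
    and H :: "('h, 'y) monoid_scheme" and R :: "('k, 'b, 'h) graded" and Rb :: "('k, 'b, 'h \<times> 'a) graded" +
  fixes X :: "('b, 'm, 'h \<times> 'a) graded"
  assumes graded_X: "graded_module G Rb X"
begin

sublocale GX: graded_group G X by (rule graded_module_graded_group[OF graded_X])

sublocale MX: right_module Rb X by (rule graded_module_right_module[OF graded_X])

sublocale PX: product_graded_group H A X
  by (intro product_graded_group.intro GX.graded_group_axioms H.group_axioms A.group_axioms)

lemma grade_ract: "\<lbrakk>p \<in> carrier G; q \<in> carrier G; x \<in> grade X p; r \<in> grade Rb q\<rbrakk> \<Longrightarrow>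
    ract X x r \<in> grade X (p \<otimes>\<^bsub>G\<^esub> q)"
  by (rule graded_module.grade_ract[OF graded_X])

lemma ract_scal_grade:
  "p \<in> carrier G \<Longrightarrow> x \<in> grade X p \<Longrightarrow> t \<in> carrier K \<Longrightarrow> ract X x (scal t) \<in> grade X p"
  using grade_ract[OF _ RG.G.one_closed _ scal_grade, of p x t] RG.G.r_one[of p] by simp

lemma hparts_ract_scal:
  assumes "x \<in> carrier X" "t \<in> carrier K" "p \<in> carrier G"
  shows "hparts G X (ract X x (scal t)) p = ract X (hparts G X x p) (scal t)"
  using assms(1)
proof (induction x rule: GX.homogeneous_induct)
  case (homogeneous q x)
  then show ?case using assms(2,3)
    by (simp add: GX.hparts_homogeneous[OF _ ract_scal_grade] GX.hparts_homogeneous MX.ract_zero_left)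
qed (use assms(2,3) in \<open>simp_all add: MX.ract_zero_left MX.ract_add_left GX.hparts_zero GX.hparts_add
    GX.hparts_closed MX.ract_closed\<close>)

lemma graded_module_pushforward: "graded_module H R PX.PX"
proof -
  have P: "carrier PX.PX = carrier X" "\<zero>\<^bsub>PX.PX\<^esub> = \<zero>\<^bsub>X\<^esub>" "add PX.PX = add X" "smult PX.PX = smult X"
    "mult PX.PX = mult X" "one PX.PX = one X"
    by (simp_all add: pushforward_def)
  interpret X: graded_module G Rb X by (rule graded_X)
  have *: "ract X x r \<in> grade PX.PX (g \<otimes>\<^bsub>H\<^esub> h)"
    if gh: "g \<in> carrier H" "h \<in> carrier H" and x: "x \<in> grade PX.PX g" and r: "r \<in> grade R h" for g h x r
  proof -
    let ?S = "{p \<in> carrier G. fst p = g}" and ?T = "{p \<in> carrier G. fst p = h}"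
    \<comment> \<open>The definition of the pushforward by finite sums is the convenient one here:
      \<open>x r\<close> expands into products of the \<open>c p\<close> with the
      \<open>d q\<close>, all of first degree \<open>g h\<close>.\<close>
    obtain S c where S: "finite S" "S \<subseteq> ?S" "\<And>p. p \<in> S \<Longrightarrow> c p \<in> grade X p" "x = (\<Oplus>\<^bsub>X\<^esub>p\<in>S. c p)"
      using x gh by (auto simp: pushforward_def Pi_iff)
    obtain T d where T: "finite T" "T \<subseteq> ?T" "\<And>q. q \<in> T \<Longrightarrow> d q \<in> grade Rb q" "r = (\<Oplus>\<^bsub>Rb\<^esub>q\<in>T. d q)"
      using r gh by (auto simp: R_eq[symmetric] pushforward_def Pi_iff)
    have fin: "finsum PX.PX f I = finsum X f I" for f :: "'h \<times> 'a \<Rightarrow> 'm" and I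
      by (simp add: same_module_finsum[OF same_module_pushforward])
    have c: "c p \<in> carrier X" if "p \<in> S" for p
      using S(2) S(3)[OF that] that GX.grade_carrier[of p "c p"] by blast
    have d: "d q \<in> carrier Rb" if "q \<in> T" for q
      using T(2) T(3)[OF that] that RG.gr.grade_carrier[of q "d q"] by blast
    have gh': "g \<otimes>\<^bsub>H\<^esub> h \<in> carrier H" using gh by simp
    have rc: "r \<in> carrier Rb" using RH.gr.grade_carrier[OF gh(2) r] by simp
    have "ract X (c p) r \<in> grade PX.PX (g \<otimes>\<^bsub>H\<^esub> h)" if p: "p \<in> S" for p
    proof -
      have "ract X (c p) (d q) \<in> grade PX.PX (g \<otimes>\<^bsub>H\<^esub> h)" if q: "q \<in> T" for q
      proof -
        have pq: "p \<in> carrier G" "q \<in> carrier G" "fst p = g" "fst q = h" using p q S T by auto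
        then have "fst (p \<otimes>\<^bsub>G\<^esub> q) = g \<otimes>\<^bsub>H\<^esub> h" by (auto simp: DirProd_def)
        then show ?thesis
          using PX.grade_pushforward_homogeneous[OF RG.G.m_closed[OF pq(1,2)]
              grade_ract[OF pq(1,2) S(3)[OF p] T(3)[OF q]]] by simp
      qed
      then have "(\<Oplus>\<^bsub>X\<^esub>q\<in>T. ract X (c p) (d q)) \<in> grade PX.PX (g \<otimes>\<^bsub>H\<^esub> h)"
        unfolding fin[symmetric] by (intro PX.P.grade_finsum gh')
      then show ?thesis using T(4) d by (simp add: MX.ract_finsum_right c p)
    qed
    then have "(\<Oplus>\<^bsub>X\<^esub>p\<in>S. ract X (c p) r) \<in> grade PX.PX (g \<otimes>\<^bsub>H\<^esub> h)"
      unfolding fin[symmetric] by (intro PX.P.grade_finsum gh')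
    then show ?thesis using S(4) c rc by (simp add: MX.ract_finsum_left)
  qed
  show ?thesis
  proof unfold_locales
    show "is_grading H PX.PX" by (rule PX.is_grading_pushforward)
    show "mult PX.PX = undefined" "one PX.PX = undefined"
      using X.mult_irrelevant X.one_irrelevant by (simp_all add: P)
    show "add PX.PX = (\<lambda>x\<in>carrier PX.PX. \<lambda>y\<in>carrier PX.PX. x \<oplus>\<^bsub>PX.PX\<^esub> y)"
      using X.add_ext by (simp add: P)
    show "smult PX.PX = (\<lambda>r\<in>carrier R. \<lambda>x\<in>carrier PX.PX. r \<odot>\<^bsub>PX.PX\<^esub> x)"
      using X.smult_ext by (simp add: P)
  qed (use * in \<open>simp_all add: P MX.ract_closed MX.ract_add_left MX.ract_add_right MX.ract_mult MX.ract_one\<close>)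
qed

abbreviation gam :: "('a \<Rightarrow> 'k) \<Rightarrow> 'm \<Rightarrow> 'm" where
  "gam \<equiv> gamma K H A Rb X"

lemma gamma_extensional: "gam \<chi> \<in> extensional (carrier X)"
  by (simp add: gamma_def)

context
  fixes \<chi> :: "'a \<Rightarrow> 'k"
  assumes \<chi>: "\<chi> \<in> characters"
begin

lemma cinv_closed: "a \<in> carrier A \<Longrightarrow> cinv \<chi> a \<in> carrier K"
  by (rule char_closed[OF D.inv_closed[OF \<chi>]])

lemma gamma_gradewise:
  "x \<in> carrier X \<Longrightarrow> gam \<chi> x = GX.gradewise (\<lambda>p x. ract X x (scal (cinv \<chi> (snd p)))) x"
  by (simp add: gamma_def GX.gradewise_def Let_def scal_def)

lemma gradewise_additive_gamma: "GX.gradewise_additive (\<lambda>p x. ract X x (scal (cinv \<chi> (snd p))))"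
  unfolding GX.gradewise_additive_def
proof (intro ballI conjI)
  fix p x assume p: "p \<in> carrier G" and x: "x \<in> grade X p"
  have c: "cinv \<chi> (snd p) \<in> carrier K" using p cinv_closed by (simp add: carrier_G)
  show "ract X x (scal (cinv \<chi> (snd p))) \<in> grade X p" by (rule ract_scal_grade[OF p x c])
  fix y assume y: "y \<in> grade X p"
  show "ract X (x \<oplus>\<^bsub>X\<^esub> y) (scal (cinv \<chi> (snd p)))
      = ract X x (scal (cinv \<chi> (snd p))) \<oplus>\<^bsub>X\<^esub> ract X y (scal (cinv \<chi> (snd p)))"
    using c GX.grade_carrier[OF p x] GX.grade_carrier[OF p y] by (simp add: MX.ract_add_left)
qed

lemma gamma_closed: "x \<in> carrier X \<Longrightarrow> gam \<chi> x \<in> carrier X"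
  using GX.gradewise_closed[OF gradewise_additive_gamma] by (simp add: gamma_gradewise)

lemma gamma_homogeneous:
  "p \<in> carrier G \<Longrightarrow> x \<in> grade X p \<Longrightarrow> gam \<chi> x = ract X x (scal (cinv \<chi> (snd p)))"
  using GX.gradewise_homogeneous[OF gradewise_additive_gamma] GX.grade_carrier
  by (simp add: gamma_gradewise)

lemma gamma_zero: "gam \<chi> \<zero>\<^bsub>X\<^esub> = \<zero>\<^bsub>X\<^esub>"
  using GX.gradewise_zero[OF gradewise_additive_gamma] by (simp add: gamma_gradewise)

lemma gamma_add: "x \<in> carrier X \<Longrightarrow> y \<in> carrier X \<Longrightarrow> gam \<chi> (x \<oplus>\<^bsub>X\<^esub> y) = gam \<chi> x \<oplus>\<^bsub>X\<^esub> gam \<chi> y"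
  using GX.gradewise_add[OF gradewise_additive_gamma] by (simp add: gamma_gradewise)

lemma hparts_gamma: "x \<in> carrier X \<Longrightarrow> p \<in> carrier G \<Longrightarrow>
    hparts G X (gam \<chi> x) p = ract X (hparts G X x p) (scal (cinv \<chi> (snd p)))"
  using GX.hparts_gradewise[OF gradewise_additive_gamma] by (simp add: gamma_gradewise)

lemma gamma_grade:
  assumes "h \<in> carrier H" "x \<in> grade PX.PX h"
  shows "gam \<chi> x \<in> grade PX.PX h"
proof -
  have x: "x \<in> carrier X" "\<And>p. p \<in> carrier G \<Longrightarrow> fst p \<noteq> h \<Longrightarrow> hparts G X x p = \<zero>\<^bsub>X\<^esub>"
    using assms by (auto simp: PX.grade_pushforward)
  have "hparts G X (gam \<chi> x) p = \<zero>\<^bsub>X\<^esub>" if "p \<in> carrier G" "fst p \<noteq> h" for p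
    using that x cinv_closed by (simp add: hparts_gamma MX.ract_zero_left carrier_G)
  then show ?thesis
    using assms(1) gamma_closed[OF x(1)] by (simp add: PX.grade_pushforward)
qed

text \<open>For \<open>x\<close> of second degree \<open>a\<close> and \<open>r\<close> of second
  degree \<open>b\<close>, the product is scaled by
  \<open>\<chi>^-1(a b) = \<chi>^-1(a) \<chi>^-1(b)\<close>: the first factor is the one for
  \<open>x\<close>, the second is the one by which the character acts on \<open>r\<close>.
  Additivity in both arguments gives the rest.\<close>

lemma gamma_ract:
  assumes "x \<in> carrier X" "r \<in> carrier Rb"
  shows "gam \<chi> (ract X x r) = ract X (gam \<chi> x) (char_act H A Rb (cinv \<chi>) r)"
proof -
  note ci = D.inv_closed[OF \<chi>]
  note ca = char_act_closed[OF ci] char_act_zero[OF ci] char_act_add[OF ci] char_act_homogeneous[OF ci]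
  show ?thesis
    using assms(1)
  proof (induction x rule: GX.homogeneous_induct)
    case zero
    show ?case using assms(2) by (simp add: gamma_zero MX.ract_zero_left ca(1))
  next
    case (add x y)
    then show ?case using assms(2) by (simp add: gamma_add gamma_closed MX.ract_add_left MX.ract_closed ca(1))
  next
    case (homogeneous p x)
    have x: "x \<in> carrier X" using homogeneous GX.grade_carrier by blast
    show ?case using assms(2)
    proof (induction r rule: RG.gr.homogeneous_induct)
      case zero
      show ?case using x by (simp add: gamma_zero MX.ract_zero_right ca(2) gamma_closed)
    next
      case (add r s)
      then show ?case using x
        by (simp add: gamma_add gamma_closed MX.ract_add_right MX.ract_closed ca(1,3))
    next
      case (homogeneous q r)
      have r: "r \<in> carrier Rb" using homogeneous RG.gr.grade_carrier by blast
      have pq: "p \<otimes>\<^bsub>G\<^esub> q \<in> carrier G" "snd (p \<otimes>\<^bsub>G\<^esub> q) = snd p \<otimes>\<^bsub>A\<^esub> snd q"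
        using \<open>p \<in> carrier G\<close> homogeneous by (auto simp: DirProd_def)
      have s: "snd p \<in> carrier A" "snd q \<in> carrier A"
        using \<open>p \<in> carrier G\<close> homogeneous by (auto simp: carrier_G)
      note c = cinv_closed[OF s(1)] cinv_closed[OF s(2)]
      have "gam \<chi> (ract X x r) = ract X (ract X x r) (scal (cinv \<chi> (snd p) \<otimes> cinv \<chi> (snd q)))"
        using gamma_homogeneous[OF pq(1) grade_ract[OF \<open>p \<in> carrier G\<close> homogeneous(1) \<open>x \<in> grade X p\<close> homogeneous(2)]]
        by (simp add: pq(2) char_mult[OF ci s])
      also have "\<dots> = ract X (ract X (ract X x r) (scal (cinv \<chi> (snd p)))) (scal (cinv \<chi> (snd q)))"
        using c x r by (simp add: ract_scal_mult[OF MX.right_module_axioms] MX.ract_closed)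
      also have "\<dots> = ract X (ract X x (scal (cinv \<chi> (snd p)))) (cinv \<chi> (snd q) \<odot>\<^bsub>Rb\<^esub> r)"
        unfolding ract_scal_commute[OF MX.right_module_axioms x c(1) r, symmetric]
        by (rule ract_smult[OF MX.right_module_axioms MX.ract_closed[OF x scal_closed[OF c(1)]] c(2) r, symmetric])
      finally show ?case
        using \<open>p \<in> carrier G\<close> \<open>x \<in> grade X p\<close> homogeneous by (simp add: gamma_homogeneous ca(4))
    qed
  qed
qed

end

text \<open>This is the cocycle condition. On a component of degree \<open>(h, a)\<close> both sides
  are multiplication by \<open>\<chi>^-1(a) \<psi>^-1(a)\<close>.\<close>

lemma gamma_mult:
  assumes "\<chi> \<in> characters" "\<psi> \<in> characters" "x \<in> carrier X"
  shows "gam (\<chi> \<star> \<psi>) x = gam \<psi> (gam \<chi> x)"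
proof (rule GX.hparts_eqI)
  note cp = D.m_closed[OF assms(1,2)]
  show "gam (\<chi> \<star> \<psi>) x \<in> carrier X" "gam \<psi> (gam \<chi> x) \<in> carrier X"
    using assms cp by (simp_all add: gamma_closed)
  fix p assume p: "p \<in> carrier G"
  have s: "snd p \<in> carrier A" using p by (simp add: carrier_G)
  have "cinv (\<chi> \<star> \<psi>) = cinv \<psi> \<star> cinv \<chi>"
    by (rule D.inv_mult_group[OF assms(1,2)])
  then have "cinv (\<chi> \<star> \<psi>) (snd p) = cinv \<chi> (snd p) \<otimes> cinv \<psi> (snd p)"
    using s cinv_closed[OF assms(1) s] cinv_closed[OF assms(2) s] by (simp add: char_group_mult K.m_comm)
  then show "hparts G X (gam (\<chi> \<star> \<psi>) x) p = hparts G X (gam \<psi> (gam \<chi> x)) p"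
    using p assms cp s cinv_closed[OF assms(1) s] cinv_closed[OF assms(2) s]
    by (simp add: hparts_gamma gamma_closed ract_scal_mult[OF MX.right_module_axioms] GX.hparts_closed)
qed

lemma gamma_one:
  assumes "x \<in> carrier X"
  shows "gam char_unit x = x"
proof (rule GX.hparts_eqI)
  fix p assume p: "p \<in> carrier G"
  then have "snd p \<in> carrier A" by (simp add: carrier_G)
  then have "cinv char_unit (snd p) = \<one>"
    unfolding D.inv_one by (simp add: char_group_one)
  then show "hparts G X (gam char_unit x) p = hparts G X x p"
    using p assms by (simp add: hparts_gamma scal_one MX.ract_one GX.hparts_closed)
qed (use assms in \<open>simp_all add: gamma_closed\<close>)

text \<open>The inverse is the map \<open>gam\<close> of the inverse character. Out of the twisted
  module it is linear, because the algebra automorphisms of \<open>\<chi>\<close> and of its inverse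
  cancel.\<close>

lemma gamma_iso:
  assumes \<chi>: "\<chi> \<in> characters"
  shows "is_iso (grMod H R) PX.PX (twisted \<chi> PX.PX) (gam \<chi>)"
  unfolding is_iso_grMod
proof (intro conjI bexI[of _ "gam (cinv \<chi>)"] ballI)
  note ci = D.inv_closed[OF \<chi>]
  have P: "carrier PX.PX = carrier X" "add PX.PX = add X" "smult PX.PX = smult X"
    by (simp_all add: pushforward_def)
  have e: "gam \<psi> \<in> carrier X \<rightarrow>\<^sub>E carrier X" if "\<psi> \<in> characters" for \<psi>
    using that gamma_closed gamma_extensional by (auto simp: PiE_iff)
  show "graded_module H R PX.PX" by (rule graded_module_pushforward)
  then show "graded_module H R (twisted \<chi> PX.PX)" by (rule graded_module_twist[OF _ ci])
  show "gam \<chi> \<in> graded_hom H R PX.PX (twisted \<chi> PX.PX)"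
    using e[OF \<chi>] gamma_add[OF \<chi>] gamma_ract[OF \<chi>] gamma_grade[OF \<chi>] gamma_closed[OF \<chi>]
    by (auto simp: graded_hom_def twist_simps P)
  have "gam (cinv \<chi>) (ract X x (char_act H A Rb (cinv \<chi>) r)) = ract X (gam (cinv \<chi>) x) r"
    if "x \<in> carrier X" "r \<in> carrier Rb" for x r
    using gamma_ract[OF ci that(1) char_act_closed[OF ci that(2)]] char_act_inverse[OF \<chi> that(2)] \<chi>
    by simp
  then show "gam (cinv \<chi>) \<in> graded_hom H R (twisted \<chi> PX.PX) PX.PX"
    using e[OF ci] gamma_add[OF ci] gamma_grade[OF ci]
    by (auto simp: graded_hom_def twist_simps P)
  show "gam (cinv \<chi>) (gam \<chi> x) = x" if "x \<in> carrier PX.PX" for x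
    using that gamma_mult[OF \<chi> ci, of x] \<chi> by (simp add: P gamma_one)
  show "gam \<chi> (gam (cinv \<chi>) x) = x" if "x \<in> carrier (twisted \<chi> PX.PX)" for x
    using that gamma_mult[OF ci \<chi>, of x] \<chi> by (simp add: P twist_simps gamma_one)
qed

lemma Gamma_obj: "fobj (Gamma K H A Rb) X \<in> Obj EC"
proof -
  have P: "carrier PX.PX = carrier X" by (simp add: pushforward_def)
  have "gam (\<chi> \<star> \<psi>) = compose (carrier X) (gam \<psi>) (gam \<chi>)"
    if "\<chi> \<in> characters" "\<psi> \<in> characters" for \<chi> \<psi>
    using gamma_mult[OF that] gamma_extensional[of "\<chi> \<star> \<psi>"]
    by (auto simp: compose_def fun_eq_iff extensional_def)
  then show ?thesis
    by (simp add: Gamma_def Obj_EC graded_module_pushforward gamma_iso P)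
qed

text \<open>A component of the wrong second degree vanishes, because some character takes different values
  on the two degrees.\<close>

lemma grade_eigenspace:
  assumes p: "p \<in> carrier G"
  shows "grade X p = {x \<in> grade PX.PX (fst p). \<forall>\<chi>\<in>characters. gam \<chi> x = ract X x (scal (cinv \<chi> (snd p)))}"
proof (intro equalityI subsetI)
  fix x assume "x \<in> grade X p"
  then show "x \<in> {x \<in> grade PX.PX (fst p). \<forall>\<chi>\<in>characters. gam \<chi> x = ract X x (scal (cinv \<chi> (snd p)))}"
    using p PX.grade_pushforward_homogeneous by (simp add: gamma_homogeneous)
next
  fix x assume "x \<in> {x \<in> grade PX.PX (fst p). \<forall>\<chi>\<in>characters. gam \<chi> x = ract X x (scal (cinv \<chi> (snd p)))}"
  then have x: "x \<in> grade PX.PX (fst p)" and eq: "\<And>\<chi>. \<chi> \<in> characters \<Longrightarrow> gam \<chi> x = ract X x (scal (cinv \<chi> (snd p)))"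
    by auto
  have s: "fst p \<in> carrier H" "snd p \<in> carrier A" using p by (auto simp: carrier_G)
  then have xc: "x \<in> carrier X" and xz: "\<And>q. q \<in> carrier G \<Longrightarrow> fst q \<noteq> fst p \<Longrightarrow> hparts G X x q = \<zero>\<^bsub>X\<^esub>"
    using x by (auto simp: PX.grade_pushforward)
  have "hparts G X x q = \<zero>\<^bsub>X\<^esub>" if q: "q \<in> carrier G" "q \<noteq> p" for q
  proof (cases "fst q = fst p")
    case True
    then have "snd q \<noteq> snd p" using q by (auto simp: prod_eq_iff)
    moreover have sq: "snd q \<in> carrier A" using q by (simp add: carrier_G)
    ultimately obtain \<psi> where \<psi>: "\<psi> \<in> characters" "\<psi> (snd q) \<noteq> \<psi> (snd p)"
      using characters_separate s by blast
    \<comment> \<open>At the inverse of \<open>\<psi>\<close> the map \<open>gam\<close> scales by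
      the values of \<open>\<psi>\<close> itself; the two sides are the components of degree
      \<open>q\<close> in the eigenvector equation for that character.\<close>
    have "ract X (hparts G X x q) (scal (\<psi> (snd q))) = ract X (hparts G X x q) (scal (\<psi> (snd p)))"
      using hparts_gamma[OF D.inv_closed[OF \<psi>(1)] xc q(1)] eq[OF D.inv_closed[OF \<psi>(1)]]
        hparts_ract_scal[OF xc char_closed[OF \<psi>(1) s(2)] q(1)] \<psi>(1) by simp
    then show ?thesis
      using ract_scal_eq_zero[OF MX.right_module_axioms GX.hparts_closed[OF xc q(1)]
          char_closed[OF \<psi>(1) sq] char_closed[OF \<psi>(1) s(2)] \<psi>(2)] by simp
  qed (use xz q in simp)
  then have "hparts G X x q = hparts G X (hparts G X x p) q" if "q \<in> carrier G" for q
    using that by (simp add: GX.hparts_homogeneous[OF p GX.hparts_grade[OF xc p]])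
  then have "x = hparts G X x p"
    by (rule GX.hparts_eqI[OF xc GX.hparts_closed[OF xc p]])
  then show "x \<in> grade X p" using GX.hparts_grade[OF xc p] by simp
qed

end

section \<open>The grading of an equivariant module by eigenspaces\<close>

text \<open>All fields but the grading are those of \<open>X\<close>, so that forgetting the second
  degree can give back the record \<open>X\<close> itself.\<close>

definition (in refinement_setup) eigengraded ::
    "('b, 'm, 'h) graded \<Rightarrow> (('a \<Rightarrow> 'k) \<Rightarrow> 'm \<Rightarrow> 'm) \<Rightarrow> ('b, 'm, 'h \<times> 'a) graded" where
  "eigengraded X \<alpha> = \<lparr>carrier = carrier X, mult = mult X, one = one X, zero = zero X, add = add X,
     smult = smult X,
     grade = (\<lambda>p\<in>carrier G. {x \<in> grade X (fst p).
       \<forall>\<chi>\<in>characters. \<alpha> \<chi> x = ract X x (scal (cinv \<chi> (snd p)))})\<rparr>"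

locale equivariant_module = refinement_setup K A H R Rb
  for K :: "('k, 'w) ring_scheme" (structure) and A :: "('a, 'z) monoid_scheme"
    and H :: "('h, 'y) monoid_scheme" and R :: "('k, 'b, 'h) graded" and Rb :: "('k, 'b, 'h \<times> 'a) graded" +
  fixes X :: "('b, 'm, 'h) graded" and \<alpha> :: "('a \<Rightarrow> 'k) \<Rightarrow> 'm \<Rightarrow> 'm"
  assumes obj: "(X, \<alpha>) \<in> Obj EC"
begin

lemma graded_X: "graded_module H R X"
  using obj by (simp add: Obj_EC)

sublocale GX: graded_group H X by (rule graded_module_graded_group[OF graded_X])

sublocale MX: right_module Rb X
  using graded_module_right_module[OF graded_X] right_module_R by blast

lemma grade_ract: "\<lbrakk>g \<in> carrier H; h \<in> carrier H; x \<in> grade X g; r \<in> grade R h\<rbrakk> \<Longrightarrow>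
    ract X x r \<in> grade X (g \<otimes>\<^bsub>H\<^esub> h)"
  by (rule graded_module.grade_ract[OF graded_X])

lemma ract_scal_grade:
  assumes "h \<in> carrier H" "x \<in> grade X h" "t \<in> carrier K"
  shows "ract X x (scal t) \<in> grade X h"
  using grade_ract[OF assms(1) H.one_closed assms(2)] grade_R[OF RG.G.one_closed scal_grade[OF assms(3)]]
    assms(1) by simp

lemma alpha_closed: "\<chi> \<in> characters \<Longrightarrow> x \<in> carrier X \<Longrightarrow> \<alpha> \<chi> x \<in> carrier X"
  using equivariant_hom(1)[OF obj] by blast

lemma alpha_extensional: "\<chi> \<in> characters \<Longrightarrow> \<alpha> \<chi> \<in> extensional (carrier X)"
  using equivariant_hom(1)[OF obj, of \<chi>] by (simp add: PiE_iff)

lemma alpha_add: "\<chi> \<in> characters \<Longrightarrow> x \<in> carrier X \<Longrightarrow> y \<in> carrier X \<Longrightarrow>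
    \<alpha> \<chi> (x \<oplus>\<^bsub>X\<^esub> y) = \<alpha> \<chi> x \<oplus>\<^bsub>X\<^esub> \<alpha> \<chi> y"
  by (rule equivariant_hom(2)[OF obj])

lemma alpha_ract: "\<chi> \<in> characters \<Longrightarrow> x \<in> carrier X \<Longrightarrow> r \<in> carrier Rb \<Longrightarrow>
    \<alpha> \<chi> (ract X x r) = ract X (\<alpha> \<chi> x) (char_act H A Rb (cinv \<chi>) r)"
  by (rule equivariant_hom(3)[OF obj])

lemma alpha_scal: "\<chi> \<in> characters \<Longrightarrow> x \<in> carrier X \<Longrightarrow> t \<in> carrier K \<Longrightarrow>
    \<alpha> \<chi> (ract X x (scal t)) = ract X (\<alpha> \<chi> x) (scal t)"
  by (simp add: alpha_ract char_act_scal)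

lemma alpha_grade: "\<chi> \<in> characters \<Longrightarrow> h \<in> carrier H \<Longrightarrow> x \<in> grade X h \<Longrightarrow> \<alpha> \<chi> x \<in> grade X h"
  by (rule equivariant_hom(4)[OF obj])

lemma alpha_mult: "\<chi> \<in> characters \<Longrightarrow> \<psi> \<in> characters \<Longrightarrow> x \<in> carrier X \<Longrightarrow>
    \<alpha> (\<chi> \<star> \<psi>) x = \<alpha> \<psi> (\<alpha> \<chi> x)"
  using obj by (simp add: Obj_EC compose_eq)

text \<open>The cocycle condition makes the map of the trivial character idempotent, and it is
  injective, being an isomorphism.\<close>

lemma alpha_one:
  assumes "x \<in> carrier X"
  shows "\<alpha> char_unit x = x"
proof -
  have "\<alpha> char_unit (\<alpha> char_unit x) = \<alpha> char_unit x"
    using alpha_mult[OF D.one_closed D.one_closed assms] by simp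
  then show ?thesis
    using inj_onD[OF equivariant_hom(5)[OF obj D.one_closed]] alpha_closed[OF D.one_closed assms] assms
    by blast
qed

lemma alpha_zero: "\<chi> \<in> characters \<Longrightarrow> \<alpha> \<chi> \<zero>\<^bsub>X\<^esub> = \<zero>\<^bsub>X\<^esub>"
  using alpha_scal[of \<chi> "\<zero>\<^bsub>X\<^esub>" "\<zero>"] alpha_closed[of \<chi> "\<zero>\<^bsub>X\<^esub>"]
  by (simp add: scal_zero MX.ract_zero_right)

lemma alpha_finsum:
  assumes "\<chi> \<in> characters" "\<And>i. i \<in> I \<Longrightarrow> c i \<in> carrier X"
  shows "\<alpha> \<chi> (\<Oplus>\<^bsub>X\<^esub>i\<in>I. c i) = (\<Oplus>\<^bsub>X\<^esub>i\<in>I. \<alpha> \<chi> (c i))"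
  using assms(2)
proof (induction I rule: infinite_finite_induct)
  case (insert i I)
  moreover from insert.prems have "c \<in> I \<rightarrow> carrier X" "c i \<in> carrier X"
    "(\<lambda>i. \<alpha> \<chi> (c i)) \<in> I \<rightarrow> carrier X" "\<alpha> \<chi> (c i) \<in> carrier X"
    using alpha_closed[OF assms(1)] by auto
  ultimately show ?case using assms(1) by (simp add: alpha_add)
qed (use assms(1) in \<open>auto simp: alpha_zero\<close>)

definition coef :: 'k where
  "coef = inv (\<Oplus>a\<in>carrier A. \<one>)"

text \<open>The factor is \<open>\<chi> a\<close> and not its inverse: on the eigenspace of degree
  \<open>a\<close> the map \<open>\<alpha> \<chi>\<close> multiplies by the inverse of
  \<open>\<chi> a\<close>, so all summands agree there.\<close>

definition eproj :: "'a \<Rightarrow> 'm \<Rightarrow> 'm" where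
  "eproj a x = (\<Oplus>\<^bsub>X\<^esub>\<chi>\<in>characters. ract X (\<alpha> \<chi> x) (scal (coef \<otimes> \<chi> a)))"

lemma coef: "coef \<in> carrier K" "coef \<otimes> (\<Oplus>a\<in>carrier A. \<one>) = \<one>"
proof -
  have "(\<Oplus>a\<in>carrier A. \<one>) \<in> Units K"
    using card_nonzero by (auto simp: K.field_Units intro!: K.finsum_closed)
  then show "coef \<in> carrier K" "coef \<otimes> (\<Oplus>a\<in>carrier A. \<one>) = \<one>"
    by (simp_all add: coef_def)
qed

lemma eproj_term: "a \<in> carrier A \<Longrightarrow> x \<in> carrier X \<Longrightarrow> \<chi> \<in> characters \<Longrightarrow>
    ract X (\<alpha> \<chi> x) (scal (coef \<otimes> \<chi> a)) \<in> carrier X"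
  by (simp add: MX.ract_closed alpha_closed coef char_closed)

lemma eproj_closed: "a \<in> carrier A \<Longrightarrow> x \<in> carrier X \<Longrightarrow> eproj a x \<in> carrier X"
  unfolding eproj_def using eproj_term by (intro GX.finsum_closed) auto

lemma eproj_grade:
  "a \<in> carrier A \<Longrightarrow> h \<in> carrier H \<Longrightarrow> x \<in> grade X h \<Longrightarrow> eproj a x \<in> grade X h"
  unfolding eproj_def
  by (intro GX.grade_finsum ract_scal_grade alpha_grade) (auto simp: coef char_closed)

lemma eproj_zero: "a \<in> carrier A \<Longrightarrow> eproj a \<zero>\<^bsub>X\<^esub> = \<zero>\<^bsub>X\<^esub>"
  unfolding eproj_def
  by (subst GX.finsum_cong'[where g = "\<lambda>_. \<zero>\<^bsub>X\<^esub>" and B = characters])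
    (auto simp: alpha_zero MX.ract_zero_left coef char_closed)

lemma eproj_add:
  assumes "a \<in> carrier A" "x \<in> carrier X" "y \<in> carrier X"
  shows "eproj a (x \<oplus>\<^bsub>X\<^esub> y) = eproj a x \<oplus>\<^bsub>X\<^esub> eproj a y"
proof -
  have "eproj a (x \<oplus>\<^bsub>X\<^esub> y) = (\<Oplus>\<^bsub>X\<^esub>\<chi>\<in>characters. ract X (\<alpha> \<chi> x) (scal (coef \<otimes> \<chi> a))
      \<oplus>\<^bsub>X\<^esub> ract X (\<alpha> \<chi> y) (scal (coef \<otimes> \<chi> a)))"
    unfolding eproj_def using assms
    by (intro GX.finsum_cong')
      (auto simp: alpha_add MX.ract_add_left alpha_closed coef char_closed MX.ract_closed)
  also have "\<dots> = eproj a x \<oplus>\<^bsub>X\<^esub> eproj a y"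
    unfolding eproj_def using assms eproj_term by (intro GX.finsum_addf) auto
  finally show ?thesis .
qed

text \<open>Applying \<open>\<alpha> \<psi>\<close> replaces \<open>\<alpha> \<chi>\<close> by
  \<open>\<alpha> (\<chi> \<star> \<psi>)\<close>. Summing over \<open>\<chi> \<star> \<psi>\<close>
  instead of \<open>\<chi>\<close> turns the coefficient \<open>\<chi>(a)\<close> into
  \<open>\<chi>(a) \<psi>^-1(a)\<close>, and the second factor comes out of the sum.\<close>

lemma alpha_eproj:
  assumes a: "a \<in> carrier A" and x: "x \<in> carrier X" and \<psi>: "\<psi> \<in> characters"
  shows "\<alpha> \<psi> (eproj a x) = ract X (eproj a x) (scal (cinv \<psi> a))"
proof -
  have ia: "cinv \<psi> a \<in> carrier K" by (rule char_closed[OF D.inv_closed[OF \<psi>] a])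
  have bij: "bij_betw (\<lambda>\<chi>. \<chi> \<star> \<psi>) characters characters"
    using \<psi> by (intro bij_betw_byWitness[where f' = "\<lambda>\<chi>. \<chi> \<star> cinv \<psi>"])
      (auto simp: D.m_assoc)
  \<comment> \<open>The summand as a function of the new variable
    \<open>\<chi> \<star> \<psi>\<close>; the factor \<open>cinv \<psi> a\<close> compensates for
    the value of \<open>\<psi>\<close> contained in it.\<close>
  let ?f = "\<lambda>\<chi>. ract X (\<alpha> \<chi> x) (scal (coef \<otimes> \<chi> a \<otimes> cinv \<psi> a))"
  have fc: "?f \<chi> \<in> carrier X" if "\<chi> \<in> characters" for \<chi>
    using that a x ia by (simp add: MX.ract_closed alpha_closed coef char_closed)
  have coe: "coef \<otimes> (\<chi> \<star> \<psi>) a \<otimes> cinv \<psi> a = coef \<otimes> \<chi> a"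
    if \<chi>: "\<chi> \<in> characters" for \<chi>
  proof -
    have "coef \<otimes> (\<chi> a \<otimes> \<psi> a) \<otimes> cinv \<psi> a = coef \<otimes> \<chi> a \<otimes> (\<psi> a \<otimes> cinv \<psi> a)"
      using ia coef(1) char_closed[OF \<chi> a] char_closed[OF \<psi> a] by (simp add: K.m_assoc)
    then show ?thesis
      using a coef(1) char_closed[OF \<chi> a] inv_char_mult(2)[OF \<psi> a] by (simp add: char_group_mult)
  qed
  have "\<alpha> \<psi> (eproj a x) = (\<Oplus>\<^bsub>X\<^esub>\<chi>\<in>characters. \<alpha> \<psi> (ract X (\<alpha> \<chi> x) (scal (coef \<otimes> \<chi> a))))"
    unfolding eproj_def using a x eproj_term by (intro alpha_finsum[OF \<psi>])
  also have "\<dots> = (\<Oplus>\<^bsub>X\<^esub>\<chi>\<in>characters. ?f (\<chi> \<star> \<psi>))"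
  proof (rule GX.finsum_cong')
    show "(\<lambda>\<chi>. ?f (\<chi> \<star> \<psi>)) \<in> characters \<rightarrow> carrier X"
      using fc \<psi> by auto
    show "\<alpha> \<psi> (ract X (\<alpha> \<chi> x) (scal (coef \<otimes> \<chi> a))) = ?f (\<chi> \<star> \<psi>)"
      if \<chi>: "\<chi> \<in> characters" for \<chi>
      unfolding coe[OF \<chi>] alpha_mult[OF \<chi> \<psi> x]
      using \<chi> \<psi> x a by (intro alpha_scal) (auto simp: alpha_closed coef char_closed)
  qed simp
  also have "\<dots> = (\<Oplus>\<^bsub>X\<^esub>\<chi>\<in>(\<lambda>\<chi>. \<chi> \<star> \<psi>) ` characters. ?f \<chi>)"
    using fc \<psi> bij_betw_imp_inj_on[OF bij] by (intro GX.finsum_reindex[symmetric]) auto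
  also have "\<dots> = (\<Oplus>\<^bsub>X\<^esub>\<chi>\<in>characters. ?f \<chi>)"
    unfolding bij_betw_imp_surj_on[OF bij] by (rule refl)
  also have "\<dots> = (\<Oplus>\<^bsub>X\<^esub>\<chi>\<in>characters. ract X (ract X (\<alpha> \<chi> x) (scal (coef \<otimes> \<chi> a))) (scal (cinv \<psi> a)))"
  proof (rule GX.finsum_cong')
    show "?f \<chi> = ract X (ract X (\<alpha> \<chi> x) (scal (coef \<otimes> \<chi> a))) (scal (cinv \<psi> a))"
      if \<chi>: "\<chi> \<in> characters" for \<chi>
      using \<chi> x a ia coef(1) by (intro ract_scal_mult[OF MX.right_module_axioms, symmetric])
        (auto simp: alpha_closed char_closed)
  qed (use eproj_term[OF a x] ia in \<open>auto intro: MX.ract_closed\<close>)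
  also have "\<dots> = ract X (eproj a x) (scal (cinv \<psi> a))"
    unfolding eproj_def using eproj_term[OF a x] ia by (intro MX.ract_finsum_left[symmetric]) auto
  finally show ?thesis .
qed

text \<open>After exchanging the sums, the coefficient of \<open>\<alpha> \<chi>\<close> is
  \<open>coef\<close> times the sum of \<open>\<chi>\<close> over \<open>A\<close>. By orthogonality
  only the trivial character survives, with coefficient \<open>\<one>\<close>, and its map is the
  identity.\<close>

lemma sum_eproj:
  assumes "x \<in> carrier X"
  shows "(\<Oplus>\<^bsub>X\<^esub>a\<in>carrier A. eproj a x) = x"
proof -
  have "(\<Oplus>\<^bsub>X\<^esub>a\<in>carrier A. eproj a x)
      = (\<Oplus>\<^bsub>X\<^esub>\<chi>\<in>characters. \<Oplus>\<^bsub>X\<^esub>a\<in>carrier A. ract X (\<alpha> \<chi> x) (scal (coef \<otimes> \<chi> a)))"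
    unfolding eproj_def using finite_A assms by (intro GX.finsum_swap eproj_term)
  also have "\<dots> = (\<Oplus>\<^bsub>X\<^esub>\<chi>\<in>characters. if char_unit = \<chi> then \<alpha> \<chi> x else \<zero>\<^bsub>X\<^esub>)"
  proof (rule GX.finsum_cong')
    fix \<chi> assume \<chi>: "\<chi> \<in> characters"
    have c: "\<chi> a \<in> carrier K" if "a \<in> carrier A" for a by (rule char_closed[OF \<chi> that])
    have "(\<Oplus>\<^bsub>X\<^esub>a\<in>carrier A. ract X (\<alpha> \<chi> x) (scal (coef \<otimes> \<chi> a)))
        = ract X (\<alpha> \<chi> x) (\<Oplus>\<^bsub>Rb\<^esub>a\<in>carrier A. scal (coef \<otimes> \<chi> a))"
      using c coef(1) alpha_closed[OF \<chi> assms] by (intro MX.ract_finsum_right[symmetric]) auto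
    also have "(\<Oplus>\<^bsub>Rb\<^esub>a\<in>carrier A. scal (coef \<otimes> \<chi> a)) = scal (\<Oplus>a\<in>carrier A. coef \<otimes> \<chi> a)"
      using c coef(1) by (intro scal_finsum[symmetric]) auto
    also have "(\<Oplus>a\<in>carrier A. coef \<otimes> \<chi> a) = coef \<otimes> (\<Oplus>a\<in>carrier A. \<chi> a)"
      using c coef(1) finite_A by (intro K.finsum_rdistr[symmetric]) auto
    finally show "(\<Oplus>\<^bsub>X\<^esub>a\<in>carrier A. ract X (\<alpha> \<chi> x) (scal (coef \<otimes> \<chi> a)))
        = (if char_unit = \<chi> then \<alpha> \<chi> x else \<zero>\<^bsub>X\<^esub>)"
      using coef alpha_closed[OF \<chi> assms]
      by (auto simp: char_sum[OF \<chi>] scal_one scal_zero MX.ract_one MX.ract_zero_right)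
  qed (use assms alpha_closed in auto)
  also have "\<dots> = \<alpha> char_unit x"
    using assms alpha_closed finite_characters by (intro GX.finsum_singleton) auto
  finally show ?thesis using alpha_one[OF assms] by simp
qed

abbreviation Eig :: "('b, 'm, 'h \<times> 'a) graded" where
  "Eig \<equiv> eigengraded X \<alpha>"

lemma Eig_simps:
  "carrier Eig = carrier X" "\<zero>\<^bsub>Eig\<^esub> = \<zero>\<^bsub>X\<^esub>" "add Eig = add X" "smult Eig = smult X"
  "mult Eig = mult X" "one Eig = one X"
  by (simp_all add: eigengraded_def)

lemma grade_Eig: "p \<in> carrier G \<Longrightarrow> x \<in> grade Eig p \<longleftrightarrow>
    x \<in> grade X (fst p) \<and> (\<forall>\<chi>\<in>characters. \<alpha> \<chi> x = ract X x (scal (cinv \<chi> (snd p))))"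
  by (simp add: eigengraded_def)

lemma same_module_Eig: "same_module X Eig"
  by (simp add: same_module_def Eig_simps)

lemma grade_Eig_carrier: "p \<in> carrier G \<Longrightarrow> x \<in> grade Eig p \<Longrightarrow> x \<in> carrier X"
  using GX.grade_carrier by (auto simp: grade_Eig carrier_G)

lemma eproj_Eig: "h \<in> carrier H \<Longrightarrow> a \<in> carrier A \<Longrightarrow> x \<in> grade X h \<Longrightarrow> eproj a x \<in> grade Eig (h, a)"
  using GX.grade_carrier[of h x] by (simp add: grade_Eig carrier_G eproj_grade alpha_eproj)

text \<open>Dual orthogonality kills \<open>x\<close> in every wrong degree. As the maps
  \<open>eproj b\<close> add up to the identity, the one for the right degree must fix
  \<open>x\<close>.\<close>

lemma eproj_eigenvector:
  assumes p: "p \<in> carrier G" and x: "x \<in> grade Eig p" and a: "a \<in> carrier A"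
  shows "eproj a x = (if a = snd p then x else \<zero>\<^bsub>X\<^esub>)"
proof -
  have xc: "x \<in> carrier X" by (rule grade_Eig_carrier[OF p x])
  have s: "snd p \<in> carrier A" using p by (simp add: carrier_G)
  have eig: "\<alpha> \<chi> x = ract X x (scal (cinv \<chi> (snd p)))" if "\<chi> \<in> characters" for \<chi>
    using x p that by (simp add: grade_Eig)
  \<comment> \<open>On the eigenvector \<open>x\<close> each \<open>\<alpha> \<chi>\<close> is a
    scalar, so \<open>eproj b x\<close> is \<open>x\<close> times a sum over the characters, which
    vanishes by \<open>char_sum_dual\<close>.\<close>
  have ne: "eproj b x = \<zero>\<^bsub>X\<^esub>" if b: "b \<in> carrier A" "b \<noteq> snd p" for b
  proof -
    let ?c = "\<lambda>\<chi>. \<chi> b \<otimes> cinv \<chi> (snd p)"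
    have c: "?c \<chi> \<in> carrier K" if "\<chi> \<in> characters" for \<chi>
      using that b s char_closed by simp
    have "eproj b x = (\<Oplus>\<^bsub>X\<^esub>\<chi>\<in>characters. ract X x (scal (coef \<otimes> ?c \<chi>)))"
      unfolding eproj_def
    proof (rule GX.finsum_cong')
      fix \<chi> assume \<chi>: "\<chi> \<in> characters"
      have k: "cinv \<chi> (snd p) \<in> carrier K" "\<chi> b \<in> carrier K"
        using \<chi> b s char_closed by simp_all
      have "ract X (\<alpha> \<chi> x) (scal (coef \<otimes> \<chi> b))
          = ract X x (scal (cinv \<chi> (snd p) \<otimes> (coef \<otimes> \<chi> b)))"
        unfolding eig[OF \<chi>] using k coef(1) xc by (intro ract_scal_mult[OF MX.right_module_axioms]) auto
      also have "cinv \<chi> (snd p) \<otimes> (coef \<otimes> \<chi> b) = coef \<otimes> ?c \<chi>"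
        using k coef(1) by (simp add: K.m_ac)
      finally show "ract X (\<alpha> \<chi> x) (scal (coef \<otimes> \<chi> b)) = ract X x (scal (coef \<otimes> ?c \<chi>))" .
    qed (use c coef(1) xc in \<open>auto intro!: MX.ract_closed\<close>)
    also have "\<dots> = ract X x (\<Oplus>\<^bsub>Rb\<^esub>\<chi>\<in>characters. scal (coef \<otimes> ?c \<chi>))"
      using c coef(1) xc by (intro MX.ract_finsum_right[symmetric]) auto
    also have "\<dots> = ract X x (scal (\<Oplus>\<chi>\<in>characters. coef \<otimes> ?c \<chi>))"
      using c coef(1) by (subst scal_finsum) auto
    also have "(\<Oplus>\<chi>\<in>characters. coef \<otimes> ?c \<chi>) = coef \<otimes> (\<Oplus>\<chi>\<in>characters. ?c \<chi>)"
      using c coef(1) finite_characters by (intro K.finsum_rdistr[symmetric]) auto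
    also have "\<dots> = \<zero>" using char_sum_dual[OF b(1) s b(2)] coef(1) by simp
    finally show ?thesis using xc by (simp add: scal_zero MX.ract_zero_right)
  qed
  have "x = (\<Oplus>\<^bsub>X\<^esub>b\<in>carrier A. eproj b x)" using sum_eproj[OF xc] by simp
  also have "\<dots> = (\<Oplus>\<^bsub>X\<^esub>b\<in>carrier A. if snd p = b then eproj b x else \<zero>\<^bsub>X\<^esub>)"
    using ne s xc eproj_closed by (intro GX.finsum_cong') auto
  also have "\<dots> = eproj (snd p) x"
    using s xc eproj_closed finite_A by (intro GX.finsum_singleton) auto
  finally show ?thesis using ne[OF a] by auto
qed

text \<open>The projection to \<open>(h, a)\<close> takes the component of degree \<open>h\<close>
  and then applies \<open>eproj a\<close>; an element of degree \<open>h\<close> is the sum of its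
  images under all \<open>eproj a\<close>.\<close>

lemma is_grading_Eig: "is_grading G Eig"
proof (rule is_gradingI[where proj = "\<lambda>p x. eproj (snd p) (hparts H X x (fst p))"])
  show ag: "abelian_group Eig"
    using same_module_abelian_group[OF same_module_Eig] GX.abelian_group_axioms by blast
  show "grade Eig \<in> extensional (carrier G)" by (simp add: eigengraded_def)
  show "grade Eig p \<subseteq> carrier Eig" if "p \<in> carrier G" for p
    using grade_Eig_carrier[OF that] by (auto simp: Eig_simps)
  show "eproj (snd p) (hparts H X x (fst p)) \<in> grade Eig p" if "p \<in> carrier G" "x \<in> carrier Eig" for p x
    using that eproj_Eig[of "fst p" "snd p"] by (simp add: carrier_G Eig_simps GX.hparts_grade)
  show "carrier Eig \<subseteq> grade_span G Eig"
  proof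
    fix x assume "x \<in> carrier Eig"
    then have "x \<in> carrier X" by (simp add: Eig_simps)
    then show "x \<in> grade_span G Eig"
    proof (induction x rule: GX.homogeneous_induct)
      case zero
      show ?case using grade_span.zero[of Eig G] by (simp add: Eig_simps)
    next
      case (add x y)
      then show ?case using grade_span.add[of x G Eig y] by (simp add: Eig_simps)
    next
      case (homogeneous h x)
      then have xc: "x \<in> carrier X" using GX.grade_carrier by blast
      have "finsum Eig (\<lambda>a. eproj a x) (carrier A) \<in> grade_span G Eig"
        using homogeneous xc eproj_Eig
        by (intro grade_span_finsum[OF ag finite_A])
          (auto simp: Eig_simps eproj_closed intro!: grade_span.homogeneous[of "(h, _)"] simp: carrier_G)
      then show ?case
        by (simp add: same_module_finsum[OF same_module_Eig] sum_eproj[OF xc])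
    qed
  qed
  show "eproj (snd p) (hparts H X (x \<oplus>\<^bsub>Eig\<^esub> y) (fst p))
      = eproj (snd p) (hparts H X x (fst p)) \<oplus>\<^bsub>Eig\<^esub> eproj (snd p) (hparts H X y (fst p))"
    if "p \<in> carrier G" "x \<in> carrier Eig" "y \<in> carrier Eig" for p x y
    using that by (simp add: Eig_simps carrier_G GX.hparts_add eproj_add GX.hparts_closed)
  show "eproj (snd p) (hparts H X x (fst p)) = (if p = q then x else \<zero>\<^bsub>Eig\<^esub>)"
    if p: "p \<in> carrier G" and q: "q \<in> carrier G" and x: "x \<in> grade Eig q" for p q x
  proof -
    have "x \<in> grade X (fst q)" using x q by (simp add: grade_Eig)
    then have "hparts H X x (fst p) = (if fst p = fst q then x else \<zero>\<^bsub>X\<^esub>)"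
      using p q by (simp add: GX.hparts_homogeneous carrier_G)
    then show ?thesis
      using p eproj_eigenvector[OF q x, of "snd p"] by (auto simp: Eig_simps eproj_zero carrier_G prod_eq_iff)
  qed
qed

text \<open>By semilinearity, \<open>\<alpha> \<chi>\<close> maps \<open>x r\<close> to the product
  of its value at \<open>x\<close> with \<open>\<chi>^-1.r\<close>. Both factors are multiples by
  values of \<open>\<chi>^-1\<close>, and these multiply to its value at the product of the second
  degrees.\<close>

lemma graded_module_Eig: "graded_module G Rb Eig"
proof -
  interpret X: graded_module H R X by (rule graded_X)
  interpret Eig: abelian_group Eig
    using same_module_abelian_group[OF same_module_Eig] GX.abelian_group_axioms by blast
  show ?thesis
  proof unfold_locales
    show "is_grading G Eig" by (rule is_grading_Eig)
    show "mult Eig = undefined" "one Eig = undefined"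
      using X.mult_irrelevant X.one_irrelevant by (simp_all add: Eig_simps)
    show "add Eig = (\<lambda>x\<in>carrier Eig. \<lambda>y\<in>carrier Eig. x \<oplus>\<^bsub>Eig\<^esub> y)"
      using X.add_ext by (simp add: Eig_simps)
    show "smult Eig = (\<lambda>r\<in>carrier Rb. \<lambda>x\<in>carrier Eig. r \<odot>\<^bsub>Eig\<^esub> x)"
      using X.smult_ext by (simp add: Eig_simps)
    fix p q x r assume pq: "p \<in> carrier G" "q \<in> carrier G" and x: "x \<in> grade Eig p" and r: "r \<in> grade Rb q"
    have xc: "x \<in> carrier X" by (rule grade_Eig_carrier[OF pq(1) x])
    have rc: "r \<in> carrier Rb" by (rule RG.gr.grade_carrier[OF pq(2) r])
    have s: "fst p \<in> carrier H" "snd p \<in> carrier A" "fst q \<in> carrier H" "snd q \<in> carrier A"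
      using pq by (auto simp: carrier_G)
    have m: "fst (p \<otimes>\<^bsub>G\<^esub> q) = fst p \<otimes>\<^bsub>H\<^esub> fst q" "snd (p \<otimes>\<^bsub>G\<^esub> q) = snd p \<otimes>\<^bsub>A\<^esub> snd q"
      by (auto simp: DirProd_def split: prod.splits)
    have "ract X x r \<in> grade X (fst (p \<otimes>\<^bsub>G\<^esub> q))"
      unfolding m using grade_ract[OF s(1,3) _ grade_R[OF pq(2) r], of x] x pq by (simp add: grade_Eig)
    moreover have "\<alpha> \<chi> (ract X x r) = ract X (ract X x r) (scal (cinv \<chi> (snd (p \<otimes>\<^bsub>G\<^esub> q))))"
      if \<chi>: "\<chi> \<in> characters" for \<chi>
    proof -
      note ci = D.inv_closed[OF \<chi>]
      note c = char_closed[OF ci s(2)] char_closed[OF ci s(4)]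
      have "\<alpha> \<chi> (ract X x r) = ract X (ract X x (scal (cinv \<chi> (snd p)))) (cinv \<chi> (snd q) \<odot>\<^bsub>Rb\<^esub> r)"
        using alpha_ract[OF \<chi> xc rc] char_act_homogeneous[OF ci pq(2) r] x pq \<chi> by (simp add: grade_Eig)
      also have "\<dots> = ract X (ract X (ract X x (scal (cinv \<chi> (snd p)))) r) (scal (cinv \<chi> (snd q)))"
        by (rule ract_smult[OF MX.right_module_axioms MX.ract_closed[OF xc scal_closed[OF c(1)]] c(2) rc])
      also have "\<dots> = ract X (ract X (ract X x r) (scal (cinv \<chi> (snd p)))) (scal (cinv \<chi> (snd q)))"
        by (simp only: ract_scal_commute[OF MX.right_module_axioms xc c(1) rc])
      also have "\<dots> = ract X (ract X x r) (scal (cinv \<chi> (snd (p \<otimes>\<^bsub>G\<^esub> q))))"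
        unfolding m char_mult[OF ci s(2,4)]
        by (rule ract_scal_mult[OF MX.right_module_axioms MX.ract_closed[OF xc rc] c])
      finally show ?thesis .
    qed
    ultimately show "ract Eig x r \<in> grade Eig (p \<otimes>\<^bsub>G\<^esub> q)"
      using RG.G.m_closed[OF pq] by (simp add: grade_Eig Eig_simps)
  qed (simp_all add: Eig_simps MX.ract_closed MX.ract_add_left MX.ract_add_right MX.ract_mult MX.ract_one)
qed

text \<open>Eigenvectors of degrees over \<open>h\<close> lie in \<open>X\<close> of degree
  \<open>h\<close> and span it, which restores the grading. The maps \<open>gam\<close> and
  \<open>\<alpha>\<close> agree on eigenvectors by the definition of the new components, hence
  everywhere.\<close>

lemma Gamma_Eig: "fobj (Gamma K H A Rb) Eig = (X, \<alpha>)"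
proof -
  interpret E: refinement_module K A H R Rb Eig
    by (intro refinement_module.intro refinement_setup_axioms refinement_module_axioms.intro graded_module_Eig)
  have "grade E.PX.PX = grade X"
  proof (rule extensionalityI[of _ "carrier H"])
    show "grade E.PX.PX \<in> extensional (carrier H)" by (simp add: pushforward_def)
    show "grade X \<in> extensional (carrier H)" by (rule GX.grade_extensional)
    fix h assume h: "h \<in> carrier H"
    show "grade E.PX.PX h = grade X h"
    proof
      show "grade E.PX.PX h \<subseteq> grade X h"
      proof
        fix x assume "x \<in> grade E.PX.PX h"
        then obtain S c where S: "S \<subseteq> {p \<in> carrier G. fst p = h}" "\<And>p. p \<in> S \<Longrightarrow> c p \<in> grade Eig p"
          "x = finsum Eig c S"
          using h by (auto simp: pushforward_def Pi_iff)
        have "c p \<in> grade X h" if "p \<in> S" for p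
          using S(1) S(2)[OF that] that by (auto simp: grade_Eig)
        then show "x \<in> grade X h"
          unfolding S(3) same_module_finsum[OF same_module_Eig] by (intro GX.grade_finsum h)
      qed
      show "grade X h \<subseteq> grade E.PX.PX h"
      proof
        fix x assume x: "x \<in> grade X h"
        have xc: "x \<in> carrier X" by (rule GX.grade_carrier[OF h x])
        have "eproj a x \<in> grade E.PX.PX h" if "a \<in> carrier A" for a
          using E.PX.grade_pushforward_homogeneous[of "(h, a)" "eproj a x"] eproj_Eig[OF h that x] h that
          by (simp add: carrier_G)
        then have "finsum E.PX.PX (\<lambda>a. eproj a x) (carrier A) \<in> grade E.PX.PX h"
          by (intro E.PX.P.grade_finsum h)
        then show "x \<in> grade E.PX.PX h"
          by (simp add: same_module_finsum[OF same_module_pushforward] same_module_finsum[OF same_module_Eig]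
            sum_eproj[OF xc])
      qed
    qed
  qed
  then have "E.PX.PX = X"
    by (intro graded.equality) (simp_all add: Eig_simps, simp_all add: pushforward_def Eig_simps)
  moreover have "(\<lambda>\<chi>\<in>characters. E.gam \<chi>) = \<alpha>"
  proof (rule extensionalityI[of _ characters])
    show "\<alpha> \<in> extensional characters" using obj by (simp add: Obj_EC)
    fix \<chi> assume \<chi>: "\<chi> \<in> characters"
    have "E.gam \<chi> = \<alpha> \<chi>"
    proof (rule extensionalityI[of _ "carrier X"])
      show "E.gam \<chi> \<in> extensional (carrier X)" using E.gamma_extensional by (simp add: Eig_simps)
      show "\<alpha> \<chi> \<in> extensional (carrier X)" by (rule alpha_extensional[OF \<chi>])
      fix x assume "x \<in> carrier X"
      then have "x \<in> carrier Eig" by (simp add: Eig_simps)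
      then show "E.gam \<chi> x = \<alpha> \<chi> x"
      proof (induction x rule: E.GX.homogeneous_induct)
        case zero
        show ?case using E.gamma_zero[OF \<chi>] alpha_zero[OF \<chi>] by (simp add: Eig_simps)
      next
        case (add x y)
        then show ?case using E.gamma_add[OF \<chi>, of x y] alpha_add[OF \<chi>, of x y] by (simp add: Eig_simps)
      next
        case (homogeneous p x)
        then show ?case using E.gamma_homogeneous[OF \<chi> homogeneous] \<chi> by (simp add: grade_Eig Eig_simps)
      qed
    qed
    then show "(\<lambda>\<chi>\<in>characters. E.gam \<chi>) \<chi> = \<alpha> \<chi>" using \<chi> by simp
  qed simp
  ultimately show ?thesis by (simp add: Gamma_def)
qed

end

section \<open>The inverse functor and the two isomorphisms of categories\<close>

context refinement_setup
begin

lemma refinement_moduleI: "graded_module G Rb X \<Longrightarrow> refinement_module K A H R Rb X"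
  by (intro refinement_module.intro refinement_setup_axioms refinement_module_axioms.intro)

lemma equivariant_moduleI: "(X, \<alpha>) \<in> Obj EC \<Longrightarrow> equivariant_module K A H R Rb X \<alpha>"
  by (intro equivariant_module.intro refinement_setup_axioms equivariant_module_axioms.intro)

text \<open>By \<open>grade_eigenspace\<close> the eigenspaces of the maps \<open>gamma\<close> are
  the original components.\<close>

lemma eigengraded_Gamma:
  assumes "graded_module G Rb X"
  shows "eigengraded (pushforward fst G H X) (\<lambda>\<chi>\<in>characters. gamma K H A Rb X \<chi>) = X"
proof -
  interpret X: refinement_module K A H R Rb X by (rule refinement_moduleI[OF assms])
  have "grade (eigengraded X.PX.PX (\<lambda>\<chi>\<in>characters. X.gam \<chi>)) = grade X"
  proof (rule extensionalityI[of _ "carrier G"])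
    show "grade X \<in> extensional (carrier G)" by (rule X.GX.grade_extensional)
    show "grade (eigengraded X.PX.PX (\<lambda>\<chi>\<in>characters. X.gam \<chi>)) p = grade X p" if "p \<in> carrier G" for p
      using that by (subst X.grade_eigenspace) (auto simp: eigengraded_def, simp_all add: pushforward_def)
  qed (simp add: eigengraded_def)
  then show ?thesis
    by (intro graded.equality) (simp_all, simp_all add: eigengraded_def pushforward_def)
qed

text \<open>A graded map commutes with taking components and with scalars, and the maps
  \<open>gamma\<close> are composed of these two operations.\<close>

lemma graded_hom_pushforward:
  assumes X: "graded_module G Rb X" and Y: "graded_module G Rb Y" and f: "f \<in> graded_hom G Rb X Y"
  shows "f \<in> Mor EC (fobj (Gamma K H A Rb) X) (fobj (Gamma K H A Rb) Y)"
proof -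
  interpret X: refinement_module K A H R Rb X by (rule refinement_moduleI[OF X])
  interpret Y: refinement_module K A H R Rb Y by (rule refinement_moduleI[OF Y])
  have P: "carrier (pushforward fst G H Z) = carrier Z" "add (pushforward fst G H Z) = add Z"
    "smult (pushforward fst G H Z) = smult Z" for Z :: "('b, 'n, 'h \<times> 'a) graded"
    by (simp_all add: pushforward_def)
  note fc = graded_hom_closed[OF f]
  have fa: "f (x \<oplus>\<^bsub>X\<^esub> y) = f x \<oplus>\<^bsub>Y\<^esub> f y" if "x \<in> carrier X" "y \<in> carrier X" for x y
    using f that by (auto simp: graded_hom_def)
  have fr: "f (ract X x r) = ract Y (f x) r" if "x \<in> carrier X" "r \<in> carrier Rb" for x r
    using f that by (auto simp: graded_hom_def)
  have f0: "f \<zero>\<^bsub>X\<^esub> = \<zero>\<^bsub>Y\<^esub>"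
    using X.MX.hom_zero[OF Y.MX.right_module_axioms graded_hom_rmod_hom[OF f]] .
  have "f x \<in> grade Y.PX.PX h" if h: "h \<in> carrier H" and x: "x \<in> grade X.PX.PX h" for h x
  proof -
    have xc: "x \<in> carrier X" and z: "\<And>p. p \<in> carrier G \<Longrightarrow> fst p \<noteq> h \<Longrightarrow> hparts G X x p = \<zero>\<^bsub>X\<^esub>"
      using x h by (auto simp: X.PX.grade_pushforward)
    have "hparts G Y (f x) p = \<zero>\<^bsub>Y\<^esub>" if "p \<in> carrier G" "fst p \<noteq> h" for p
      using graded_hom_hparts[OF X Y f xc that(1)] z[OF that] f0 by simp
    then show ?thesis using h fc[OF xc] by (simp add: Y.PX.grade_pushforward)
  qed
  then have "f \<in> graded_hom H R X.PX.PX Y.PX.PX"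
    using f unfolding graded_hom_def P by auto
  moreover have "Y.gam \<chi> (f x) = f (X.gam \<chi> x)" if \<chi>: "\<chi> \<in> characters" and x: "x \<in> carrier X" for \<chi> x
    using x
  proof (induction x rule: X.GX.homogeneous_induct)
    case zero
    show ?case by (simp add: f0 X.gamma_zero[OF \<chi>] Y.gamma_zero[OF \<chi>])
  next
    case (add x y)
    then show ?case
      by (simp add: fa fc X.gamma_add[OF \<chi>] Y.gamma_add[OF \<chi>] X.gamma_closed[OF \<chi>])
  next
    case (homogeneous p x)
    then show ?case
      using X.GX.grade_carrier[OF homogeneous] X.cinv_closed[OF \<chi>, of "snd p"]
      by (simp add: fr X.gamma_homogeneous[OF \<chi>] Y.gamma_homogeneous[OF \<chi>] graded_hom_grade[OF f] carrier_G)
  qed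
  ultimately show ?thesis
    by (simp add: Gamma_def Mor_EC P)
qed

text \<open>Scalars act through elements of the algebra, so an equivariant linear map carries an
  eigenvector equation to the corresponding one in \<open>Y\<close>.\<close>

lemma eigengraded_hom:
  assumes X: "(X, \<alpha>) \<in> Obj EC" and Y: "(Y, \<beta>) \<in> Obj EC" and f: "f \<in> Mor EC (X, \<alpha>) (Y, \<beta>)"
  shows "f \<in> graded_hom G Rb (eigengraded X \<alpha>) (eigengraded Y \<beta>)"
proof -
  interpret X: equivariant_module K A H R Rb X \<alpha> by (rule equivariant_moduleI[OF X])
  interpret Y: equivariant_module K A H R Rb Y \<beta> by (rule equivariant_moduleI[OF Y])
  have fh: "f \<in> graded_hom H R X Y" and eq: "\<And>\<chi> x. \<chi> \<in> characters \<Longrightarrow> x \<in> carrier X \<Longrightarrow> \<beta> \<chi> (f x) = f (\<alpha> \<chi> x)"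
    using f by (auto simp: Mor_EC)
  have "f x \<in> grade Y.Eig p" if p: "p \<in> carrier G" and x: "x \<in> grade X.Eig p" for p x
  proof -
    have xc: "x \<in> carrier X" by (rule X.grade_Eig_carrier[OF p x])
    have s: "fst p \<in> carrier H" "snd p \<in> carrier A" using p by (auto simp: carrier_G)
    have "x \<in> grade X (fst p)" using x p by (simp add: X.grade_Eig)
    then have "f x \<in> grade Y (fst p)" by (rule graded_hom_grade[OF fh s(1)])
    moreover have "\<beta> \<chi> (f x) = ract Y (f x) (scal (cinv \<chi> (snd p)))" if \<chi>: "\<chi> \<in> characters" for \<chi>
    proof -
      have "scal (cinv \<chi> (snd p)) \<in> carrier R"
        using char_closed[OF D.inv_closed[OF \<chi>] s(2)] by simp
      then have "f (ract X x (scal (cinv \<chi> (snd p)))) = ract Y (f x) (scal (cinv \<chi> (snd p)))"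
        using fh xc unfolding graded_hom_def by blast
      then show ?thesis using eq[OF \<chi> xc] x p \<chi> by (simp add: X.grade_Eig)
    qed
    ultimately show ?thesis using p by (simp add: Y.grade_Eig)
  qed
  then show ?thesis
    using fh unfolding graded_hom_def X.Eig_simps Y.Eig_simps by auto
qed

theorem Gamma_isomorphism:
  "cat_isomorphism (grMod G Rb :: (('b, 'm, 'h \<times> 'a) graded, 'm \<Rightarrow> 'm) cat) EC (Gamma K H A Rb)"
proof -
  let ?C = "grMod G Rb :: (('b, 'm, 'h \<times> 'a) graded, 'm \<Rightarrow> 'm) cat"
  let ?\<Gamma> = "Gamma K H A Rb :: (('b, 'm, 'h \<times> 'a) graded, 'm \<Rightarrow> 'm,
    ('b, 'm, 'h) graded \<times> (('a \<Rightarrow> 'k) \<Rightarrow> 'm \<Rightarrow> 'm), 'm \<Rightarrow> 'm) cfun"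
  let ?\<Delta> = "\<lparr>fobj = (\<lambda>(X, \<alpha>). eigengraded X \<alpha>), fmor = (\<lambda>X Y f. f)\<rparr> ::
    (('b, 'm, 'h) graded \<times> (('a \<Rightarrow> 'k) \<Rightarrow> 'm \<Rightarrow> 'm), 'm \<Rightarrow> 'm, ('b, 'm, 'h \<times> 'a) graded, 'm \<Rightarrow> 'm) cfun"
  have C: "Obj ?C = {X. graded_module G Rb X}" "Mor ?C = graded_hom G Rb"
    "Idt ?C X = (\<lambda>x\<in>carrier X. x)" "Cmp ?C X Y Z g f = compose (carrier X) g f" for X Y Z g f
    by (simp_all add: grMod_def)
  have fm: "fmor ?\<Gamma> = (\<lambda>X Y f. f)" by (simp add: Gamma_def)
  have fo: "fobj ?\<Gamma> X = (pushforward fst G H X, \<lambda>\<chi>\<in>characters. gamma K H A Rb X \<chi>)" for X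
    by (simp add: Gamma_def)
  have PC: "carrier (pushforward fst G H X) = carrier X" for X :: "('b, 'm, 'h \<times> 'a) graded"
    by (simp add: pushforward_def)
  have EC: "carrier (eigengraded X \<alpha>) = carrier X" for X :: "('b, 'm, 'h) graded" and \<alpha>
    by (simp add: eigengraded_def)
  have obj: "fobj ?\<Gamma> X \<in> Obj EC" if "graded_module G Rb X" for X
    by (rule refinement_module.Gamma_obj[OF refinement_moduleI[OF that]])
  have "is_functor ?C EC ?\<Gamma>"
    unfolding is_functor_def
  proof (intro conjI ballI)
    show "is_cat ?C" by (rule is_cat_grMod)
    show "is_cat (EC :: (('b, 'm, 'h) graded \<times> (('a \<Rightarrow> 'k) \<Rightarrow> 'm \<Rightarrow> 'm), 'm \<Rightarrow> 'm) cat)" by (rule is_cat_EC)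
    show "fobj ?\<Gamma> X \<in> Obj EC" if "X \<in> Obj ?C" for X using obj that by (simp add: C)
    show "fmor ?\<Gamma> X Y f \<in> Mor EC (fobj ?\<Gamma> X) (fobj ?\<Gamma> Y)"
      if "X \<in> Obj ?C" "Y \<in> Obj ?C" "f \<in> Mor ?C X Y" for X Y f
      unfolding fm using that by (intro graded_hom_pushforward) (simp_all add: C)
  qed (simp_all add: fm fo C Idt_EC Cmp_EC PC)
  moreover have "is_functor EC ?C ?\<Delta>"
    unfolding is_functor_def
  proof (intro conjI ballI)
    show "is_cat ?C" by (rule is_cat_grMod)
    show "is_cat (EC :: (('b, 'm, 'h) graded \<times> (('a \<Rightarrow> 'k) \<Rightarrow> 'm \<Rightarrow> 'm), 'm \<Rightarrow> 'm) cat)" by (rule is_cat_EC)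
    show "fobj ?\<Delta> X \<in> Obj ?C" if X: "X \<in> Obj EC" for X
    proof (cases X)
      case (Pair X' \<alpha>)
      then show ?thesis
        using equivariant_module.graded_module_Eig[OF equivariant_moduleI] X by (simp add: C)
    qed
    show "fmor ?\<Delta> X Y f \<in> Mor ?C (fobj ?\<Delta> X) (fobj ?\<Delta> Y)"
      if "X \<in> Obj EC" "Y \<in> Obj EC" "f \<in> Mor EC X Y" for X Y f
      using that eigengraded_hom by (cases X; cases Y) (simp add: C)
    show "fmor ?\<Delta> X X (Idt EC X) = Idt ?C (fobj ?\<Delta> X)" for X
      by (cases X) (simp add: C Idt_EC EC)
    show "fmor ?\<Delta> X Z (Cmp EC X Y Z g f)
        = Cmp ?C (fobj ?\<Delta> X) (fobj ?\<Delta> Y) (fobj ?\<Delta> Z) (fmor ?\<Delta> Y Z g) (fmor ?\<Delta> X Y f)" for X Y Z f g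
      by (cases X; cases Y; cases Z) (simp add: C Cmp_EC EC)
  qed
  moreover have "left_inverse ?C ?\<Gamma> ?\<Delta>"
    using eigengraded_Gamma by (auto simp: left_inverse_def fm fo C)
  moreover have "left_inverse EC ?\<Delta> ?\<Gamma>"
    using equivariant_module.Gamma_Eig[OF equivariant_moduleI]
    by (auto simp: left_inverse_def fm)
  ultimately show ?thesis unfolding cat_isomorphism_def by blast
qed

text \<open>Both sides amount to finite presentability of one ungraded module over one ring, as
  \<open>R\<close> and \<open>Rb\<close> differ only in their gradings.\<close>

lemma fin_presented_pushforward:
  assumes "graded_module G Rb X"
  shows "fin_presented G Rb X \<longleftrightarrow> fin_presented H R (pushforward fst G H X)"
proof -
  interpret X: refinement_module K A H R Rb X by (rule refinement_moduleI[OF assms])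
  have "fin_pres R (pushforward fst G H X) \<longleftrightarrow> fin_pres Rb X"
    by (rule same_module_fin_pres[OF same_module_pushforward]) (auto simp: R_eq[symmetric] pushforward_def)
  then show ?thesis
    using RG.fin_presented_iff[OF assms] RH.fin_presented_iff[OF X.graded_module_pushforward] by simp
qed

text \<open>In the category on the left the maps \<open>\<alpha> \<chi>\<close> must be isomorphisms
  of finitely presented modules, so their targets, the twists of \<open>X\<close>, have to be
  finitely presented. This is automatic, since \<open>\<alpha> \<chi>\<close> makes them isomorphic
  to \<open>X\<close>.\<close>

lemma equivariant_fp_grMod:
  "equivariant_cat (char_group K A) (fp_grMod H R) (twisting_action K H A R Rb)
    = full_subcat EC (\<lambda>(X, \<alpha>). fin_presented H R X)" (is "?L = full_subcat ?E ?P")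
proof (rule cat.equality)
  have iso: "is_iso (fp_grMod H R) X Y f \<longleftrightarrow>
      is_iso (grMod H R) X Y f \<and> fin_presented H R X \<and> fin_presented H R Y" for X Y :: "('b, 'm, 'h) graded" and f
    by (auto simp: is_iso_def fp_grMod_def full_subcat_simps)
  have inv: "fin_presented H R Y" if "is_iso (grMod H R) X Y f" "fin_presented H R X"
    for X Y :: "('b, 'm, 'h) graded" and f
    using RH.fin_presented_iso[OF _ that(2,1)] that(1) by (simp add: is_iso_grMod)
  have "X \<in> Obj ?L \<longleftrightarrow> X \<in> Obj (full_subcat ?E ?P)" for X
  proof (cases X)
    case (Pair X' \<alpha>)
    have L: "X \<in> Obj ?L \<longleftrightarrow> graded_module H R X' \<and> fin_presented H R X' \<and> \<alpha> \<in> extensional characters \<and>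
        (\<forall>\<chi>\<in>characters. is_iso (fp_grMod H R) X' (twisted \<chi> X') (\<alpha> \<chi>)) \<and>
        (\<forall>\<chi>\<in>characters. \<forall>\<psi>\<in>characters. \<alpha> (\<chi> \<star> \<psi>) = compose (carrier X') (\<alpha> \<psi>) (\<alpha> \<chi>))"
      unfolding Pair by (simp add: equivariant_cat_def twisting_action_def)
        (simp add: fp_grMod_def full_subcat_simps grMod_def)
    have E: "X \<in> Obj (full_subcat ?E ?P) \<longleftrightarrow> (X', \<alpha>) \<in> Obj EC \<and> fin_presented H R X'"
      unfolding Pair full_subcat_simps by simp
    show ?thesis unfolding L E Obj_EC iso using inv by blast
  qed
  then show "Obj ?L = Obj (full_subcat ?E ?P)" by blast
qed (simp_all add: full_subcat_simps, simp_all add: equivariant_cat_def fp_grMod_def full_subcat_simps)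

end

theorem proposition5p7:
  fixes K :: "('k, 'w) ring_scheme" and H :: "('h, 'y) monoid_scheme"
    and A :: "('a, 'z) monoid_scheme"
    and R :: "('k, 'b, 'h) graded" and Rb :: "('k, 'b, 'h \<times> 'a) graded"
  assumes "field K"
    and "group H"
    and "graded_algebra K H R"
    and "comm_group A"
    and "finite (carrier A)"
    and "splitting_field K A"
    and "is_refinement K H A R Rb"
  shows "cat_isomorphism
           (grMod (H \<times>\<times> A) Rb :: (('b, 'm, 'h \<times> 'a) graded, 'm \<Rightarrow> 'm) cat)
           (equivariant_cat (char_group K A) (grMod H R) (twisting_action K H A R Rb))
           (Gamma K H A Rb) \<and>
         cat_isomorphism
           (fp_grMod (H \<times>\<times> A) Rb :: (('b, 'm, 'h \<times> 'a) graded, 'm \<Rightarrow> 'm) cat)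
           (equivariant_cat (char_group K A) (fp_grMod H R) (twisting_action K H A R Rb))
           (Gamma K H A Rb)"
proof
  interpret refinement_setup K A H R Rb
    using assms by (intro refinement_setup.intro split_char_setup.intro char_setup.intro
      split_char_setup_axioms.intro refinement_setup_axioms.intro)
  show iso: "cat_isomorphism (grMod (H \<times>\<times> A) Rb :: (('b, 'm, 'h \<times> 'a) graded, 'm \<Rightarrow> 'm) cat)
      (equivariant_cat (char_group K A) (grMod H R) (twisting_action K H A R Rb)) (Gamma K H A Rb)"
    by (rule Gamma_isomorphism)
  show "cat_isomorphism (fp_grMod (H \<times>\<times> A) Rb :: (('b, 'm, 'h \<times> 'a) graded, 'm \<Rightarrow> 'm) cat)
      (equivariant_cat (char_group K A) (fp_grMod H R) (twisting_action K H A R Rb)) (Gamma K H A Rb)"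
    \<comment> \<open>Both sides are now full subcategories, cut out by properties that correspond
      under \<open>Gamma\<close> by \<open>fin_presented_pushforward\<close>.\<close>
    unfolding equivariant_fp_grMod unfolding fp_grMod_def
    by (rule cat_isomorphism_full_subcat[OF iso])
      (simp add: Gamma_def grMod_def fin_presented_pushforward)
qed

end
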